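(* For every positive integer $n$ with $n \notin \{3,4\}$, the ReCom metagraph for dimer tilings of the even triangle of side length $n$ is connected. Moreover, the diameter of this metagraph is in $\Theta(n^2)$ (as a function of $n$).
   Context: The triangular lattice is the infinite planar graph in which each node has six neighbors; equivalently, its nodes are the cells of the hexagonal grid, with two cells adjacent when they share a side. Concretely, one may take the nodes to be $\mathbb{Z}^2$, with $(x,y)$ adjacent to $(x,y)\pm(1,0)$, $(x,y)\pm(0,1)$ and $(x,y)\pm(1,-1)$. The full triangle of side length $n$ is the subgraph of the triangular lattice induced by the nodes of an equilateral triangle with $n$ nodes along each side (e.g. $\{(x,y)\in\mathbb{Z}^2 : x\ge 0,\ y\ge 0,\ x+y\le n-1\}$ in the coordinates where the nodes are $\mathbb{Z}^2$ and $(x,y)$ is adjacent to $(x,y)\pm(1,0)$, $(x,y)\pm(0,1)$ and $(x,y)\pm(1,-1)$); it has $n(n+1)/2$ nodes. The clipped triangle of side length $n$ is the full triangle of side length $n$ with one corner node removed (the choice of corner is immaterial up to symmetry). The even triangle of side length $n$ is the full triangle of side length $n$ if $n \equiv 0,3 \pmod 4$, and the clipped triangle of side length $n$ if $n \equiv 1,2 \pmod 4$; thus it always has an even number of nodes. (For $n=1$ it is the empty graph, which has exactly one, empty, tiling.) A dimer tiling of a finite graph $G$ is a partition of its node set into tiles, each tile being a set of two adjacent nodes of $G$ (equivalently, a perfect matching of $G$). A ReCom move on a dimer tiling chooses two adjacent tiles (tiles joined by at least one edge of $G$), merges them into a set of four nodes, and re-splits this set into two tiles (each a pair of adjacent nodes),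 leaving all other tiles unchanged. The ReCom metagraph for dimer tilings of $G$ is the graph whose nodes are the dimer tilings of $G$, with two distinct tilings joined by an edge if and only if one can be obtained from the other by a single ReCom move. *)

theory Defs
  imports "Graph_Theory.Graph_Theory" "HOL-Library.Disjoint_Sets" "HOL-Library.Landau_Symbols"
begin

text \<open>Simple graphs are represented, as in the AFP entry \<open>Graph_Theory\<close>, by symmetric
  loop-free digraphs whose arcs are pairs of nodes (locale \<open>graph\<close> in the finite case).\<close>

definition triangular_lattice :: "(int \<times> int, (int \<times> int) \<times> (int \<times> int)) pre_digraph" where
  "triangular_lattice = with_proj
     \<lparr> pverts = UNIV,
       parcs = {((x, y), (x', y')).
         (x' - x, y' - y) \<in> {(1, 0), (-1, 0), (0, 1), (0, -1), (1, -1), (-1, 1)}} \<rparr>"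

definition full_triangle_nodes :: "nat \<Rightarrow> (int \<times> int) set" where
  "full_triangle_nodes n = {(x, y). x \<ge> 0 \<and> y \<ge> 0 \<and> x + y \<le> int n - 1}"

definition full_triangle :: "nat \<Rightarrow> (int \<times> int, (int \<times> int) \<times> (int \<times> int)) pre_digraph" where
  "full_triangle n = triangular_lattice \<restriction> full_triangle_nodes n"

text \<open>The corners of the full triangle are \<open>(0, 0)\<close>, \<open>(n - 1, 0)\<close> and \<open>(0, n - 1)\<close>. They are
  exchanged by symmetries of the lattice that preserve the triangle, and we remove the first.\<close>

definition clipped_triangle :: "nat \<Rightarrow> (int \<times> int, (int \<times> int) \<times> (int \<times> int)) pre_digraph" where
  "clipped_triangle n = triangular_lattice \<restriction> (full_triangle_nodes n - {(0, 0)})"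

definition even_triangle :: "nat \<Rightarrow> (int \<times> int, (int \<times> int) \<times> (int \<times> int)) pre_digraph" where
  "even_triangle n = (if n mod 4 \<in> {0, 3} then full_triangle n else clipped_triangle n)"

definition is_tile :: "('a, 'b) pre_digraph \<Rightarrow> 'a set \<Rightarrow> bool" where
  "is_tile G t \<longleftrightarrow> (\<exists>u v. t = {u, v} \<and> u \<rightarrow>\<^bsub>G\<^esub> v)"

definition dimer_tiling :: "('a, 'b) pre_digraph \<Rightarrow> 'a set set \<Rightarrow> bool" where
  "dimer_tiling G T \<longleftrightarrow> partition_on (verts G) T \<and> (\<forall>t\<in>T. is_tile G t)"

definition recom_move :: "('a, 'b) pre_digraph \<Rightarrow> 'a set set \<Rightarrow> 'a set set \<Rightarrow> bool" where
  "recom_move G T T' \<longleftrightarrow>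
     (\<exists>s t s' t'. s \<in> T \<and> t \<in> T \<and> s \<noteq> t \<and> (\<exists>u\<in>s. \<exists>v\<in>t. u \<rightarrow>\<^bsub>G\<^esub> v) \<and>
        is_tile G s' \<and> is_tile G t' \<and> s' \<inter> t' = {} \<and> s' \<union> t' = s \<union> t \<and>
        T' = (T - {s, t}) \<union> {s', t'})"

definition recom_metagraph ::
    "('a, 'b) pre_digraph \<Rightarrow> ('a set set, 'a set set \<times> 'a set set) pre_digraph" where
  "recom_metagraph G = with_proj
     \<lparr> pverts = {T. dimer_tiling G T},
       parcs = {(T, T'). dimer_tiling G T \<and> dimer_tiling G T' \<and> T \<noteq> T' \<and>
         (recom_move G T T' \<or> recom_move G T' T)} \<rparr>"

text \<open>With unit weights, \<open>\<mu>\<close> is the graph distance: the least length of a walk between two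
  nodes (infinite if there is none).\<close>

definition graph_diameter :: "('a, 'b) pre_digraph \<Rightarrow> ereal" where
  "graph_diameter G = (SUP (u, v) \<in> verts G \<times> verts G. wf_digraph.\<mu> G (\<lambda>_. 1) u v)"

lemma finite_full_triangle_nodes: "finite (full_triangle_nodes n)"
proof (rule finite_subset)
  show "full_triangle_nodes n \<subseteq> {0..int n} \<times> {0..int n}"
    by (auto simp: full_triangle_nodes_def)
qed simp

lemma graph_lattice_restriction:
  assumes "finite S"
  shows "graph (triangular_lattice \<restriction> S)"
proof
  show "finite (arcs (triangular_lattice \<restriction> S))"
  proof (rule finite_subset)
    show "arcs (triangular_lattice \<restriction> S) \<subseteq> S \<times> S"
      by (auto simp: triangular_lattice_def)
  qed (simp add: assms)
  show "symmetric (triangular_lattice \<restriction> S)"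
    by (force simp: symmetric_conv triangular_lattice_def)
qed (auto simp: triangular_lattice_def arc_to_ends_def assms)

lemma graph_even_triangle: "graph (even_triangle n)"
  by (simp add: even_triangle_def full_triangle_def clipped_triangle_def
      graph_lattice_restriction finite_full_triangle_nodes)

lemma graph_recom_metagraph:
  assumes "finite (verts G)"
  shows "graph (recom_metagraph G)"
proof -
  have "finite {T. dimer_tiling G T}"
  proof (rule finite_subset)
    show "{T. dimer_tiling G T} \<subseteq> Pow (Pow (verts G))"
      by (auto simp: dimer_tiling_def partition_on_def)
  qed (simp add: assms)
  then have fin: "finite (verts (recom_metagraph G))"
    by (simp add: recom_metagraph_def)
  show ?thesis
  proof
    show "finite (arcs (recom_metagraph G))"
    proof (rule finite_subset)
      show "arcs (recom_metagraph G) \<subseteq> verts (recom_metagraph G) \<times> verts (recom_metagraph G)"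
        by (auto simp: recom_metagraph_def)
    qed (simp add: fin)
    show "symmetric (recom_metagraph G)"
      by (force simp: symmetric_conv recom_metagraph_def)
  qed (use fin in \<open>auto simp: recom_metagraph_def arc_to_ends_def\<close>)
qed

end

theory Submission
  imports Defs
begin

text \<open>
  Merging two adjacent tiles and splitting them again changes a tiling only when the two tiles are
  opposite sides of a rhombus, which are then replaced by the other two sides. Such
  \<^emph>\<open>flips\<close> suffice to connect the tilings.

  The regions considered are \<open>region l r\<close>: a triangle of side \<open>l + r + 1\<close> whose bottom row has lost
  its first \<open>l\<close> nodes, with the origin placed at the first node that is left in that row. The heart
  of the proof is a local statement (\<open>corner_tile\<close>): if the triangle has side at least \<open>6\<close> and the
  bottom row still has at least two nodes, then a bounded number of flips, with a bound that depends
  on neither \<open>l\<close> nor \<open>r\<close>, turns any tiling of the region into one that contains the tile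
  \<open>{(0, 0), (1, 0)}\<close>. A finite decision tree shows it: ask for the partner of one node near the origin
  after the other, and, if necessary, whether the left or the right side of the triangle is close,
  until the tiles that have been seen admit a sequence of flips that creates the desired tile.
  The tree is given explicitly (\<open>corner_cert\<close>) and a verified checker accepts it
  (\<open>check_sound\<close>, \<open>corner_ok\<close>).

  Removing the tile \<open>{(0, 0), (1, 0)}\<close> from \<open>region l r\<close> leaves a translate of
  \<open>region (l + 2) (r - 2)\<close>. Hence the bottom row can be fixed tile by tile. If it has an even number
  of nodes, the full triangle of the next smaller side remains. If it has an odd number of nodes, its
  last node can only be matched to the end of the second row, and what remains is a mirror image of
  the clipped triangle of the next smaller side. In either case an even triangle of side \<open>n\<close> is reduced
  to the even triangle of side \<open>n - 1\<close>, as one sees from the four residues of \<open>n\<close> modulo \<open>4\<close>. The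
  induction starts at \<open>n = 5\<close>, where a second decision tree (\<open>base_cert\<close>) connects every tiling
  to a fixed one. Every tile costs a bounded number of flips, so two tilings are \<open>O(n\<^sup>2)\<close> flips apart.

  For the lower bound, the same induction yields a tiling with at most \<open>n + 2\<close> tiles that are not
  horizontal. Exchanging the two coordinates turns it into a tiling with at most \<open>n + 2\<close>
  horizontal tiles. There are about \<open>n\<^sup>2 / 4\<close> tiles, and a ReCom move replaces only two of them, so
  these two tilings are \<open>\<Omega>(n\<^sup>2)\<close> moves apart.
\<close>

section \<open>The triangular lattice and its dimer tilings\<close>

type_synonym node = "int \<times> int"

text \<open>The six directions of the lattice, in counterclockwise order.\<close>

datatype dir = E | NE | NW | W | SW | SE

fun step :: "dir \<Rightarrow> node \<Rightarrow> node" where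
  "step E (x, y) = (x + 1, y)"
| "step NE (x, y) = (x, y + 1)"
| "step NW (x, y) = (x - 1, y + 1)"
| "step W (x, y) = (x - 1, y)"
| "step SW (x, y) = (x, y - 1)"
| "step SE (x, y) = (x + 1, y - 1)"

definition adj :: "node \<Rightarrow> node \<Rightarrow> bool" where
  "adj p q \<longleftrightarrow> (\<exists>d. q = step d p)"

lemma adj_iff:
  "adj (x, y) (x', y') \<longleftrightarrow>
     (x' - x, y' - y) \<in> {(1, 0), (-1, 0), (0, 1), (0, -1), (1, -1), (-1, 1)}"
proof
  assume "adj (x, y) (x', y')"
  then obtain d where "(x', y') = step d (x, y)"
    by (auto simp: adj_def)
  then show "(x' - x, y' - y) \<in> {(1, 0), (-1, 0), (0, 1), (0, -1), (1, -1), (-1, 1)}"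
    by (cases d) auto
next
  assume h: "(x' - x, y' - y) \<in> {(1, 0), (-1, 0), (0, 1), (0, -1), (1, -1), (-1, 1)}"
  define a b where "a = x' - x" and "b = y' - y"
  have xy: "x' = x + a" "y' = y + b"
    by (simp_all add: a_def b_def)
  have "(a, b) \<in> {(1, 0), (-1, 0), (0, 1), (0, -1), (1, -1), (-1, 1)}"
    using h by (simp only: a_def b_def)
  then have "(x', y') \<in> {step E (x, y), step NE (x, y), step NW (x, y),
      step W (x, y), step SW (x, y), step SE (x, y)}"
    unfolding xy by auto
  then show "adj (x, y) (x', y')"
    unfolding adj_def by blast
qed

lemma adj_sym: "adj p q \<Longrightarrow> adj q p"
  by (cases p, cases q) (auto simp: adj_iff)

lemma adj_irrefl: "\<not> adj p p"
  by (cases p) (auto simp: adj_iff)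

lemma adj_step: "adj p (step d p)"
  by (auto simp: adj_def)

lemma adj_cases:
  assumes "adj (x, y) q"
  obtains "q = (x + 1, y)" | "q = (x, y + 1)" | "q = (x - 1, y + 1)"
    | "q = (x - 1, y)" | "q = (x, y - 1)" | "q = (x + 1, y - 1)"
proof -
  obtain d where "q = step d (x, y)"
    using assms by (auto simp: adj_def)
  then show ?thesis using that by (cases d) auto
qed

text \<open>A dimer tiling of the subgraph of the triangular lattice that is induced by \<open>S\<close>.\<close>

definition tiling :: "node set \<Rightarrow> node set set \<Rightarrow> bool" where
  "tiling S T \<longleftrightarrow> partition_on S T \<and> (\<forall>t\<in>T. \<exists>p q. t = {p, q} \<and> adj p q)"

lemma tiling_Union: "tiling S T \<Longrightarrow> \<Union>T = S"
  by (simp add: tiling_def partition_on_def)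

lemma tiling_eq: "tiling S T \<Longrightarrow> t \<in> T \<Longrightarrow> u \<in> T \<Longrightarrow> p \<in> t \<Longrightarrow> p \<in> u \<Longrightarrow> t = u"
  unfolding tiling_def partition_on_def disjoint_def by blast

lemma tiling_adj: "tiling S T \<Longrightarrow> {p, q} \<in> T \<Longrightarrow> adj p q"
  unfolding tiling_def by (metis adj_sym doubleton_eq_iff)

lemma tiling_tile:
  assumes "tiling S T" "t \<in> T" "p \<in> t"
  obtains q where "t = {p, q}" "adj p q"
proof -
  obtain a b where ab: "t = {a, b}" "adj a b"
    using assms(1,2) unfolding tiling_def by blast
  then have "p = a \<or> p = b" using assms(3) by auto
  then show ?thesis
    using that[of b] that[of a] ab adj_sym[of a b] by (auto simp: insert_commute)
qed

lemma tilingI: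
  assumes "\<Union>T = S"
    and "\<And>t. t \<in> T \<Longrightarrow> \<exists>p q. t = {p, q} \<and> adj p q"
    and "\<And>t u p. t \<in> T \<Longrightarrow> u \<in> T \<Longrightarrow> p \<in> t \<Longrightarrow> p \<in> u \<Longrightarrow> t = u"
  shows "tiling S T"
proof -
  have "{} \<notin> T" using assms(2) by blast
  moreover have "disjoint T"
    unfolding disjoint_def using assms(3) by blast
  ultimately show ?thesis
    using assms(1,2) by (auto simp: tiling_def partition_on_def)
qed

lemma tiling_subset_eq:
  assumes "tiling S T" "tiling S U" "U \<subseteq> T"
  shows "U = T"
proof
  show "T \<subseteq> U"
  proof
    fix t assume t: "t \<in> T"
    obtain p where p: "p \<in> t"
      using t assms(1) unfolding tiling_def by blast
    then have "p \<in> S"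
      using t tiling_Union[OF assms(1)] by blast
    then obtain u where "u \<in> U" "p \<in> u"
      using tiling_Union[OF assms(2)] by blast
    then show "t \<in> U"
      using tiling_eq[OF assms(1) t _ p] assms(3) by blast
  qed
qed fact

section \<open>Flips\<close>

text \<open>Two disjoint tiles \<open>{a, b}\<close> and \<open>{c, e}\<close> are replaced by \<open>{a, c}\<close> and \<open>{b, e}\<close>.\<close>

definition flip :: "node set set \<Rightarrow> node set set \<Rightarrow> bool" where
  "flip T T' \<longleftrightarrow> (\<exists>a b c e. {a, b} \<in> T \<and> {c, e} \<in> T \<and> {a, b} \<inter> {c, e} = {} \<and>
     adj a c \<and> adj b e \<and> T' = (T - {{a, b}, {c, e}}) \<union> {{a, c}, {b, e}})"

lemma flip_tiling:
  assumes T: "tiling S T" and "flip T T'"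
  shows "tiling S T'"
proof -
  obtain a b c e where h: "{a, b} \<in> T" "{c, e} \<in> T" "{a, b} \<inter> {c, e} = {}" "adj a c" "adj b e"
    and T': "T' = (T - {{a, b}, {c, e}}) \<union> {{a, c}, {b, e}}"
    using assms(2) unfolding flip_def by blast
  have ne: "a \<noteq> b" "c \<noteq> e"
    using tiling_adj[OF T h(1)] tiling_adj[OF T h(2)] adj_irrefl by metis+
  have away: "a \<notin> t \<and> b \<notin> t \<and> c \<notin> t \<and> e \<notin> t" if "t \<in> T - {{a, b}, {c, e}}" for t
    using that tiling_eq[OF T _ h(1)] tiling_eq[OF T _ h(2)] by blast
  have U: "\<Union>T = \<Union>(T - {{a, b}, {c, e}}) \<union> {a, b, c, e}"
    using h by blast
  show ?thesis
  proof (rule tilingI)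
    show "\<Union>T' = S"
      using U tiling_Union[OF T] unfolding T' by auto
    show "\<exists>p q. t = {p, q} \<and> adj p q" if "t \<in> T'" for t
      using that T h(4,5) unfolding T' tiling_def by blast
    show "t = u" if tu: "t \<in> T'" "u \<in> T'" and p: "p \<in> t" "p \<in> u" for t u p
    proof (cases "p \<in> {a, b, c, e}")
      case True
      have "t' \<in> {{a, c}, {b, e}}" if "t' \<in> T'" "p \<in> t'" for t'
      proof -
        have "t' \<notin> T - {{a, b}, {c, e}}"
        proof
          assume "t' \<in> T - {{a, b}, {c, e}}"
          from away[OF this] True that(2) show False by auto
        qed
        then show ?thesis using that(1) unfolding T' by (simp only: Un_iff) simp
      qed
      then have "t \<in> {{a, c}, {b, e}}" "u \<in> {{a, c}, {b, e}}"
        using tu p by auto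
      then show ?thesis using p h(3) ne by auto
    next
      case False
      then have "t \<in> T" "u \<in> T"
        using tu p unfolding T' by auto
      then show ?thesis using tiling_eq[OF T] p by blast
    qed
  qed
qed

lemma flip_sym:
  assumes T: "tiling S T" and "flip T T'"
  shows "flip T' T"
proof -
  obtain a b c e where h: "{a, b} \<in> T" "{c, e} \<in> T" "{a, b} \<inter> {c, e} = {}" "adj a c" "adj b e"
    and T': "T' = (T - {{a, b}, {c, e}}) \<union> {{a, c}, {b, e}}"
    using assms(2) unfolding flip_def by blast
  have adj: "adj a b" "adj c e"
    using tiling_adj[OF T] h by auto
  then have ne: "a \<noteq> b" "c \<noteq> e"
    using adj_irrefl by metis+
  have "{a, c} \<notin> T" "{b, e} \<notin> T"
    using tiling_eq[OF T h(1), of "{a, c}" a] tiling_eq[OF T h(1), of "{b, e}" b] h(3)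
    by (auto simp: doubleton_eq_iff)
  then have "T = (T' - {{a, c}, {b, e}}) \<union> {{a, b}, {c, e}}"
    using h unfolding T' by blast
  moreover have "{a, c} \<inter> {b, e} = {}"
    using ne h(3) by auto
  ultimately show ?thesis
    unfolding flip_def using adj T' by blast
qed

text \<open>\<open>T'\<close> can be reached from \<open>T\<close> by at most \<open>n\<close> flips.\<close>

definition flips_within :: "nat \<Rightarrow> node set set \<Rightarrow> node set set \<Rightarrow> bool" where
  "flips_within n T T' \<longleftrightarrow> (\<exists>m\<le>n. (flip ^^ m) T T')"

lemma flips_within_refl: "flips_within n T T"
  unfolding flips_within_def by (intro exI[of _ 0]) simp

lemma flips_within_mono: "flips_within m T T' \<Longrightarrow> m \<le> n \<Longrightarrow> flips_within n T T'"
  unfolding flips_within_def using le_trans by blast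

lemma flips_within_trans:
  assumes "flips_within m T U" "flips_within n U V"
  shows "flips_within (m + n) T V"
proof -
  obtain i j where "i \<le> m" "(flip ^^ i) T U" "j \<le> n" "(flip ^^ j) U V"
    using assms unfolding flips_within_def by blast
  then have "(flip ^^ (i + j)) T V" "i + j \<le> m + n"
    by (auto simp: relpowp_add)
  then show ?thesis unfolding flips_within_def by blast
qed

lemma flips_within_flip:
  assumes "flip T U" "flips_within n U V"
  shows "flips_within (Suc n) T V"
proof -
  have "flips_within (Suc 0) T U"
    unfolding flips_within_def using assms(1) by (intro exI[of _ "Suc 0"]) auto
  from flips_within_trans[OF this assms(2)] show ?thesis by simp
qed

lemma relpowp_flip_tiling:
  assumes "tiling S T" "(flip ^^ m) T T'"
  shows "tiling S T'" "(flip ^^ m) T' T"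
proof -
  have "tiling S T' \<and> (flip ^^ m) T' T"
    using assms(2)
  proof (induction m arbitrary: T')
    case 0
    then show ?case using assms(1) by simp
  next
    case (Suc m)
    then obtain U where U: "(flip ^^ m) T U" "flip U T'"
      by (auto elim: relpowp_Suc_E)
    have IH: "tiling S U" "(flip ^^ m) U T"
      using Suc.IH[OF U(1)] by auto
    then have "tiling S T'" "flip T' U"
      using flip_tiling flip_sym U(2) by blast+
    then show ?case
      using IH(2) relpowp_Suc_I2[of flip T' U m T] by simp
  qed
  then show "tiling S T'" "(flip ^^ m) T' T" by auto
qed

lemma flips_within_tiling: "flips_within n T T' \<Longrightarrow> tiling S T \<Longrightarrow> tiling S T'"
  unfolding flips_within_def using relpowp_flip_tiling(1) by blast

lemma flips_within_sym: "flips_within n T T' \<Longrightarrow> tiling S T \<Longrightarrow> flips_within n T' T"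
  unfolding flips_within_def using relpowp_flip_tiling(2) by blast

lemma tiling_insert:
  assumes T: "tiling (S - {v, w}) T" and S: "{v, w} \<subseteq> S" and "adj v w"
  shows "tiling S (insert {v, w} T)"
proof (rule tilingI)
  have U: "\<Union>T = S - {v, w}" using tiling_Union[OF T] .
  then show "\<Union>(insert {v, w} T) = S" using S by auto
  show "\<exists>p q. t = {p, q} \<and> adj p q" if "t \<in> insert {v, w} T" for t
    using that assms(3) T unfolding tiling_def by blast
  show "t = u" if "t \<in> insert {v, w} T" "u \<in> insert {v, w} T" "p \<in> t" "p \<in> u" for t u p
    using that U tiling_eq[OF T] by blast
qed

lemma tiling_remove:
  assumes T: "tiling S T" and t: "{v, w} \<in> T"
  shows "tiling (S - {v, w}) (T - {{v, w}})"
proof (rule tilingI)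
  have "{v, w} \<inter> t' = {}" if "t' \<in> T - {{v, w}}" for t'
    using that tiling_eq[OF T _ t] by blast
  then show "\<Union>(T - {{v, w}}) = S - {v, w}"
    using tiling_Union[OF T] by blast
  show "\<exists>p q. t' = {p, q} \<and> adj p q" if "t' \<in> T - {{v, w}}" for t'
    using that T unfolding tiling_def by blast
  show "t' = u" if "t' \<in> T - {{v, w}}" "u \<in> T - {{v, w}}" "p \<in> t'" "p \<in> u" for t' u p
    using that tiling_eq[OF T] by blast
qed

lemma flip_insert:
  assumes "flip T T'" "v \<notin> \<Union>T"
  shows "flip (insert {v, w} T) (insert {v, w} T')"
proof -
  obtain a b c e where h: "{a, b} \<in> T" "{c, e} \<in> T" "{a, b} \<inter> {c, e} = {}" "adj a c" "adj b e"
    and T': "T' = (T - {{a, b}, {c, e}}) \<union> {{a, c}, {b, e}}"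
    using assms(1) unfolding flip_def by blast
  have "{v, w} \<noteq> {a, b}" "{v, w} \<noteq> {c, e}"
    using assms(2) h(1,2) by blast+
  then have "insert {v, w} T' = (insert {v, w} T - {{a, b}, {c, e}}) \<union> {{a, c}, {b, e}}"
    unfolding T' by (simp add: insert_Diff_if insert_commute)
  then show ?thesis
    unfolding flip_def using h by blast
qed

lemma flips_within_insert:
  assumes "tiling (S - {v, w}) T" "flips_within n T T'"
  shows "flips_within n (insert {v, w} T) (insert {v, w} T')"
proof -
  obtain m where m: "m \<le> n" "(flip ^^ m) T T'"
    using assms(2) unfolding flips_within_def by blast
  have "(flip ^^ m) (insert {v, w} T) (insert {v, w} T')"
    using m(2)
  proof (induction m arbitrary: T')
    case 0
    then show ?case by simp
  next
    case (Suc m)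
    then obtain U where U: "(flip ^^ m) T U" "flip U T'"
      by (auto elim: relpowp_Suc_E)
    have "tiling (S - {v, w}) U"
      using relpowp_flip_tiling(1)[OF assms(1) U(1)] .
    then have "\<Union>U = S - {v, w}" by (rule tiling_Union)
    then have "v \<notin> \<Union>U" by simp
    from relpowp_Suc_I[OF Suc.IH[OF U(1)] flip_insert[OF U(2) this]] show ?case .
  qed
  then show ?thesis
    using m(1) unfolding flips_within_def by blast
qed

section \<open>Symmetries of the lattice\<close>

text \<open>An automorphism of the triangular lattice.\<close>

definition symmetry :: "(node \<Rightarrow> node) \<Rightarrow> bool" where
  "symmetry f \<longleftrightarrow> bij f \<and> (\<forall>p q. adj (f p) (f q) \<longleftrightarrow> adj p q)"

lemma symmetry_inv:
  assumes "symmetry f"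
  shows "symmetry (inv f)"
  unfolding symmetry_def
proof (intro conjI allI)
  have bij: "bij f" and adj: "\<And>p q. adj (f p) (f q) \<longleftrightarrow> adj p q"
    using assms unfolding symmetry_def by blast+
  show "bij (inv f)" using bij by (rule bij_imp_bij_inv)
  have "f (inv f p) = p" for p
    using bij by (simp add: bij_is_surj surj_f_inv_f)
  then show "adj (inv f p) (inv f q) \<longleftrightarrow> adj p q" for p q
    using adj[of "inv f p" "inv f q"] by simp
qed

lemma tiling_image:
  assumes f: "symmetry f" and T: "tiling S T"
  shows "tiling (f ` S) ((`) f ` T)"
proof (rule tilingI)
  have inj: "inj f" using f by (simp add: symmetry_def bij_is_inj)
  show "\<Union>((`) f ` T) = f ` S" using tiling_Union[OF T] by auto
  show "\<exists>p q. t = {p, q} \<and> adj p q" if t: "t \<in> (`) f ` T" for t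
  proof -
    obtain t' where t': "t' \<in> T" "t = f ` t'"
      using t by blast
    obtain p q where "t' = {p, q}" "adj p q"
      using T t'(1) unfolding tiling_def by blast
    then have "t = {f p, f q}" "adj (f p) (f q)"
      using f t'(2) unfolding symmetry_def by (simp, blast)
    then show ?thesis by blast
  qed
  show "t = u" if h: "t \<in> (`) f ` T" "u \<in> (`) f ` T" "p \<in> t" "p \<in> u" for t u p
  proof -
    obtain t' u' where tu: "t' \<in> T" "t = f ` t'" "u' \<in> T" "u = f ` u'"
      using h(1,2) by blast
    obtain q q' where q: "q \<in> t'" "p = f q" "q' \<in> u'" "p = f q'"
      using h(3,4) tu by blast
    then have "q = q'" using injD[OF inj] by blast
    then have "t' = u'"
      using tiling_eq[OF T tu(1,3)] q by blast
    then show ?thesis using tu by simp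
  qed
qed

lemma flip_image:
  assumes f: "symmetry f" and "flip T T'"
  shows "flip ((`) f ` T) ((`) f ` T')"
proof -
  have inj: "inj f" using f by (simp add: symmetry_def bij_is_inj)
  have inj2: "inj ((`) f)" using inj by (simp add: inj_image_eq_iff inj_def)
  obtain a b c e where h: "{a, b} \<in> T" "{c, e} \<in> T" "{a, b} \<inter> {c, e} = {}" "adj a c" "adj b e"
    and T': "T' = (T - {{a, b}, {c, e}}) \<union> {{a, c}, {b, e}}"
    using assms(2) unfolding flip_def by blast
  have "(`) f ` T' = ((`) f ` T - {{f a, f b}, {f c, f e}}) \<union> {{f a, f c}, {f b, f e}}"
    unfolding T' using image_set_diff[OF inj2] by (simp add: image_Un)
  moreover have "{f a, f b} \<in> (`) f ` T" "{f c, f e} \<in> (`) f ` T"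
    using imageI[OF h(1), of "(`) f"] imageI[OF h(2), of "(`) f"] by simp_all
  moreover have "{f a, f b} \<inter> {f c, f e} = {}"
    using h(3) inj by (auto dest: injD)
  moreover have "adj (f a) (f c)" "adj (f b) (f e)"
    using f h(4,5) unfolding symmetry_def by blast+
  ultimately show ?thesis
    unfolding flip_def by blast
qed

lemma flips_within_image:
  assumes f: "symmetry f" and "flips_within n T T'"
  shows "flips_within n ((`) f ` T) ((`) f ` T')"
proof -
  have "(flip ^^ m) ((`) f ` T) ((`) f ` T')" if "(flip ^^ m) T T'" for m
    using that
  proof (induction m arbitrary: T')
    case (Suc m)
    then obtain U where U: "(flip ^^ m) T U" "flip U T'"
      by (auto elim: relpowp_Suc_E)
    from relpowp_Suc_I[OF Suc.IH[OF U(1)] flip_image[OF f U(2)]] show ?case .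
  qed simp
  then show ?thesis using assms(2) unfolding flips_within_def by blast
qed

lemma symmetryI:
  assumes "\<And>p. g (f p) = p" "\<And>p. f (g p) = p" "\<And>p q. adj (f p) (f q) \<longleftrightarrow> adj p q"
  shows "symmetry f"
  unfolding symmetry_def using assms by (metis bij_betw_byWitness subset_UNIV)

definition shift :: "int \<Rightarrow> int \<Rightarrow> node \<Rightarrow> node" where
  "shift a b = (\<lambda>(x, y). (x + a, y + b))"

text \<open>The reflection of the lattice in a vertical line; it maps each horizontal row to itself.\<close>

definition mirror :: "node \<Rightarrow> node" where
  "mirror = (\<lambda>(x, y). (- x - y, y))"

lemma symmetry_shift: "symmetry (shift a b)"
proof (rule symmetryI[of "shift (- a) (- b)"])
  show "adj (shift a b p) (shift a b q) \<longleftrightarrow> adj p q" for p q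
    by (cases p; cases q) (simp add: shift_def adj_iff)
qed (auto simp: shift_def)

lemma symmetry_mirror: "symmetry mirror"
proof (rule symmetryI[of mirror])
  have *: "adj (mirror p) (mirror q)" if "adj p q" for p q
  proof (cases p)
    case (Pair x y)
    have "adj (x, y) q" using that Pair by simp
    then show ?thesis
      by (cases rule: adj_cases) (simp_all add: Pair mirror_def adj_iff)
  qed
  show inv: "mirror (mirror p) = p" for p
    by (cases p) (simp add: mirror_def)
  show "mirror (mirror p) = p" for p by (rule inv)
  show "adj (mirror p) (mirror q) \<longleftrightarrow> adj p q" for p q
    using *[of p q] *[of "mirror p" "mirror q"] by (auto simp: inv)
qed

lemma shift_image: "shift a b ` S = {(x, y). (x - a, y - b) \<in> S}"
  by (force simp: shift_def)

lemma mirror_image: "mirror ` S = {(x, y). (- x - y, y) \<in> S}"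
  by (force simp: mirror_def)

lemma symmetry_swap: "symmetry prod.swap"
proof (rule symmetryI[of prod.swap])
  show "adj (prod.swap p) (prod.swap q) \<longleftrightarrow> adj p q" for p q :: node
    by (cases p; cases q) (auto simp: adj_iff)
qed simp_all

section \<open>Connecting tilings by flips\<close>

text \<open>A tile is level if it is horizontal, that is, if its nodes lie in the same row.\<close>

definition level :: "node set \<Rightarrow> bool" where
  "level t \<longleftrightarrow> (\<forall>p\<in>t. \<forall>q\<in>t. snd p = snd q)"

text \<open>Any two tilings of \<open>S\<close> are at most \<open>K\<close> flips apart, and \<open>S\<close> has a tiling with at most \<open>k\<close>
  tiles that are not level. The two statements are kept together since they are proved by the same
  induction; the second one is what the lower bound on the diameter needs.\<close>

definition connects :: "node set \<Rightarrow> nat \<Rightarrow> nat \<Rightarrow> bool" where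
  "connects S K k \<longleftrightarrow>
     (\<exists>T. tiling S T \<and> card {t \<in> T. \<not> level t} \<le> k) \<and>
     (\<forall>T T'. tiling S T \<longrightarrow> tiling S T' \<longrightarrow> flips_within K T T')"

lemma connects_mono: "connects S K k \<Longrightarrow> K \<le> K' \<Longrightarrow> k \<le> k' \<Longrightarrow> connects S K' k'"
  unfolding connects_def using le_trans[of _ k k'] flips_within_mono[of K _ _ K'] by blast

text \<open>If every tiling of \<open>S\<close> is at most \<open>C\<close> flips away from one that contains the tile \<open>{v, w}\<close>, then
  two tilings of \<open>S\<close> are connected by first creating this tile in both of them and then working in the
  rest of \<open>S\<close>.\<close>

lemma connects_peel:
  assumes vw: "{v, w} \<subseteq> S" "adj v w"
    and C: "\<And>T. tiling S T \<Longrightarrow> \<exists>T'. flips_within C T T' \<and> {v, w} \<in> T'"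
    and IH: "connects (S - {v, w}) K k"
  shows "connects S (K + 2 * C) (k + of_bool (\<not> level {v, w}))"
  unfolding connects_def
proof (intro conjI allI impI)
  obtain T where T: "tiling (S - {v, w}) T" "card {t \<in> T. \<not> level t} \<le> k"
    using IH unfolding connects_def by blast
  have "{t \<in> insert {v, w} T. \<not> level t} =
      (if level {v, w} then {t \<in> T. \<not> level t} else insert {v, w} {t \<in> T. \<not> level t})"
    by auto
  then have "card {t \<in> insert {v, w} T. \<not> level t} \<le> k + of_bool (\<not> level {v, w})"
    using T(2) card_insert_le_m1[of "Suc k" "{t \<in> T. \<not> level t}" "{v, w}"] by auto
  then show "\<exists>T. tiling S T \<and> card {t \<in> T. \<not> level t} \<le> k + of_bool (\<not> level {v, w})"
    using tiling_insert[OF T(1) vw] by blast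
next
  fix T T' assume T: "tiling S T" and T': "tiling S T'"
  obtain U where U: "flips_within C T U" "{v, w} \<in> U" using C[OF T] by blast
  obtain U' where U': "flips_within C T' U'" "{v, w} \<in> U'" using C[OF T'] by blast
  have r: "tiling (S - {v, w}) (U - {{v, w}})" "tiling (S - {v, w}) (U' - {{v, w}})"
    using tiling_remove flips_within_tiling[OF U(1) T] flips_within_tiling[OF U'(1) T'] U(2) U'(2) by auto
  then have "flips_within K (U - {{v, w}}) (U' - {{v, w}})"
    using IH unfolding connects_def by blast
  from flips_within_insert[OF r(1) this] have "flips_within K U U'"
    using U(2) U'(2) by (simp add: insert_absorb)
  then have "flips_within (C + (K + C)) T T'"
    using flips_within_trans[OF U(1) flips_within_trans] flips_within_sym[OF U'(1) T'] by blast
  then show "flips_within (K + 2 * C) T T'"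
    by (rule flips_within_mono) simp
qed

lemma connects_image:
  assumes f: "symmetry f" "\<And>p q. snd (f p) = snd (f q) \<longleftrightarrow> snd p = snd q"
    and c: "connects S K k"
  shows "connects (f ` S) K k"
  unfolding connects_def
proof (intro conjI allI impI)
  have bij: "bij f" using f(1) by (simp add: symmetry_def)
  obtain T where T: "tiling S T" "card {t \<in> T. \<not> level t} \<le> k"
    using c unfolding connects_def by blast
  have "level (f ` t) \<longleftrightarrow> level t" for t
    using f(2) by (auto simp: level_def)
  then have "{t \<in> (`) f ` T. \<not> level t} = (`) f ` {t \<in> T. \<not> level t}"
    by auto
  moreover have "inj_on ((`) f) {t \<in> T. \<not> level t}"
    using bij by (meson bij_is_inj inj_image_eq_iff inj_onI)
  ultimately have "card {t \<in> (`) f ` T. \<not> level t} \<le> k"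
    using T(2) by (simp add: card_image)
  then show "\<exists>T. tiling (f ` S) T \<and> card {t \<in> T. \<not> level t} \<le> k"
    using tiling_image[OF f(1) T(1)] by blast
  fix T T' assume TT: "tiling (f ` S) T" "tiling (f ` S) T'"
  have pull: "tiling S ((`) (inv f) ` T)" if "tiling (f ` S) T" for T
    using tiling_image[OF symmetry_inv[OF f(1)] that] bij by (simp add: bij_is_inj image_comp)
  have "flips_within K ((`) (inv f) ` T) ((`) (inv f) ` T')"
    using c pull[OF TT(1)] pull[OF TT(2)] unfolding connects_def by blast
  from flips_within_image[OF f(1) this] show "flips_within K T T'"
    using bij by (simp add: image_comp image_image surj_f_inv_f bij_is_surj)
qed

lemma connects_shift: "connects S K k \<Longrightarrow> connects (shift a b ` S) K k"
  by (rule connects_image[OF symmetry_shift]) (auto simp: shift_def)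

lemma connects_mirror: "connects S K k \<Longrightarrow> connects (mirror ` S) K k"
  by (rule connects_image[OF symmetry_mirror]) (auto simp: mirror_def)

section \<open>Regions and decision trees\<close>

text \<open>Membership in \<open>region l r\<close>. The set is cut out by the bottom row, the start of the bottom row at
  the origin, the left side \<open>x = - l\<close> and the right side \<open>x + y = r\<close>.\<close>

fun inside :: "int \<Rightarrow> int \<Rightarrow> node \<Rightarrow> bool" where
  "inside l r (x, y) \<longleftrightarrow> 0 \<le> y \<and> (0 < y \<or> 0 \<le> x) \<and> - l \<le> x \<and> x + y \<le> r"

definition region :: "int \<Rightarrow> int \<Rightarrow> node set" where
  "region l r = {p. inside l r p}"

text \<open>A list of tiles; each tile is given by its two nodes in either order.\<close>

type_synonym config = "(node \<times> node) list"

text \<open>A certificate is a decision tree for a region \<open>region L R\<close> and an unknown tiling of it, of which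
  some tiles are already known. \<open>Ask x y\<close> asks for the partner of the node \<open>(x, y)\<close> and has one
  subtree for each direction, in the order of \<open>dir\<close>. \<open>SplitL\<close> and \<open>SplitR\<close> distinguish whether \<open>L\<close> or
  \<open>R\<close> equals the lower bound known so far or exceeds it. \<open>Done\<close> lists flips of known tiles that
  create the wanted tiles: the entry \<open>(x, y, d, e)\<close> stands for the rhombus at \<open>(x, y)\<close> with sides in
  the directions \<open>d\<close> and \<open>e\<close>, whose two sides in direction \<open>d\<close> are exchanged for those in direction
  \<open>e\<close>. \<open>Void\<close> marks a branch that cannot occur, in
  particular a direction in which no partner is possible.\<close>

datatype cert =
    Done "(int \<times> int \<times> dir \<times> dir) list"
  | Ask int int cert cert cert cert cert cert
  | SplitL cert cert
  | SplitR cert cert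
  | Void

fun has_tile :: "config \<Rightarrow> node \<Rightarrow> node \<Rightarrow> bool" where
  "has_tile [] a b \<longleftrightarrow> False"
| "has_tile ((p, q) # K) a b \<longleftrightarrow> p = a \<and> q = b \<or> p = b \<and> q = a \<or> has_tile K a b"

fun drop_tile :: "config \<Rightarrow> node \<Rightarrow> config" where
  "drop_tile [] a = []"
| "drop_tile ((p, q) # K) a = (if p = a \<or> q = a then drop_tile K a else (p, q) # drop_tile K a)"

fun covers :: "config \<Rightarrow> node \<Rightarrow> bool" where
  "covers [] a \<longleftrightarrow> False"
| "covers ((p, q) # K) a \<longleftrightarrow> p = a \<or> q = a \<or> covers K a"

fun has_tiles :: "config \<Rightarrow> config \<Rightarrow> bool" where
  "has_tiles K [] \<longleftrightarrow> True"
| "has_tiles K ((a, b) # G) \<longleftrightarrow> has_tile K a b \<and> has_tiles K G"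

definition can_flip :: "config \<Rightarrow> node \<Rightarrow> dir \<Rightarrow> dir \<Rightarrow> bool" where
  "can_flip K a d e \<longleftrightarrow> has_tile K a (step d a) \<and> has_tile K (step e a) (step e (step d a))"

text \<open>The two tiles to be replaced are those at the nodes \<open>a\<close> and \<open>step e a\<close>.\<close>

definition do_flip :: "config \<Rightarrow> node \<Rightarrow> dir \<Rightarrow> dir \<Rightarrow> config" where
  "do_flip K a d e = (a, step e a) # (step d a, step e (step d a)) #
     drop_tile (drop_tile K a) (step e a)"

fun check_flips :: "config \<Rightarrow> config \<Rightarrow> (int \<times> int \<times> dir \<times> dir) list \<Rightarrow> bool" where
  "check_flips G K [] \<longleftrightarrow> has_tiles K G"
| "check_flips G K ((x, y, d, e) # fs) \<longleftrightarrow>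
     can_flip K (x, y) d e \<and> check_flips G (do_flip K (x, y) d e) fs"

text \<open>The node cannot be the partner of a node that is asked for: either it certainly lies outside the
  region, or it is covered by a known tile. The flags \<open>el\<close> and \<open>er\<close> tell whether the bounds \<open>l\<close> and
  \<open>r\<close> are known to be exact.\<close>

fun blocked :: "int \<Rightarrow> bool \<Rightarrow> int \<Rightarrow> bool \<Rightarrow> config \<Rightarrow> node \<Rightarrow> bool" where
  "blocked l el r er K (x, y) \<longleftrightarrow>
     y < 0 \<or> y = 0 \<and> x < 0 \<or> el \<and> x < - l \<or> er \<and> r < x + y \<or> covers K (x, y)"

text \<open>\<open>G\<close> are the tiles to be created, \<open>s\<close> is a lower bound for \<open>L + R\<close>, and \<open>K\<close> are the known tiles.
  For \<open>L\<close> it is known that \<open>l \<le> L\<close>, and that \<open>l = L\<close> if \<open>el\<close> holds; likewise for \<open>R\<close>.\<close>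

primrec check :: "config \<Rightarrow> int \<Rightarrow> cert \<Rightarrow> int \<Rightarrow> bool \<Rightarrow> int \<Rightarrow> bool \<Rightarrow> config \<Rightarrow> bool" where
  "check G s (Done fs) = (\<lambda>l el r er K. check_flips G K fs)"
| "check G s (Ask x y c1 c2 c3 c4 c5 c6) = (\<lambda>l el r er K.
     inside l r (x, y) \<and> \<not> covers K (x, y) \<and>
     (blocked l el r er K (x + 1, y) \<or> check G s c1 l el r er (((x, y), (x + 1, y)) # K)) \<and>
     (blocked l el r er K (x, y + 1) \<or> check G s c2 l el r er (((x, y), (x, y + 1)) # K)) \<and>
     (blocked l el r er K (x - 1, y + 1) \<or> check G s c3 l el r er (((x, y), (x - 1, y + 1)) # K)) \<and>
     (blocked l el r er K (x - 1, y) \<or> check G s c4 l el r er (((x, y), (x - 1, y)) # K)) \<and>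
     (blocked l el r er K (x, y - 1) \<or> check G s c5 l el r er (((x, y), (x, y - 1)) # K)) \<and>
     (blocked l el r er K (x + 1, y - 1) \<or> check G s c6 l el r er (((x, y), (x + 1, y - 1)) # K)))"
| "check G s (SplitL c c') = (\<lambda>l el r er K.
     check G s c l True r er K \<and> check G s c' (l + 1) False r er K)"
| "check G s (SplitR c c') = (\<lambda>l el r er K.
     check G s c l el r True K \<and> check G s c' l el (r + 1) False K)"
| "check G s Void = (\<lambda>l el r er K. el \<and> er \<and> l + r < s)"

definition tiles :: "config \<Rightarrow> node set set" where
  "tiles K = (\<lambda>(p, q). {p, q}) ` set K"

lemma tiles_simps [simp]:
  "tiles [] = {}"
  "tiles ((p, q) # K) = insert {p, q} (tiles K)"
  by (simp_all add: tiles_def)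

lemma has_tile_tiles: "has_tile K a b \<Longrightarrow> {a, b} \<in> tiles K"
  by (induction K a b rule: has_tile.induct) auto

lemma has_tiles_tiles: "has_tiles K G \<Longrightarrow> tiles G \<subseteq> tiles K"
  by (induction K G rule: has_tiles.induct) (auto simp: has_tile_tiles)

lemma tiles_drop_tile: "tiles (drop_tile K a) = {t \<in> tiles K. a \<notin> t}"
  by (induction K a rule: drop_tile.induct) auto

lemma covers_tiles: "covers K a \<longleftrightarrow> (\<exists>t\<in>tiles K. a \<in> t)"
  by (induction K a rule: covers.induct) auto

lemma step_step_neq: "step e (step e p) \<noteq> p"
  by (cases p; cases e) auto

lemma can_flip_sound:
  assumes T: "tiling S T" and K: "tiles K \<subseteq> T" and cf: "can_flip K a d e"
  shows "\<exists>T'. flip T T' \<and> tiles (do_flip K a d e) \<subseteq> T'"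
proof -
  define b c f where "b = step d a" and "c = step e a" and "f = step e b"
  have t: "{a, b} \<in> T" "{c, f} \<in> T"
    using cf K has_tile_tiles unfolding can_flip_def b_def c_def f_def by blast+
  have adj: "adj a c" "adj b f"
    unfolding c_def f_def by (rule adj_step)+
  have "{a, b} \<noteq> {c, f}"
  proof
    assume "{a, b} = {c, f}"
    moreover have "a \<noteq> c" using adj(1) adj_irrefl by metis
    ultimately have "a = f" "b = c" by (auto simp: doubleton_eq_iff)
    then show False using step_step_neq[of e a] unfolding c_def f_def by simp
  qed
  then have disj: "{a, b} \<inter> {c, f} = {}"
    using tiling_eq[OF T t] by blast
  define T' where "T' = (T - {{a, b}, {c, f}}) \<union> {{a, c}, {b, f}}"
  have "flip T T'"
    unfolding flip_def T'_def using t adj disj by blast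
  moreover have "tiles (do_flip K a d e) \<subseteq> T'"
    using K unfolding do_flip_def T'_def
    by (auto simp: tiles_drop_tile simp flip: b_def c_def f_def)
  ultimately show ?thesis by blast
qed

lemma check_flips_sound:
  assumes "check_flips G K fs" "tiling S T" "tiles K \<subseteq> T"
  shows "\<exists>T'. flips_within (length fs) T T' \<and> tiles G \<subseteq> T'"
  using assms
proof (induction G K fs arbitrary: T rule: check_flips.induct)
  case (1 G K)
  then have "tiles G \<subseteq> T" using has_tiles_tiles by fastforce
  then show ?case using flips_within_refl by blast
next
  case (2 G K x y d e fs)
  have cf: "can_flip K (x, y) d e" "check_flips G (do_flip K (x, y) d e) fs"
    using 2(2) by simp_all
  from can_flip_sound[OF 2(3,4) cf(1)]
  obtain U where U: "flip T U" "tiles (do_flip K (x, y) d e) \<subseteq> U" by blast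
  from 2(1)[OF cf(2) flip_tiling[OF 2(3) U(1)] U(2)]
  obtain T' where "flips_within (length fs) U T'" "tiles G \<subseteq> T'" by blast
  then show ?case using flips_within_flip[OF U(1)] by auto
qed

text \<open>The largest number of flips on a branch of the tree.\<close>

primrec cost :: "cert \<Rightarrow> nat" where
  "cost (Done fs) = length fs"
| "cost (Ask x y c1 c2 c3 c4 c5 c6) =
     Max {cost c1, cost c2, cost c3, cost c4, cost c5, cost c6}"
| "cost (SplitL c c') = max (cost c) (cost c')"
| "cost (SplitR c c') = max (cost c) (cost c')"
| "cost Void = 0"

text \<open>A tree that passes the check shows that the tiles \<open>G\<close> can be created by at most \<open>cost c\<close> flips in
  every tiling that contains the known tiles.\<close>

lemma check_sound:
  assumes "check G s c l el r er K"
    and "tiling (region L R) T" "tiles K \<subseteq> T" "s \<le> L + R"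
    and "l \<le> L" "el \<Longrightarrow> l = L" "r \<le> R" "er \<Longrightarrow> r = R"
  shows "\<exists>T'. flips_within (cost c) T T' \<and> tiles G \<subseteq> T'"
  using assms
proof (induction c arbitrary: l el r er K)
  case (Done fs)
  then show ?case using check_flips_sound[of G K fs] by simp
next
  case (Ask x y c1 c2 c3 c4 c5 c6)
  let ?p = "(x, y)"
  have ins: "inside l r ?p" and unc: "\<not> covers K ?p"
    using Ask.prems(1) by simp_all
  have "?p \<in> region L R"
    using ins Ask.prems(5,7) by (auto simp: region_def)
  then obtain t where t: "t \<in> T" "?p \<in> t"
    using tiling_Union[OF Ask.prems(2)] by blast
  obtain q where q: "t = {?p, q}" "adj ?p q"
    using tiling_tile[OF Ask.prems(2) t] .
  have "q \<in> region L R"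
    using tiling_Union[OF Ask.prems(2)] t q by blast
  then have insq: "inside L R q" by (simp add: region_def)
  \<comment> \<open>The partner \<open>q\<close> is uncovered, because a known tile at \<open>q\<close> would be \<open>t\<close> and cover the node asked for.\<close>
  have "\<not> covers K q"
  proof
    assume "covers K q"
    then obtain u where u: "u \<in> tiles K" "q \<in> u"
      by (auto simp: covers_tiles)
    then have "u = t"
      using tiling_eq[OF Ask.prems(2) _ t(1), of u q] q(1) Ask.prems(3) by blast
    then show False using unc u(1) t(2) by (auto simp: covers_tiles)
  qed
  then have unb: "\<not> blocked l el r er K q"
    using insq Ask.prems(6,8) by (cases q) auto
  have K': "tiles ((?p, q) # K) \<subseteq> T"
    using Ask.prems(3) t q by simp
  have up: ?case if "\<exists>T'. flips_within m T T' \<and> tiles G \<subseteq> T'"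
    and "m \<le> cost (Ask x y c1 c2 c3 c4 c5 c6)" for m
    using that flips_within_mono by blast
  have le: "cost c \<le> cost (Ask x y c1 c2 c3 c4 c5 c6)" if "c \<in> {c1, c2, c3, c4, c5, c6}" for c
    unfolding cost.simps by (rule Max_ge) (use that in auto)
  have ck: "blocked l el r er K (x + 1, y) \<or> check G s c1 l el r er ((?p, (x + 1, y)) # K)"
    "blocked l el r er K (x, y + 1) \<or> check G s c2 l el r er ((?p, (x, y + 1)) # K)"
    "blocked l el r er K (x - 1, y + 1) \<or> check G s c3 l el r er ((?p, (x - 1, y + 1)) # K)"
    "blocked l el r er K (x - 1, y) \<or> check G s c4 l el r er ((?p, (x - 1, y)) # K)"
    "blocked l el r er K (x, y - 1) \<or> check G s c5 l el r er ((?p, (x, y - 1)) # K)"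
    "blocked l el r er K (x + 1, y - 1) \<or> check G s c6 l el r er ((?p, (x + 1, y - 1)) # K)"
    using Ask.prems(1) unfolding check.simps by blast+
  from q(2) show ?case
  proof (cases rule: adj_cases)
    case 1
    then have "check G s c1 l el r er ((?p, q) # K)" using ck(1) unb by (simp del: blocked.simps)
    then have "\<exists>T'. flips_within (cost c1) T T' \<and> tiles G \<subseteq> T'"
      by (rule Ask.IH(1)[OF _ Ask.prems(2) K' Ask.prems(4-8)])
    then show ?thesis by (rule up) (rule le, simp)
  next
    case 2
    then have "check G s c2 l el r er ((?p, q) # K)" using ck(2) unb by (simp del: blocked.simps)
    then have "\<exists>T'. flips_within (cost c2) T T' \<and> tiles G \<subseteq> T'"
      by (rule Ask.IH(2)[OF _ Ask.prems(2) K' Ask.prems(4-8)])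
    then show ?thesis by (rule up) (rule le, simp)
  next
    case 3
    then have "check G s c3 l el r er ((?p, q) # K)" using ck(3) unb by (simp del: blocked.simps)
    then have "\<exists>T'. flips_within (cost c3) T T' \<and> tiles G \<subseteq> T'"
      by (rule Ask.IH(3)[OF _ Ask.prems(2) K' Ask.prems(4-8)])
    then show ?thesis by (rule up) (rule le, simp)
  next
    case 4
    then have "check G s c4 l el r er ((?p, q) # K)" using ck(4) unb by (simp del: blocked.simps)
    then have "\<exists>T'. flips_within (cost c4) T T' \<and> tiles G \<subseteq> T'"
      by (rule Ask.IH(4)[OF _ Ask.prems(2) K' Ask.prems(4-8)])
    then show ?thesis by (rule up) (rule le, simp)
  next
    case 5
    then have "check G s c5 l el r er ((?p, q) # K)" using ck(5) unb by (simp del: blocked.simps)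
    then have "\<exists>T'. flips_within (cost c5) T T' \<and> tiles G \<subseteq> T'"
      by (rule Ask.IH(5)[OF _ Ask.prems(2) K' Ask.prems(4-8)])
    then show ?thesis by (rule up) (rule le, simp)
  next
    case 6
    then have "check G s c6 l el r er ((?p, q) # K)" using ck(6) unb by (simp del: blocked.simps)
    then have "\<exists>T'. flips_within (cost c6) T T' \<and> tiles G \<subseteq> T'"
      by (rule Ask.IH(6)[OF _ Ask.prems(2) K' Ask.prems(4-8)])
    then show ?thesis by (rule up) (rule le, simp)
  qed
next
  case (SplitL c c')
  have *: "flips_within (cost (SplitL c c')) T T'"
    if "flips_within (cost c) T T' \<or> flips_within (cost c') T T'" for T'
    using that flips_within_mono[of "cost c" T T' "cost (SplitL c c')"]
      flips_within_mono[of "cost c'" T T' "cost (SplitL c c')"] by auto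
  show ?case
  proof (cases "l = L")
    case True
    have "\<exists>T'. flips_within (cost c) T T' \<and> tiles G \<subseteq> T'"
      by (rule SplitL.IH(1)[of l True r er K]) (use SplitL.prems True in auto)
    then show ?thesis using * by blast
  next
    case False
    have "\<exists>T'. flips_within (cost c') T T' \<and> tiles G \<subseteq> T'"
      by (rule SplitL.IH(2)[of "l + 1" False r er K]) (use SplitL.prems False in auto)
    then show ?thesis using * by blast
  qed
next
  case (SplitR c c')
  have *: "flips_within (cost (SplitR c c')) T T'"
    if "flips_within (cost c) T T' \<or> flips_within (cost c') T T'" for T'
    using that flips_within_mono[of "cost c" T T' "cost (SplitR c c')"]
      flips_within_mono[of "cost c'" T T' "cost (SplitR c c')"] by auto
  show ?case
  proof (cases "r = R")
    case True
    have "\<exists>T'. flips_within (cost c) T T' \<and> tiles G \<subseteq> T'"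
      by (rule SplitR.IH(1)[of l el r True K]) (use SplitR.prems True in auto)
    then show ?thesis using * by blast
  next
    case False
    have "\<exists>T'. flips_within (cost c') T T' \<and> tiles G \<subseteq> T'"
      by (rule SplitR.IH(2)[of l el "r + 1" False K]) (use SplitR.prems False in auto)
    then show ?thesis using * by blast
  qed
next
  case Void
  then show ?case by simp
qed

section \<open>Tiling the corner of a region\<close>

text \<open>For every region of a triangle of side at least \<open>6\<close> with at least two nodes in the bottom row: a
  tree that creates the tile \<open>{(0, 0), (1, 0)}\<close>. It has been found by a computer search that chose the
  questions so as to keep the tree small.\<close>

definition corner_cert :: cert where "corner_cert =
  SplitL (Ask 0 0 (Done []) (SplitR Void (Ask 1 0 (SplitR Void (Ask 1 1 (Done [(1,0,E,NE),
   (1,0,NE,W)]) (SplitR Void (Ask 2 1 (Ask 3 0 (Ask 0 2 Void (SplitR Void (Ask 2 2 (Done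
   [(2,1,E,NE), (2,1,NE,W), (1,0,E,NE), (1,0,NE,W)]) (Ask 1 3 Void (Done [(1,1,NE,NW),
   (2,2,NE,NW), (2,2,NW,W), (2,1,E,NW), (2,1,NW,W), (1,0,E,NE), (1,0,NE,W)]) (Done [(1,1,NE,NW),
   (1,3,NW,SW), (2,2,NE,W), (2,1,E,NW), (2,1,NW,W), (1,0,E,NE), (1,0,NE,W)]) Void Void Void) (Done
   [(1,1,NE,NW), (2,2,NW,W), (2,1,E,NW), (2,1,NW,W), (1,0,E,NE), (1,0,NE,W)]) Void Void Void))
   Void Void Void Void) Void Void Void Void Void) (Done [(2,1,NE,W), (1,0,E,NE), (1,0,NE,W)]) Void
   Void Void (Ask 0 2 Void (SplitR Void (Ask 3 1 (Ask 4 0 (Ask 2 2 (Done [(3,1,E,NW), (3,1,NW,SW),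
   (2,1,NE,W), (1,0,E,NE), (1,0,NE,W)]) (SplitR (Ask 3 2 Void Void Void Void Void Void) (Ask 3 2
   (Done [(3,1,E,NE), (3,1,NE,NW), (3,1,NW,SW), (2,1,NE,W), (1,0,E,NE), (1,0,NE,W)]) (Done
   [(3,2,NE,W), (3,1,E,NW), (3,1,NW,SW), (2,1,NE,W), (1,0,E,NE), (1,0,NE,W)]) Void Void Void
   Void)) (Done [(4,0,E,NW), (4,0,NW,W), (1,1,NE,NW), (2,2,NW,W), (2,1,E,NW), (2,1,NW,W),
   (1,0,E,NE), (1,0,NE,W)]) Void Void Void) Void Void Void Void Void) (Ask 2 2 Void (Done
   [(3,1,NE,NW), (3,1,NW,SW), (2,1,NE,W), (1,0,E,NE), (1,0,NE,W)]) (Ask 4 0 (SplitR (Ask 4 1 Void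
   Void Void Void Void Void) (Ask 4 1 (Done [(4,0,E,NE), (4,0,NE,NW), (4,0,NW,W), (1,1,NE,NW),
   (2,2,NW,W), (2,1,E,NW), (2,1,NW,W), (1,0,E,NE), (1,0,NE,W)]) (Done [(1,1,NE,NW), (4,1,NE,W),
   (4,0,E,NW), (4,0,NW,W), (2,2,NW,W), (2,1,E,NW), (2,1,NW,W), (1,0,E,NE), (1,0,NE,W)]) Void Void
   Void Void)) (Done [(4,0,NE,NW), (4,0,NW,W), (1,1,NE,NW), (2,2,NW,W), (2,1,E,NW), (2,1,NW,W),
   (1,0,E,NE), (1,0,NE,W)]) Void Void Void Void) Void Void Void) (Done [(3,1,NW,SW), (2,1,NE,W),
   (1,0,E,NE), (1,0,NE,W)]) Void Void (Ask 2 2 (Done [(4,0,NW,W), (2,1,E,NE), (2,1,NE,W),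
   (1,0,E,NE), (1,0,NE,W)]) (Ask 1 3 Void (Done [(4,0,NW,W), (1,1,NE,NW), (2,2,NE,NW), (2,2,NW,W),
   (2,1,E,NW), (2,1,NW,W), (1,0,E,NE), (1,0,NE,W)]) (Done [(4,0,NW,W), (1,1,NE,NW), (1,3,NW,SW),
   (2,2,NE,W), (2,1,E,NW), (2,1,NW,W), (1,0,E,NE), (1,0,NE,W)]) Void Void Void) (Done [(4,0,NW,W),
   (1,1,NE,NW), (2,2,NW,W), (2,1,E,NW), (2,1,NW,W), (1,0,E,NE), (1,0,NE,W)]) Void Void Void)))
   Void Void Void Void))) (SplitR Void (Ask 2 1 (Ask 1 2 (Done [(2,1,E,NW), (2,1,NW,W),
   (1,0,E,NE), (1,0,NE,W)]) (SplitR Void (Ask 2 2 (Done [(2,1,E,NE), (2,1,NE,NW), (2,1,NW,W),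
   (1,0,E,NE), (1,0,NE,W)]) (Done [(2,2,NE,W), (2,1,E,NW), (2,1,NW,W), (1,0,E,NE), (1,0,NE,W)])
   Void Void Void Void)) (SplitR Void (Ask 2 2 (Done [(2,1,E,NE), (1,2,NW,SW), (2,1,NE,W),
   (1,0,E,NE), (1,0,NE,W)]) (Ask 1 3 Void (Done [(2,2,NE,NW), (2,2,NW,W), (2,1,E,NW), (2,1,NW,W),
   (1,0,E,NE), (1,0,NE,W)]) (Done [(1,3,NW,SW), (2,2,NE,W), (2,1,E,NW), (2,1,NW,W), (1,0,E,NE),
   (1,0,NE,W)]) Void Void Void) (Done [(2,2,NW,W), (2,1,E,NW), (2,1,NW,W), (1,0,E,NE),
   (1,0,NE,W)]) Void Void Void)) Void Void Void) (Ask 1 2 Void (Done [(2,1,NE,NW), (2,1,NW,W),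
   (1,0,E,NE), (1,0,NE,W)]) (Done [(1,2,NW,SW), (2,1,NE,W), (1,0,E,NE), (1,0,NE,W)]) Void Void
   Void) (Done [(2,1,NW,W), (1,0,E,NE), (1,0,NE,W)]) Void Void (Ask 1 2 (SplitR Void (Ask 3 1 (Ask
   4 0 (Done [(4,0,E,NW), (4,0,NW,W), (2,1,E,NW), (2,1,NW,W), (1,0,E,NE), (1,0,NE,W)]) Void Void
   Void Void Void) (Ask 4 0 (SplitR (Ask 4 1 Void Void Void Void Void Void) (Ask 4 1 (Done
   [(4,0,E,NE), (4,0,NE,NW), (4,0,NW,W), (2,1,E,NW), (2,1,NW,W), (1,0,E,NE), (1,0,NE,W)]) (Done
   [(4,1,NE,W), (4,0,E,NW), (4,0,NW,W), (2,1,E,NW), (2,1,NW,W), (1,0,E,NE), (1,0,NE,W)]) Void Void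
   Void Void)) (Done [(4,0,NE,NW), (4,0,NW,W), (2,1,E,NW), (2,1,NW,W), (1,0,E,NE), (1,0,NE,W)])
   Void Void Void Void) Void Void Void (Done [(4,0,NW,W), (2,1,E,NW), (2,1,NW,W), (1,0,E,NE),
   (1,0,NE,W)]))) (Ask 0 3 Void (SplitR Void (Ask 3 1 (Ask 4 0 (Ask 2 2 (Done [(3,1,E,NW),
   (3,1,NW,SW), (2,1,NE,NW), (2,1,NW,W), (1,0,E,NE), (1,0,NE,W)]) (Done [(4,0,E,NW), (4,0,NW,W),
   (2,2,NE,W), (2,1,E,NW), (2,1,NW,W), (1,0,E,NE), (1,0,NE,W)]) Void Void Void Void) Void Void
   Void Void Void) (Ask 2 2 Void (Done [(3,1,NE,NW), (3,1,NW,SW), (2,1,NE,NW), (2,1,NW,W),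
   (1,0,E,NE), (1,0,NE,W)]) Void Void Void Void) (Done [(3,1,NW,SW), (2,1,NE,NW), (2,1,NW,W),
   (1,0,E,NE), (1,0,NE,W)]) Void Void (Ask 2 2 (Done [(4,0,NW,W), (2,1,E,NE), (2,1,NE,NW),
   (2,1,NW,W), (1,0,E,NE), (1,0,NE,W)]) (Done [(4,0,NW,W), (2,2,NE,W), (2,1,E,NW), (2,1,NW,W),
   (1,0,E,NE), (1,0,NE,W)]) Void Void Void Void))) Void Void Void Void) (SplitR Void (Ask 3 1 (Ask
   4 0 (Ask 2 2 (Done [(3,1,E,NW), (3,1,NW,SW), (1,2,NW,SW), (2,1,NE,W), (1,0,E,NE), (1,0,NE,W)])
   (SplitR (Ask 3 2 Void Void Void Void Void Void) (Ask 3 2 (Done [(3,1,E,NE), (3,1,NE,NW),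
   (3,1,NW,SW), (1,2,NW,SW), (2,1,NE,W), (1,0,E,NE), (1,0,NE,W)]) (Done [(1,2,NW,SW), (3,2,NE,W),
   (3,1,E,NW), (3,1,NW,SW), (2,1,NE,W), (1,0,E,NE), (1,0,NE,W)]) Void Void Void Void)) (Done
   [(4,0,E,NW), (4,0,NW,W), (2,2,NW,W), (2,1,E,NW), (2,1,NW,W), (1,0,E,NE), (1,0,NE,W)]) Void Void
   Void) Void Void Void Void Void) (Ask 2 2 Void (Done [(3,1,NE,NW), (3,1,NW,SW), (1,2,NW,SW),
   (2,1,NE,W), (1,0,E,NE), (1,0,NE,W)]) (Ask 4 0 (SplitR (Ask 4 1 Void Void Void Void Void Void)
   (Ask 4 1 (Done [(4,0,E,NE), (4,0,NE,NW), (4,0,NW,W), (2,2,NW,W), (2,1,E,NW), (2,1,NW,W),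
   (1,0,E,NE), (1,0,NE,W)]) (Done [(4,1,NE,W), (4,0,E,NW), (4,0,NW,W), (2,2,NW,W), (2,1,E,NW),
   (2,1,NW,W), (1,0,E,NE), (1,0,NE,W)]) Void Void Void Void)) (Done [(4,0,NE,NW), (4,0,NW,W),
   (2,2,NW,W), (2,1,E,NW), (2,1,NW,W), (1,0,E,NE), (1,0,NE,W)]) Void Void Void Void) Void Void
   Void) (Done [(3,1,NW,SW), (1,2,NW,SW), (2,1,NE,W), (1,0,E,NE), (1,0,NE,W)]) Void Void (Ask 2 2
   (Done [(4,0,NW,W), (2,1,E,NE), (1,2,NW,SW), (2,1,NE,W), (1,0,E,NE), (1,0,NE,W)]) (Ask 1 3 Void
   (Done [(4,0,NW,W), (2,2,NE,NW), (2,2,NW,W), (2,1,E,NW), (2,1,NW,W), (1,0,E,NE), (1,0,NE,W)])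
   (Done [(4,0,NW,W), (1,3,NW,SW), (2,2,NE,W), (2,1,E,NW), (2,1,NW,W), (1,0,E,NE), (1,0,NE,W)])
   Void Void Void) (Done [(4,0,NW,W), (2,2,NW,W), (2,1,E,NW), (2,1,NW,W), (1,0,E,NE), (1,0,NE,W)])
   Void Void Void))) Void Void Void))) Void Void Void)) (Done [(1,0,NE,W)]) Void Void Void Void))
   Void Void Void Void) (Ask 0 0 (Done []) (SplitR (Ask 1 0 Void Void Void Void Void Void) (Ask 1
   0 (SplitR (Ask 1 1 Void Void (SplitL Void (Ask (-1) 2 Void (SplitL Void (Ask (-2) 2 Void (Ask
   (-1) 1 Void Void Void (Done [((-1),2,NE,W), ((-2),1,E,NE), (0,0,NE,NW), (1,1,NW,W), (1,0,E,NW),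
   (1,0,NW,W)]) Void Void) (Ask (-2) 3 Void (Ask (-1) 1 Void Void Void (Done [((-1),2,NE,NW),
   ((-1),2,NW,W), ((-2),1,E,NE), (0,0,NE,NW), (1,1,NW,W), (1,0,E,NW), (1,0,NW,W)]) Void Void) (Ask
   (-1) 1 Void Void Void (Done [((-2),3,NW,SW), ((-1),2,NE,W), ((-2),1,E,NE), (0,0,NE,NW),
   (1,1,NW,W), (1,0,E,NW), (1,0,NW,W)]) Void Void) Void Void Void) (Ask (-1) 1 Void Void Void (Ask
   (-2) 3 Void (Done [((-2),1,E,NW), ((-1),2,NE,NW), ((-1),2,NW,SW), (0,0,NE,NW), (1,1,NW,W),
   (1,0,E,NW), (1,0,NW,W)]) (Ask (-2) 4 Void Void (Done [((-2),1,E,NW), ((-2),4,NW,SW),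
   ((-1),2,NE,NW), ((-1),2,NW,SW), (0,0,NE,NW), (1,1,NW,W), (1,0,E,NW), (1,0,NW,W)]) Void Void
   Void) (Done [((-3),2,E,NE), ((-1),2,NE,W), ((-2),1,E,NE), (0,0,NE,NW), (1,1,NW,W), (1,0,E,NW),
   (1,0,NW,W)]) Void Void) Void Void) (Ask (-1) 1 Void Void Void Void Void Void) (Ask (-2) 4 Void
   Void (Ask (-2) 3 Void Void (Done [((-2),4,NW,SW), ((-1),2,NE,NW), ((-1),2,NW,SW), (0,0,NE,NW),
   (1,1,NW,W), (1,0,E,NW), (1,0,NW,W)]) (SplitL (Ask (-3) 4 Void Void Void Void Void Void) (Ask
   (-3) 4 Void Void (Done [((-2),4,NW,W), ((-3),3,E,NE), ((-1),2,NE,NW), ((-1),2,NW,SW),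
   (0,0,NE,NW), (1,1,NW,W), (1,0,E,NW), (1,0,NW,W)]) (Done [((-3),3,E,NW), ((-2),4,NW,SW),
   ((-1),2,NE,NW), ((-1),2,NW,SW), (0,0,NE,NW), (1,1,NW,W), (1,0,E,NW), (1,0,NW,W)]) Void Void))
   Void Void) (Ask (-2) 3 Void Void Void (Done [((-3),3,E,NE), ((-1),2,NE,NW), ((-1),2,NW,SW),
   (0,0,NE,NW), (1,1,NW,W), (1,0,E,NW), (1,0,NW,W)]) Void Void) (Done [((-1),2,NE,NW),
   ((-1),2,NW,SW), (0,0,NE,NW), (1,1,NW,W), (1,0,E,NW), (1,0,NW,W)]) Void))) (Ask (-1) 1 Void Void
   (Done [((-1),2,NW,SW), (0,0,NE,NW), (1,1,NW,W), (1,0,E,NW), (1,0,NW,W)]) (SplitL Void (Ask (-2)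
   2 Void Void (Done [((-1),2,NW,W), ((-2),1,E,NE), (0,0,NE,NW), (1,1,NW,W), (1,0,E,NW),
   (1,0,NW,W)]) (Done [((-2),1,E,NW), ((-1),2,NW,SW), (0,0,NE,NW), (1,1,NW,W), (1,0,E,NW),
   (1,0,NW,W)]) Void Void)) Void Void) (Ask (-1) 1 Void Void Void (Done [((-2),1,E,NE),
   (0,0,NE,NW), (1,1,NW,W), (1,0,E,NW), (1,0,NW,W)]) Void Void) (Done [(0,0,NE,NW), (1,1,NW,W),
   (1,0,E,NW), (1,0,NW,W)]) Void)) Void Void Void) (Ask 1 1 (Done [(1,0,E,NE), (1,0,NE,W)])
   (SplitR (Ask 2 1 Void Void Void Void Void (SplitL Void (Ask (-1) 1 Void (Ask 0 2 Void (Done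
   [(0,0,NE,NW), (1,1,NE,NW), (1,1,NW,W), (1,0,E,NW), (1,0,NW,W)]) (Done [(0,0,NE,NW),
   (0,2,NW,SW), (1,1,NE,W), (1,0,E,NW), (1,0,NW,W)]) Void Void Void) (Ask (-1) 2 (Ask (-1) 3
   (SplitL (Ask (-2) 1 Void Void Void Void Void Void) (Ask (-2) 4 (SplitL (Ask (-2) 1 Void Void
   (Ask (-3) 1 Void Void Void Void Void Void) (Ask (-3) 2 Void (Ask (-2) 5 Void Void (Ask (-3) 5
   Void Void Void Void (Ask (-2) 3 Void Void Void Void Void Void) Void) (Ask (-3) 6 Void Void Void
   Void Void Void) Void Void) Void Void Void Void) Void Void) (Ask (-3) 4 Void (Ask (-2) 1 Void
   Void (Ask (-2) 3 Void Void Void (Done [((-1),1,NW,W), ((-3),2,E,NE), ((-1),2,E,NE),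
   (1,1,NE,NW), ((-1),2,NE,W), ((-2),1,E,NE), (0,0,NE,NW), (1,1,NW,W), (1,0,E,NW), (1,0,NW,W)])
   Void Void) (Ask (-2) 3 Void Void Void (Ask (-3) 2 Void Void (Ask (-2) 5 Void Void (SplitL (Ask
   (-4) 4 Void (Done [((-1),3,E,NW), ((-3),4,NE,W), ((-3),3,E,NW), ((-1),3,NW,W), ((-1),2,E,NW),
   ((-1),2,NW,SW), (0,0,NE,NW), (0,2,NW,SW), (1,1,NE,W), (1,0,E,NW), (1,0,NW,W)]) Void Void Void
   Void) (Ask (-4) 5 Void (Done [((-1),2,E,NE), (1,1,NE,NW), ((-3),4,NE,NW), ((-2),5,NW,W),
   ((-2),4,E,NW), ((-2),4,NW,W), ((-3),3,E,NE), ((-1),2,NE,NW), ((-1),2,NW,SW), (0,0,NE,NW),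
   (1,1,NW,W), (1,0,E,NW), (1,0,NW,W)]) (Ask (-4) 4 Void Void (Done [((-1),3,E,NW),
   ((-4),5,NW,SW), ((-3),4,NE,W), ((-3),3,E,NW), ((-1),3,NW,W), ((-1),2,E,NW), ((-1),2,NW,SW),
   (0,0,NE,NW), (0,2,NW,SW), (1,1,NE,W), (1,0,E,NW), (1,0,NW,W)]) (SplitL (Ask (-5) 5 Void Void
   Void Void Void Void) (Ask (-5) 5 Void Void (Done [((-1),3,E,NW), ((-4),5,NW,W), ((-5),4,E,NE),
   ((-3),4,NE,W), ((-3),3,E,NW), ((-1),3,NW,W), ((-1),2,E,NW), ((-1),2,NW,SW), (0,0,NE,NW),
   (0,2,NW,SW), (1,1,NE,W), (1,0,E,NW), (1,0,NW,W)]) (Done [((-1),3,E,NW), ((-5),4,E,NW),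
   ((-4),5,NW,SW), ((-3),4,NE,W), ((-3),3,E,NW), ((-1),3,NW,W), ((-1),2,E,NW), ((-1),2,NW,SW),
   (0,0,NE,NW), (0,2,NW,SW), (1,1,NE,W), (1,0,E,NW), (1,0,NW,W)]) Void Void)) Void Void) (Ask (-4)
   4 Void Void Void (Done [((-1),3,E,NW), ((-5),4,E,NE), ((-3),4,NE,W), ((-3),3,E,NW),
   ((-1),3,NW,W), ((-1),2,E,NW), ((-1),2,NW,SW), (0,0,NE,NW), (0,2,NW,SW), (1,1,NE,W), (1,0,E,NW),
   (1,0,NW,W)]) Void Void) (Done [((-1),3,E,NW), ((-3),4,NE,W), ((-3),3,E,NW), ((-1),3,NW,W),
   ((-1),2,E,NW), ((-1),2,NW,SW), (0,0,NE,NW), (0,2,NW,SW), (1,1,NE,W), (1,0,E,NW), (1,0,NW,W)])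
   Void)) Void Void Void) (Done [((-3),1,E,NW), ((-1),1,NW,W), ((-3),2,E,NE), ((-1),2,E,NE),
   (1,1,NE,NW), ((-1),2,NE,W), ((-2),1,E,NE), (0,0,NE,NW), (1,1,NW,W), (1,0,E,NW), (1,0,NW,W)])
   Void Void) Void Void) Void Void) (Ask (-2) 5 Void Void (Ask (-3) 5 Void Void (Ask (-2) 3 Void
   Void Void (Done [((-1),2,E,NE), (1,1,NE,NW), ((-2),5,NW,W), ((-2),4,E,NW), ((-2),4,NW,W),
   ((-3),3,E,NE), ((-1),2,NE,NW), ((-1),2,NW,SW), (0,0,NE,NW), (1,1,NW,W), (1,0,E,NW),
   (1,0,NW,W)]) Void Void) Void Void Void) (Ask (-2) 3 Void Void Void (Done [((-1),2,E,NE),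
   (1,1,NE,NW), ((-2),4,E,NW), ((-2),4,NW,W), ((-3),3,E,NE), ((-1),2,NE,NW), ((-1),2,NW,SW),
   (0,0,NE,NW), (1,1,NW,W), (1,0,E,NW), (1,0,NW,W)]) Void Void) Void Void) (Ask (-2) 3 Void Void
   Void (Done [((-3),3,E,NW), ((-1),3,E,NW), ((-1),3,NW,W), ((-1),2,E,NW), ((-1),2,NW,SW),
   (0,0,NE,NW), (0,2,NW,SW), (1,1,NE,W), (1,0,E,NW), (1,0,NW,W)]) Void Void) (Ask (-2) 3 Void Void
   Void Void Void Void) (Done [((-1),3,E,NW), ((-1),3,NW,W), ((-1),2,E,NW), ((-1),2,NW,SW),
   (0,0,NE,NW), (0,2,NW,SW), (1,1,NE,W), (1,0,E,NW), (1,0,NW,W)]))) (Ask (-1) 4 Void Void Void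
   Void Void Void) (Ask (-2) 3 Void Void (Done [((-1),2,E,NE), (1,1,NE,NW), ((-2),4,NW,SW),
   ((-1),2,NE,NW), ((-1),2,NW,SW), (0,0,NE,NW), (1,1,NW,W), (1,0,E,NW), (1,0,NW,W)]) (SplitL (Ask
   (-3) 4 Void Void Void Void Void Void) (Ask (-3) 4 Void Void (Done [((-1),2,E,NE), (1,1,NE,NW),
   ((-2),4,NW,W), ((-3),3,E,NE), ((-1),2,NE,NW), ((-1),2,NW,SW), (0,0,NE,NW), (1,1,NW,W),
   (1,0,E,NW), (1,0,NW,W)]) (Done [((-1),2,E,NE), (1,1,NE,NW), ((-3),3,E,NW), ((-2),4,NW,SW),
   ((-1),2,NE,NW), ((-1),2,NW,SW), (0,0,NE,NW), (1,1,NW,W), (1,0,E,NW), (1,0,NW,W)]) Void Void))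
   Void Void) (Ask (-2) 3 Void Void Void (Done [((-1),2,E,NE), (1,1,NE,NW), ((-3),3,E,NE),
   ((-1),2,NE,NW), ((-1),2,NW,SW), (0,0,NE,NW), (1,1,NW,W), (1,0,E,NW), (1,0,NW,W)]) Void Void)
   (Done [((-1),2,E,NE), (1,1,NE,NW), ((-1),2,NE,NW), ((-1),2,NW,SW), (0,0,NE,NW), (1,1,NW,W),
   (1,0,E,NW), (1,0,NW,W)]) Void)) (Ask 0 3 Void Void Void Void Void Void) (SplitL (Ask (-2) 1
   Void Void Void Void Void Void) (Ask (-2) 3 Void Void (Done [((-1),3,NW,W), ((-1),2,E,NW),
   ((-1),2,NW,SW), (0,0,NE,NW), (0,2,NW,SW), (1,1,NE,W), (1,0,E,NW), (1,0,NW,W)]) (Ask 0 3 Void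
   Void (Ask (-2) 1 Void Void (Done [((-1),1,NW,W), ((-3),2,E,NE), (0,3,NW,W), ((-1),2,E,NE),
   (1,1,NE,NW), ((-1),2,NE,W), ((-2),1,E,NE), (0,0,NE,NW), (1,1,NW,W), (1,0,E,NW), (1,0,NW,W)])
   (SplitL (Ask (-3) 2 Void Void Void Void Void Void) (Ask (-3) 2 Void Void (Ask (-3) 4 Void (Ask
   (-2) 5 Void Void (SplitL (Ask (-4) 4 Void (Done [((-3),4,NE,W), ((-3),3,E,NW), ((-1),3,NW,W),
   ((-1),2,E,NW), ((-1),2,NW,SW), (0,0,NE,NW), (0,2,NW,SW), (1,1,NE,W), (1,0,E,NW), (1,0,NW,W)])
   Void Void Void Void) (Ask (-4) 5 Void (Done [(0,3,NW,W), ((-1),2,E,NE), (1,1,NE,NW),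
   ((-3),4,NE,NW), ((-2),5,NW,W), ((-2),4,E,NW), ((-2),4,NW,W), ((-3),3,E,NE), ((-1),2,NE,NW),
   ((-1),2,NW,SW), (0,0,NE,NW), (1,1,NW,W), (1,0,E,NW), (1,0,NW,W)]) (Ask (-4) 4 Void Void (Done
   [((-4),5,NW,SW), ((-3),4,NE,W), ((-3),3,E,NW), ((-1),3,NW,W), ((-1),2,E,NW), ((-1),2,NW,SW),
   (0,0,NE,NW), (0,2,NW,SW), (1,1,NE,W), (1,0,E,NW), (1,0,NW,W)]) (SplitL (Ask (-5) 5 Void Void
   Void Void Void Void) (Ask (-5) 5 Void Void (Done [((-4),5,NW,W), ((-5),4,E,NE), ((-3),4,NE,W),
   ((-3),3,E,NW), ((-1),3,NW,W), ((-1),2,E,NW), ((-1),2,NW,SW), (0,0,NE,NW), (0,2,NW,SW),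
   (1,1,NE,W), (1,0,E,NW), (1,0,NW,W)]) (Done [((-5),4,E,NW), ((-4),5,NW,SW), ((-3),4,NE,W),
   ((-3),3,E,NW), ((-1),3,NW,W), ((-1),2,E,NW), ((-1),2,NW,SW), (0,0,NE,NW), (0,2,NW,SW),
   (1,1,NE,W), (1,0,E,NW), (1,0,NW,W)]) Void Void)) Void Void) (Ask (-4) 4 Void Void Void (Done
   [((-5),4,E,NE), ((-3),4,NE,W), ((-3),3,E,NW), ((-1),3,NW,W), ((-1),2,E,NW), ((-1),2,NW,SW),
   (0,0,NE,NW), (0,2,NW,SW), (1,1,NE,W), (1,0,E,NW), (1,0,NW,W)]) Void Void) (Done [((-3),4,NE,W),
   ((-3),3,E,NW), ((-1),3,NW,W), ((-1),2,E,NW), ((-1),2,NW,SW), (0,0,NE,NW), (0,2,NW,SW),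
   (1,1,NE,W), (1,0,E,NW), (1,0,NW,W)]) Void)) Void Void Void) (Ask (-2) 5 Void Void (Ask (-3) 5
   Void Void (Done [(0,3,NW,W), ((-1),2,E,NE), (1,1,NE,NW), ((-2),5,NW,W), ((-2),4,E,NW),
   ((-2),4,NW,W), ((-3),3,E,NE), ((-1),2,NE,NW), ((-1),2,NW,SW), (0,0,NE,NW), (1,1,NW,W),
   (1,0,E,NW), (1,0,NW,W)]) Void Void Void) (Done [(0,3,NW,W), ((-1),2,E,NE), (1,1,NE,NW),
   ((-2),4,E,NW), ((-2),4,NW,W), ((-3),3,E,NE), ((-1),2,NE,NW), ((-1),2,NW,SW), (0,0,NE,NW),
   (1,1,NW,W), (1,0,E,NW), (1,0,NW,W)]) Void Void) (Done [((-3),3,E,NW), ((-1),3,NW,W),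
   ((-1),2,E,NW), ((-1),2,NW,SW), (0,0,NE,NW), (0,2,NW,SW), (1,1,NE,W), (1,0,E,NW), (1,0,NW,W)])
   Void Void) (Done [((-3),1,E,NW), ((-1),1,NW,W), ((-3),2,E,NE), (0,3,NW,W), ((-1),2,E,NE),
   (1,1,NE,NW), ((-1),2,NE,W), ((-2),1,E,NE), (0,0,NE,NW), (1,1,NW,W), (1,0,E,NW), (1,0,NW,W)])
   Void Void)) Void Void) Void Void Void) Void Void)) (Done [((-1),2,E,NW), ((-1),2,NW,SW),
   (0,0,NE,NW), (0,2,NW,SW), (1,1,NE,W), (1,0,E,NW), (1,0,NW,W)]) Void Void) (SplitL (Ask (-2) 1
   Void Void Void Void Void Void) (Ask (-2) 4 (Ask (-2) 3 Void Void (Ask 0 2 Void (Done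
   [(0,2,NE,W), ((-1),3,E,NW), ((-1),3,NW,W), ((-1),2,E,NW), ((-1),2,NW,SW), (0,0,NE,NW),
   (0,2,NW,SW), (1,1,NE,W), (1,0,E,NW), (1,0,NW,W)]) Void Void Void Void) (Ask (-2) 1 Void Void
   (Ask 0 2 Void (Done [((-1),1,NW,W), (1,1,NE,NW), ((-3),2,E,NE), ((-1),2,NE,W), ((-2),1,E,NE),
   (0,0,NE,NW), (1,1,NW,W), (1,0,E,NW), (1,0,NW,W)]) Void Void Void Void) (SplitL (Ask (-3) 2 Void
   Void Void Void Void Void) (Ask (-3) 2 Void Void (Ask 0 2 Void (Ask (-3) 4 Void (Ask (-2) 5 Void
   Void (SplitL (Ask (-4) 4 Void (Done [(0,2,NE,W), ((-1),3,E,NW), ((-3),4,NE,W), ((-3),3,E,NW),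
   ((-1),3,NW,W), ((-1),2,E,NW), ((-1),2,NW,SW), (0,0,NE,NW), (0,2,NW,SW), (1,1,NE,W), (1,0,E,NW),
   (1,0,NW,W)]) Void Void Void Void) (Ask (-4) 5 Void (Done [(1,1,NE,NW), ((-3),4,NE,NW),
   ((-2),5,NW,W), ((-2),4,E,NW), ((-2),4,NW,W), ((-3),3,E,NE), ((-1),2,NE,NW), ((-1),2,NW,SW),
   (0,0,NE,NW), (1,1,NW,W), (1,0,E,NW), (1,0,NW,W)]) (Ask (-4) 4 Void Void (Done [(0,2,NE,W),
   ((-1),3,E,NW), ((-4),5,NW,SW), ((-3),4,NE,W), ((-3),3,E,NW), ((-1),3,NW,W), ((-1),2,E,NW),
   ((-1),2,NW,SW), (0,0,NE,NW), (0,2,NW,SW), (1,1,NE,W), (1,0,E,NW), (1,0,NW,W)]) (SplitL (Ask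
   (-5) 5 Void Void Void Void Void Void) (Ask (-5) 5 Void Void (Done [(0,2,NE,W), ((-1),3,E,NW),
   ((-4),5,NW,W), ((-5),4,E,NE), ((-3),4,NE,W), ((-3),3,E,NW), ((-1),3,NW,W), ((-1),2,E,NW),
   ((-1),2,NW,SW), (0,0,NE,NW), (0,2,NW,SW), (1,1,NE,W), (1,0,E,NW), (1,0,NW,W)]) (Done
   [(0,2,NE,W), ((-1),3,E,NW), ((-5),4,E,NW), ((-4),5,NW,SW), ((-3),4,NE,W), ((-3),3,E,NW),
   ((-1),3,NW,W), ((-1),2,E,NW), ((-1),2,NW,SW), (0,0,NE,NW), (0,2,NW,SW), (1,1,NE,W), (1,0,E,NW),
   (1,0,NW,W)]) Void Void)) Void Void) (Ask (-4) 4 Void Void Void (Done [(0,2,NE,W),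
   ((-1),3,E,NW), ((-5),4,E,NE), ((-3),4,NE,W), ((-3),3,E,NW), ((-1),3,NW,W), ((-1),2,E,NW),
   ((-1),2,NW,SW), (0,0,NE,NW), (0,2,NW,SW), (1,1,NE,W), (1,0,E,NW), (1,0,NW,W)]) Void Void) (Done
   [(0,2,NE,W), ((-1),3,E,NW), ((-3),4,NE,W), ((-3),3,E,NW), ((-1),3,NW,W), ((-1),2,E,NW),
   ((-1),2,NW,SW), (0,0,NE,NW), (0,2,NW,SW), (1,1,NE,W), (1,0,E,NW), (1,0,NW,W)]) Void)) Void Void
   Void) (Ask (-2) 5 Void Void (Ask (-3) 5 Void Void (Done [(1,1,NE,NW), ((-2),5,NW,W),
   ((-2),4,E,NW), ((-2),4,NW,W), ((-3),3,E,NE), ((-1),2,NE,NW), ((-1),2,NW,SW), (0,0,NE,NW),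
   (1,1,NW,W), (1,0,E,NW), (1,0,NW,W)]) Void Void Void) (Done [(1,1,NE,NW), ((-2),4,E,NW),
   ((-2),4,NW,W), ((-3),3,E,NE), ((-1),2,NE,NW), ((-1),2,NW,SW), (0,0,NE,NW), (1,1,NW,W),
   (1,0,E,NW), (1,0,NW,W)]) Void Void) (Done [(0,2,NE,W), ((-3),3,E,NW), ((-1),3,E,NW),
   ((-1),3,NW,W), ((-1),2,E,NW), ((-1),2,NW,SW), (0,0,NE,NW), (0,2,NW,SW), (1,1,NE,W), (1,0,E,NW),
   (1,0,NW,W)]) Void Void) Void Void Void Void) (Ask 0 2 Void (Done [((-3),1,E,NW), ((-1),1,NW,W),
   (1,1,NE,NW), ((-3),2,E,NE), ((-1),2,NE,W), ((-2),1,E,NE), (0,0,NE,NW), (1,1,NW,W), (1,0,E,NW),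
   (1,0,NW,W)]) Void Void Void Void) Void Void)) Void Void) Void Void) (Ask 0 2 Void (Ask (-1) 4
   Void Void Void Void Void Void) Void Void Void Void) (Ask (-2) 3 Void Void (Ask 0 2 Void (Done
   [(1,1,NE,NW), ((-2),4,NW,SW), ((-1),2,NE,NW), ((-1),2,NW,SW), (0,0,NE,NW), (1,1,NW,W),
   (1,0,E,NW), (1,0,NW,W)]) Void Void Void Void) (SplitL (Ask (-3) 4 Void Void Void Void Void
   Void) (Ask (-3) 4 Void Void (Ask 0 2 Void (Done [(1,1,NE,NW), ((-2),4,NW,W), ((-3),3,E,NE),
   ((-1),2,NE,NW), ((-1),2,NW,SW), (0,0,NE,NW), (1,1,NW,W), (1,0,E,NW), (1,0,NW,W)]) Void Void
   Void Void) (Ask 0 2 Void (Done [(1,1,NE,NW), ((-3),3,E,NW), ((-2),4,NW,SW), ((-1),2,NE,NW),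
   ((-1),2,NW,SW), (0,0,NE,NW), (1,1,NW,W), (1,0,E,NW), (1,0,NW,W)]) Void Void Void Void) Void
   Void)) Void Void) (Ask (-2) 3 Void Void Void (Ask 0 2 Void (Done [(1,1,NE,NW), ((-3),3,E,NE),
   ((-1),2,NE,NW), ((-1),2,NW,SW), (0,0,NE,NW), (1,1,NW,W), (1,0,E,NW), (1,0,NW,W)]) Void Void
   Void Void) Void Void) (Ask 0 2 Void (Done [(1,1,NE,NW), ((-1),2,NE,NW), ((-1),2,NW,SW),
   (0,0,NE,NW), (1,1,NW,W), (1,0,E,NW), (1,0,NW,W)]) Void Void Void Void) Void)) (Ask 0 2 Void
   (Done [(1,1,NE,NW), ((-1),2,NW,SW), (0,0,NE,NW), (1,1,NW,W), (1,0,E,NW), (1,0,NW,W)]) (Done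
   [((-1),2,NW,SW), (0,0,NE,NW), (0,2,NW,SW), (1,1,NE,W), (1,0,E,NW), (1,0,NW,W)]) Void Void Void)
   Void Void Void) (Ask (-1) 2 (Ask 0 3 Void Void (Ask (-1) 3 Void Void (SplitL (Ask (-2) 5 Void
   Void Void Void Void Void) (Ask (-2) 3 Void Void (Ask (-2) 2 Void Void (Done [((-1),3,NW,W),
   ((-1),2,E,NW), ((-1),2,NW,W), ((-2),1,E,NE), (0,0,NE,NW), (0,2,NW,SW), (1,1,NE,W), (1,0,E,NW),
   (1,0,NW,W)]) (Done [((-2),1,E,NW), ((-1),3,NW,W), ((-1),2,E,NW), ((-1),2,NW,SW), (0,0,NE,NW),
   (0,2,NW,SW), (1,1,NE,W), (1,0,E,NW), (1,0,NW,W)]) Void Void) (Ask (-2) 2 Void Void Void (Done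
   [((-3),2,E,NE), (0,3,NW,W), ((-1),2,E,NE), (1,1,NE,NW), ((-1),2,NE,W), ((-2),1,E,NE),
   (0,0,NE,NW), (1,1,NW,W), (1,0,E,NW), (1,0,NW,W)]) Void Void) (Done [(0,3,NW,W), ((-1),2,E,NE),
   (1,1,NE,NW), ((-1),2,NE,W), ((-2),1,E,NE), (0,0,NE,NW), (1,1,NW,W), (1,0,E,NW), (1,0,NW,W)])
   Void)) (SplitL (Ask (-2) 2 Void Void Void Void Void Void) (Ask (-2) 2 Void Void (Done
   [((-1),2,E,NW), ((-1),2,NW,W), ((-2),1,E,NE), (0,0,NE,NW), (0,2,NW,SW), (1,1,NE,W), (1,0,E,NW),
   (1,0,NW,W)]) (Done [((-2),1,E,NW), ((-1),2,E,NW), ((-1),2,NW,SW), (0,0,NE,NW), (0,2,NW,SW),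
   (1,1,NE,W), (1,0,E,NW), (1,0,NW,W)]) Void Void)) Void Void) (SplitL (Ask (-1) 4 Void Void (Ask
   (-2) 4 Void Void Void Void (Ask (-2) 2 Void Void Void Void Void Void) Void) (Ask (-2) 5 Void
   Void Void Void Void Void) Void Void) (Ask (-2) 2 Void (Done [((-1),2,E,NE), (1,1,NE,NW),
   ((-1),2,NE,W), ((-2),1,E,NE), (0,0,NE,NW), (1,1,NW,W), (1,0,E,NW), (1,0,NW,W)]) (Ask (-2) 3
   Void (Done [((-1),2,E,NE), (1,1,NE,NW), ((-1),2,NE,NW), ((-1),2,NW,W), ((-2),1,E,NE),
   (0,0,NE,NW), (1,1,NW,W), (1,0,E,NW), (1,0,NW,W)]) (Done [((-1),2,E,NE), (1,1,NE,NW),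
   ((-2),3,NW,SW), ((-1),2,NE,W), ((-2),1,E,NE), (0,0,NE,NW), (1,1,NW,W), (1,0,E,NW), (1,0,NW,W)])
   Void Void Void) (Ask (-2) 3 Void (Done [((-2),1,E,NW), ((-1),2,E,NE), (1,1,NE,NW),
   ((-1),2,NE,NW), ((-1),2,NW,SW), (0,0,NE,NW), (1,1,NW,W), (1,0,E,NW), (1,0,NW,W)]) (SplitL (Ask
   (-3) 3 Void Void Void Void Void Void) (Ask (-3) 3 Void Void (Done [((-1),2,E,NE), (1,1,NE,NW),
   ((-2),3,NW,W), ((-3),2,E,NE), ((-1),2,NE,W), ((-2),1,E,NE), (0,0,NE,NW), (1,1,NW,W),
   (1,0,E,NW), (1,0,NW,W)]) (Done [((-3),2,E,NW), ((-1),2,E,NE), (1,1,NE,NW), ((-2),3,NW,SW),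
   ((-1),2,NE,W), ((-2),1,E,NE), (0,0,NE,NW), (1,1,NW,W), (1,0,E,NW), (1,0,NW,W)]) Void Void))
   (Done [((-3),2,E,NE), ((-1),2,E,NE), (1,1,NE,NW), ((-1),2,NE,W), ((-2),1,E,NE), (0,0,NE,NW),
   (1,1,NW,W), (1,0,E,NW), (1,0,NW,W)]) Void Void) Void Void)) Void Void) (SplitL (Ask 0 2 Void
   (Ask (-1) 4 Void Void (Ask (-2) 4 Void Void Void Void (Ask (-2) 2 Void Void Void Void Void
   Void) Void) (Ask (-2) 5 Void Void Void Void Void Void) Void Void) Void Void Void Void) (Ask
   (-2) 3 Void (Ask (-2) 2 Void Void (Ask 0 2 Void (Done [(1,1,NE,NW), ((-1),2,NE,NW),
   ((-1),2,NW,W), ((-2),1,E,NE), (0,0,NE,NW), (1,1,NW,W), (1,0,E,NW), (1,0,NW,W)]) Void Void Void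
   Void) (Ask 0 2 Void (Done [((-2),1,E,NW), (1,1,NE,NW), ((-1),2,NE,NW), ((-1),2,NW,SW),
   (0,0,NE,NW), (1,1,NW,W), (1,0,E,NW), (1,0,NW,W)]) Void Void Void Void) Void Void) (Ask (-2) 2
   Void Void (Ask 0 2 Void (Done [(1,1,NE,NW), ((-2),3,NW,SW), ((-1),2,NE,W), ((-2),1,E,NE),
   (0,0,NE,NW), (1,1,NW,W), (1,0,E,NW), (1,0,NW,W)]) Void Void Void Void) (SplitL (Ask (-3) 3 Void
   Void Void Void Void Void) (Ask (-3) 3 Void Void (Ask 0 2 Void (Done [(1,1,NE,NW),
   ((-2),3,NW,W), ((-3),2,E,NE), ((-1),2,NE,W), ((-2),1,E,NE), (0,0,NE,NW), (1,1,NW,W),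
   (1,0,E,NW), (1,0,NW,W)]) Void Void Void Void) (Ask 0 2 Void (Done [(1,1,NE,NW), ((-3),2,E,NW),
   ((-2),3,NW,SW), ((-1),2,NE,W), ((-2),1,E,NE), (0,0,NE,NW), (1,1,NW,W), (1,0,E,NW), (1,0,NW,W)])
   Void Void Void Void) Void Void)) Void Void) (Ask (-2) 2 Void Void Void (Ask 0 2 Void (Done
   [(1,1,NE,NW), ((-3),2,E,NE), ((-1),2,NE,W), ((-2),1,E,NE), (0,0,NE,NW), (1,1,NW,W), (1,0,E,NW),
   (1,0,NW,W)]) Void Void Void Void) Void Void) (Ask 0 2 Void (Done [(1,1,NE,NW), ((-1),2,NE,W),
   ((-2),1,E,NE), (0,0,NE,NW), (1,1,NW,W), (1,0,E,NW), (1,0,NW,W)]) Void Void Void Void) Void))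
   (SplitL (Ask (-2) 2 Void Void Void Void Void Void) (Ask (-2) 2 Void Void (Ask 0 2 Void (Done
   [(1,1,NE,NW), ((-1),2,NW,W), ((-2),1,E,NE), (0,0,NE,NW), (1,1,NW,W), (1,0,E,NW), (1,0,NW,W)])
   (Done [((-1),2,NW,W), ((-2),1,E,NE), (0,0,NE,NW), (0,2,NW,SW), (1,1,NE,W), (1,0,E,NW),
   (1,0,NW,W)]) Void Void Void) (Ask 0 2 Void (Done [((-2),1,E,NW), (1,1,NE,NW), ((-1),2,NW,SW),
   (0,0,NE,NW), (1,1,NW,W), (1,0,E,NW), (1,0,NW,W)]) (Done [((-2),1,E,NW), ((-1),2,NW,SW),
   (0,0,NE,NW), (0,2,NW,SW), (1,1,NE,W), (1,0,E,NW), (1,0,NW,W)]) Void Void Void) Void Void)) (Ask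
   0 2 Void (Done [((-2),1,E,NE), (0,0,NE,NW), (1,1,NE,NW), (1,1,NW,W), (1,0,E,NW), (1,0,NW,W)])
   (Done [((-2),1,E,NE), (0,0,NE,NW), (0,2,NW,SW), (1,1,NE,W), (1,0,E,NW), (1,0,NW,W)]) Void Void
   Void) Void Void) Void Void))) (Ask 2 1 (Ask 3 0 (SplitR (Ask 0 2 Void (Ask 2 2 Void Void (Done
   [(1,1,NE,NW), (2,2,NW,W), (2,1,E,NW), (2,1,NW,W), (1,0,E,NE), (1,0,NE,W)]) Void Void Void)
   (SplitL (Ask (-1) 1 Void (Done [(0,0,NE,NW), (0,2,NW,SW), (1,1,NE,W), (1,0,E,NW), (1,0,NW,W)])
   Void Void Void Void) (Ask (-1) 1 Void (Done [(0,0,NE,NW), (0,2,NW,SW), (1,1,NE,W), (1,0,E,NW),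
   (1,0,NW,W)]) (Ask (-1) 2 Void Void (Done [((-1),2,NW,SW), (0,0,NE,NW), (0,2,NW,SW), (1,1,NE,W),
   (1,0,E,NW), (1,0,NW,W)]) Void Void Void) (Ask (-1) 2 Void Void (SplitL (Ask (-2) 2 Void Void
   Void Void Void Void) (Ask (-2) 2 Void Void (Done [((-1),2,NW,W), ((-2),1,E,NE), (0,0,NE,NW),
   (0,2,NW,SW), (1,1,NE,W), (1,0,E,NW), (1,0,NW,W)]) (Done [((-2),1,E,NW), ((-1),2,NW,SW),
   (0,0,NE,NW), (0,2,NW,SW), (1,1,NE,W), (1,0,E,NW), (1,0,NW,W)]) Void Void)) (Done
   [((-2),1,E,NE), (0,0,NE,NW), (0,2,NW,SW), (1,1,NE,W), (1,0,E,NW), (1,0,NW,W)]) Void Void) Void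
   Void)) (SplitL (Ask (-1) 1 Void Void Void Void Void Void) (Ask (-1) 3 (Ask 2 2 Void Void (Done
   [((-1),2,E,NE), (1,1,NE,NW), (2,2,NW,W), (2,1,E,NW), (2,1,NW,W), (1,0,E,NE), (1,0,NE,W)]) Void
   Void Void) (Ask 2 2 Void Void (Ask 0 3 Void (Done [(0,3,NE,W), ((-1),2,E,NE), (1,1,NE,NW),
   (2,2,NW,W), (2,1,E,NW), (2,1,NW,W), (1,0,E,NE), (1,0,NE,W)]) Void Void Void Void) Void Void
   Void) (Ask 0 3 (Ask 2 2 Void Void Void Void Void Void) (Ask (-1) 4 Void (Ask 2 2 Void Void
   (Done [(0,3,NE,NW), (0,3,NW,W), ((-1),2,E,NE), (1,1,NE,NW), (2,2,NW,W), (2,1,E,NW), (2,1,NW,W),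
   (1,0,E,NE), (1,0,NE,W)]) Void Void Void) (Ask 2 2 Void Void (Done [((-1),4,NW,SW), (0,3,NE,W),
   ((-1),2,E,NE), (1,1,NE,NW), (2,2,NW,W), (2,1,E,NW), (2,1,NW,W), (1,0,E,NE), (1,0,NE,W)]) Void
   Void Void) Void Void Void) (Ask 2 2 Void Void (Done [(0,3,NW,W), ((-1),2,E,NE), (1,1,NE,NW),
   (2,2,NW,W), (2,1,E,NW), (2,1,NW,W), (1,0,E,NE), (1,0,NE,W)]) Void Void Void) Void Void Void)
   (Ask (-1) 1 Void Void (Done [((-1),2,E,NW), ((-1),2,NW,SW), (0,0,NE,NW), (0,2,NW,SW),
   (1,1,NE,W), (1,0,E,NW), (1,0,NW,W)]) (SplitL (Ask (-2) 2 Void Void Void Void Void Void) (Ask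
   (-2) 2 Void Void (Done [((-1),2,E,NW), ((-1),2,NW,W), ((-2),1,E,NE), (0,0,NE,NW), (0,2,NW,SW),
   (1,1,NE,W), (1,0,E,NW), (1,0,NW,W)]) (Done [((-2),1,E,NW), ((-1),2,E,NW), ((-1),2,NW,SW),
   (0,0,NE,NW), (0,2,NW,SW), (1,1,NE,W), (1,0,E,NW), (1,0,NW,W)]) Void Void)) Void Void) Void
   Void)) Void Void) (Ask 2 2 (Done [(2,1,E,NE), (2,1,NE,W), (1,0,E,NE), (1,0,NE,W)]) (SplitR (Ask
   5 0 Void Void (Ask 3 2 Void Void Void Void Void Void) Void Void Void) (Ask 3 2 (Ask 4 1 (Done
   [(3,0,E,NW), (4,1,E,NW), (4,1,NW,SW), (3,1,NE,NW), (3,1,NW,SW), (2,1,NE,W), (1,0,E,NE),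
   (1,0,NE,W)]) Void Void Void Void (Done [(3,0,E,NW), (5,0,NW,W), (3,1,E,NE), (3,1,NE,NW),
   (3,1,NW,SW), (2,1,NE,W), (1,0,E,NE), (1,0,NE,W)])) (Done [(3,2,NE,W), (2,1,E,NE), (2,1,NE,W),
   (1,0,E,NE), (1,0,NE,W)]) Void Void Void (Done [(3,0,E,NW), (4,1,NW,SW), (3,1,NE,NW),
   (3,1,NW,SW), (2,1,NE,W), (1,0,E,NE), (1,0,NE,W)]))) (Ask 0 3 Void (SplitL (Ask (-1) 1 Void (Ask
   0 2 Void Void (Done [(0,0,NE,NW), (0,2,NW,SW), (1,1,NE,W), (1,0,E,NW), (1,0,NW,W)]) Void Void
   Void) Void Void Void Void) (Ask (-1) 3 Void (Ask 0 2 Void Void Void (Done [(0,3,NE,W),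
   ((-1),2,E,NE), (1,1,NE,NW), (2,2,NW,W), (2,1,E,NW), (2,1,NW,W), (1,0,E,NE), (1,0,NE,W)]) Void
   Void) (Ask (-1) 1 Void (Ask 0 2 Void Void Void Void Void Void) (Ask 0 2 Void Void Void (Ask
   (-1) 4 Void (Done [(0,3,NE,NW), (0,3,NW,W), ((-1),2,E,NE), (1,1,NE,NW), (2,2,NW,W), (2,1,E,NW),
   (2,1,NW,W), (1,0,E,NE), (1,0,NE,W)]) (Done [((-1),4,NW,SW), (0,3,NE,W), ((-1),2,E,NE),
   (1,1,NE,NW), (2,2,NW,W), (2,1,E,NW), (2,1,NW,W), (1,0,E,NE), (1,0,NE,W)]) Void Void Void) Void
   Void) (Ask 0 2 Void Void Void (Ask (-1) 4 Void (Done [(0,3,NE,NW), (0,3,NW,W), ((-1),2,E,NE),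
   (1,1,NE,NW), (2,2,NW,W), (2,1,E,NW), (2,1,NW,W), (1,0,E,NE), (1,0,NE,W)]) (Done
   [((-1),4,NW,SW), (0,3,NE,W), ((-1),2,E,NE), (1,1,NE,NW), (2,2,NW,W), (2,1,E,NW), (2,1,NW,W),
   (1,0,E,NE), (1,0,NE,W)]) Void Void Void) Void Void) Void Void) (Ask 0 2 Void Void Void (Ask
   (-1) 1 Void Void (Done [((-1),2,E,NW), ((-1),2,NW,SW), (0,0,NE,NW), (0,2,NW,SW), (1,1,NE,W),
   (1,0,E,NW), (1,0,NW,W)]) (SplitL (Ask (-2) 2 Void Void Void Void Void Void) (Ask (-2) 2 Void
   Void (Done [((-1),2,E,NW), ((-1),2,NW,W), ((-2),1,E,NE), (0,0,NE,NW), (0,2,NW,SW), (1,1,NE,W),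
   (1,0,E,NW), (1,0,NW,W)]) (Done [((-2),1,E,NW), ((-1),2,E,NW), ((-1),2,NW,SW), (0,0,NE,NW),
   (0,2,NW,SW), (1,1,NE,W), (1,0,E,NW), (1,0,NW,W)]) Void Void)) Void Void) Void Void) (Ask 0 2
   Void Void Void Void Void Void) (Ask (-1) 1 Void (Done [(0,0,NE,NW), (0,2,NW,SW), (1,1,NE,W),
   (1,0,E,NW), (1,0,NW,W)]) (Ask (-1) 2 Void Void (Done [((-1),2,NW,SW), (0,0,NE,NW), (0,2,NW,SW),
   (1,1,NE,W), (1,0,E,NW), (1,0,NW,W)]) Void Void Void) (Ask (-1) 2 Void Void (SplitL (Ask (-2) 2
   Void Void Void Void Void Void) (Ask (-2) 2 Void Void (Done [((-1),2,NW,W), ((-2),1,E,NE),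
   (0,0,NE,NW), (0,2,NW,SW), (1,1,NE,W), (1,0,E,NW), (1,0,NW,W)]) (Done [((-2),1,E,NW),
   ((-1),2,NW,SW), (0,0,NE,NW), (0,2,NW,SW), (1,1,NE,W), (1,0,E,NW), (1,0,NW,W)]) Void Void))
   (Done [((-2),1,E,NE), (0,0,NE,NW), (0,2,NW,SW), (1,1,NE,W), (1,0,E,NW), (1,0,NW,W)]) Void Void)
   Void Void))) (Ask 0 2 Void Void (Done [(0,3,NW,SW), (1,1,NE,NW), (2,2,NW,W), (2,1,E,NW),
   (2,1,NW,W), (1,0,E,NE), (1,0,NE,W)]) (SplitL (Ask (-1) 1 Void Void Void Void Void Void) (Ask
   (-1) 3 Void Void (Done [(0,3,NW,W), ((-1),2,E,NE), (1,1,NE,NW), (2,2,NW,W), (2,1,E,NW),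
   (2,1,NW,W), (1,0,E,NE), (1,0,NE,W)]) (Done [((-1),2,E,NW), (0,3,NW,SW), (1,1,NE,NW),
   (2,2,NW,W), (2,1,E,NW), (2,1,NW,W), (1,0,E,NE), (1,0,NE,W)]) Void Void)) Void Void) (Ask 0 2
   Void Void Void (Done [((-1),2,E,NE), (1,1,NE,NW), (2,2,NW,W), (2,1,E,NW), (2,1,NW,W),
   (1,0,E,NE), (1,0,NE,W)]) Void Void) (Done [(1,1,NE,NW), (2,2,NW,W), (2,1,E,NW), (2,1,NW,W),
   (1,0,E,NE), (1,0,NE,W)]) Void) Void Void Void)) Void Void Void Void Void) (Done [(2,1,NE,W),
   (1,0,E,NE), (1,0,NE,W)]) Void Void Void (SplitR (Ask 0 2 Void (Ask 4 0 Void Void (Ask 2 2 Void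
   Void (Done [(4,0,NW,W), (1,1,NE,NW), (2,2,NW,W), (2,1,E,NW), (2,1,NW,W), (1,0,E,NE),
   (1,0,NE,W)]) Void Void Void) Void Void Void) (SplitL (Ask (-1) 1 Void (Done [(0,0,NE,NW),
   (0,2,NW,SW), (1,1,NE,W), (1,0,E,NW), (1,0,NW,W)]) Void Void Void Void) (Ask (-1) 1 Void (Done
   [(0,0,NE,NW), (0,2,NW,SW), (1,1,NE,W), (1,0,E,NW), (1,0,NW,W)]) (Ask (-1) 2 Void Void (Done
   [((-1),2,NW,SW), (0,0,NE,NW), (0,2,NW,SW), (1,1,NE,W), (1,0,E,NW), (1,0,NW,W)]) Void Void Void)
   (Ask (-1) 2 Void Void (SplitL (Ask (-2) 2 Void Void Void Void Void Void) (Ask (-2) 2 Void Void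
   (Done [((-1),2,NW,W), ((-2),1,E,NE), (0,0,NE,NW), (0,2,NW,SW), (1,1,NE,W), (1,0,E,NW),
   (1,0,NW,W)]) (Done [((-2),1,E,NW), ((-1),2,NW,SW), (0,0,NE,NW), (0,2,NW,SW), (1,1,NE,W),
   (1,0,E,NW), (1,0,NW,W)]) Void Void)) (Done [((-2),1,E,NE), (0,0,NE,NW), (0,2,NW,SW),
   (1,1,NE,W), (1,0,E,NW), (1,0,NW,W)]) Void Void) Void Void)) (Ask 4 0 Void Void (SplitL (Ask
   (-1) 1 Void Void Void Void Void Void) (Ask (-1) 3 (Ask 2 2 Void Void (Done [(4,0,NW,W),
   ((-1),2,E,NE), (1,1,NE,NW), (2,2,NW,W), (2,1,E,NW), (2,1,NW,W), (1,0,E,NE), (1,0,NE,W)]) Void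
   Void Void) (Ask 2 2 Void Void (Ask 0 3 Void (Done [(4,0,NW,W), (0,3,NE,W), ((-1),2,E,NE),
   (1,1,NE,NW), (2,2,NW,W), (2,1,E,NW), (2,1,NW,W), (1,0,E,NE), (1,0,NE,W)]) Void Void Void Void)
   Void Void Void) (Ask 0 3 (Ask 2 2 Void Void Void Void Void Void) (Ask (-1) 4 Void (Ask 2 2 Void
   Void (Done [(4,0,NW,W), (0,3,NE,NW), (0,3,NW,W), ((-1),2,E,NE), (1,1,NE,NW), (2,2,NW,W),
   (2,1,E,NW), (2,1,NW,W), (1,0,E,NE), (1,0,NE,W)]) Void Void Void) (Ask 2 2 Void Void (Done
   [(4,0,NW,W), ((-1),4,NW,SW), (0,3,NE,W), ((-1),2,E,NE), (1,1,NE,NW), (2,2,NW,W), (2,1,E,NW),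
   (2,1,NW,W), (1,0,E,NE), (1,0,NE,W)]) Void Void Void) Void Void Void) (Ask 2 2 Void Void (Done
   [(4,0,NW,W), (0,3,NW,W), ((-1),2,E,NE), (1,1,NE,NW), (2,2,NW,W), (2,1,E,NW), (2,1,NW,W),
   (1,0,E,NE), (1,0,NE,W)]) Void Void Void) Void Void Void) (Ask (-1) 1 Void Void (Done
   [((-1),2,E,NW), ((-1),2,NW,SW), (0,0,NE,NW), (0,2,NW,SW), (1,1,NE,W), (1,0,E,NW), (1,0,NW,W)])
   (SplitL (Ask (-2) 2 Void Void Void Void Void Void) (Ask (-2) 2 Void Void (Done [((-1),2,E,NW),
   ((-1),2,NW,W), ((-2),1,E,NE), (0,0,NE,NW), (0,2,NW,SW), (1,1,NE,W), (1,0,E,NW), (1,0,NW,W)])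
   (Done [((-2),1,E,NW), ((-1),2,E,NW), ((-1),2,NW,SW), (0,0,NE,NW), (0,2,NW,SW), (1,1,NE,W),
   (1,0,E,NW), (1,0,NW,W)]) Void Void)) Void Void) Void Void)) Void Void Void) Void Void) (Ask 2 2
   (Ask 3 1 (Done [(3,1,E,NW), (3,1,NW,SW), (2,1,NE,W), (1,0,E,NE), (1,0,NE,W)]) Void Void Void
   Void (Done [(4,0,NW,W), (2,1,E,NE), (2,1,NE,W), (1,0,E,NE), (1,0,NE,W)])) (Ask 3 1 (Ask 4 0
   (SplitR (Ask 3 2 Void Void Void Void Void Void) (Ask 3 2 (Done [(3,1,E,NE), (3,1,NE,NW),
   (3,1,NW,SW), (2,1,NE,W), (1,0,E,NE), (1,0,NE,W)]) (Done [(3,2,NE,W), (3,1,E,NW), (3,1,NW,SW),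
   (2,1,NE,W), (1,0,E,NE), (1,0,NE,W)]) Void Void Void Void)) Void Void Void Void Void) (Done
   [(3,1,NE,NW), (3,1,NW,SW), (2,1,NE,W), (1,0,E,NE), (1,0,NE,W)]) Void Void Void (SplitR (Ask 5 0
   Void Void (Ask 3 2 Void Void Void Void Void Void) Void Void Void) (Ask 3 2 (Ask 4 1 (Done
   [(4,1,E,NW), (4,1,NW,SW), (3,1,NE,NW), (3,1,NW,SW), (2,1,NE,W), (1,0,E,NE), (1,0,NE,W)]) Void
   Void Void Void (Done [(5,0,NW,W), (3,1,E,NE), (3,1,NE,NW), (3,1,NW,SW), (2,1,NE,W), (1,0,E,NE),
   (1,0,NE,W)])) (Done [(4,0,NW,W), (3,2,NE,W), (2,1,E,NE), (2,1,NE,W), (1,0,E,NE), (1,0,NE,W)])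
   Void Void Void (Done [(4,1,NW,SW), (3,1,NE,NW), (3,1,NW,SW), (2,1,NE,W), (1,0,E,NE),
   (1,0,NE,W)])))) (Ask 0 2 Void (Ask 3 1 (Ask 4 0 (Done [(4,0,E,NW), (4,0,NW,W), (1,1,NE,NW),
   (2,2,NW,W), (2,1,E,NW), (2,1,NW,W), (1,0,E,NE), (1,0,NE,W)]) Void Void Void Void Void) (Ask 4 0
   (SplitR (Ask 4 1 Void Void Void Void Void Void) (Ask 4 1 (Done [(4,0,E,NE), (4,0,NE,NW),
   (4,0,NW,W), (1,1,NE,NW), (2,2,NW,W), (2,1,E,NW), (2,1,NW,W), (1,0,E,NE), (1,0,NE,W)]) (Done
   [(1,1,NE,NW), (4,1,NE,W), (4,0,E,NW), (4,0,NW,W), (2,2,NW,W), (2,1,E,NW), (2,1,NW,W),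
   (1,0,E,NE), (1,0,NE,W)]) Void Void Void Void)) (Done [(4,0,NE,NW), (4,0,NW,W), (1,1,NE,NW),
   (2,2,NW,W), (2,1,E,NW), (2,1,NW,W), (1,0,E,NE), (1,0,NE,W)]) Void Void Void Void) Void Void
   Void (Done [(4,0,NW,W), (1,1,NE,NW), (2,2,NW,W), (2,1,E,NW), (2,1,NW,W), (1,0,E,NE),
   (1,0,NE,W)])) (SplitL (Ask (-1) 1 Void (Done [(0,0,NE,NW), (0,2,NW,SW), (1,1,NE,W), (1,0,E,NW),
   (1,0,NW,W)]) Void Void Void Void) (Ask (-1) 1 Void (Done [(0,0,NE,NW), (0,2,NW,SW), (1,1,NE,W),
   (1,0,E,NW), (1,0,NW,W)]) (Ask (-1) 2 Void Void (Done [((-1),2,NW,SW), (0,0,NE,NW), (0,2,NW,SW),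
   (1,1,NE,W), (1,0,E,NW), (1,0,NW,W)]) Void Void Void) (Ask (-1) 2 Void Void (SplitL (Ask (-2) 2
   Void Void Void Void Void Void) (Ask (-2) 2 Void Void (Done [((-1),2,NW,W), ((-2),1,E,NE),
   (0,0,NE,NW), (0,2,NW,SW), (1,1,NE,W), (1,0,E,NW), (1,0,NW,W)]) (Done [((-2),1,E,NW),
   ((-1),2,NW,SW), (0,0,NE,NW), (0,2,NW,SW), (1,1,NE,W), (1,0,E,NW), (1,0,NW,W)]) Void Void))
   (Done [((-2),1,E,NE), (0,0,NE,NW), (0,2,NW,SW), (1,1,NE,W), (1,0,E,NW), (1,0,NW,W)]) Void Void)
   Void Void)) (SplitL (Ask (-1) 1 Void Void Void Void Void Void) (Ask (-1) 3 (Ask 3 1 (Ask 4 0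
   (Done [(4,0,E,NW), (4,0,NW,W), ((-1),2,E,NE), (1,1,NE,NW), (2,2,NW,W), (2,1,E,NW), (2,1,NW,W),
   (1,0,E,NE), (1,0,NE,W)]) Void Void Void Void Void) (Ask 4 0 (SplitR (Ask 4 1 Void Void Void
   Void Void Void) (Ask 4 1 (Done [(4,0,E,NE), (4,0,NE,NW), (4,0,NW,W), ((-1),2,E,NE),
   (1,1,NE,NW), (2,2,NW,W), (2,1,E,NW), (2,1,NW,W), (1,0,E,NE), (1,0,NE,W)]) (Done [(4,1,NE,W),
   (4,0,E,NW), (4,0,NW,W), ((-1),2,E,NE), (1,1,NE,NW), (2,2,NW,W), (2,1,E,NW), (2,1,NW,W),
   (1,0,E,NE), (1,0,NE,W)]) Void Void Void Void)) (Done [(4,0,NE,NW), (4,0,NW,W), ((-1),2,E,NE),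
   (1,1,NE,NW), (2,2,NW,W), (2,1,E,NW), (2,1,NW,W), (1,0,E,NE), (1,0,NE,W)]) Void Void Void Void)
   Void Void Void (Done [(4,0,NW,W), ((-1),2,E,NE), (1,1,NE,NW), (2,2,NW,W), (2,1,E,NW),
   (2,1,NW,W), (1,0,E,NE), (1,0,NE,W)])) (Ask 3 1 (Ask 4 0 (Ask 0 3 Void (Done [(4,0,E,NW),
   (4,0,NW,W), (0,3,NE,W), ((-1),2,E,NE), (1,1,NE,NW), (2,2,NW,W), (2,1,E,NW), (2,1,NW,W),
   (1,0,E,NE), (1,0,NE,W)]) Void Void Void Void) Void Void Void Void Void) (Ask 4 0 (SplitR (Ask 4
   1 Void Void Void Void Void Void) (Ask 4 1 (Ask 0 3 Void (Done [(4,0,E,NE), (4,0,NE,NW),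
   (4,0,NW,W), (0,3,NE,W), ((-1),2,E,NE), (1,1,NE,NW), (2,2,NW,W), (2,1,E,NW), (2,1,NW,W),
   (1,0,E,NE), (1,0,NE,W)]) Void Void Void Void) (Ask 0 3 Void (Done [(4,1,NE,W), (4,0,E,NW),
   (4,0,NW,W), (0,3,NE,W), ((-1),2,E,NE), (1,1,NE,NW), (2,2,NW,W), (2,1,E,NW), (2,1,NW,W),
   (1,0,E,NE), (1,0,NE,W)]) Void Void Void Void) Void Void Void Void)) (Ask 0 3 Void (Done
   [(4,0,NE,NW), (4,0,NW,W), (0,3,NE,W), ((-1),2,E,NE), (1,1,NE,NW), (2,2,NW,W), (2,1,E,NW),
   (2,1,NW,W), (1,0,E,NE), (1,0,NE,W)]) Void Void Void Void) Void Void Void Void) Void Void Void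
   (Ask 0 3 Void (Done [(4,0,NW,W), (0,3,NE,W), ((-1),2,E,NE), (1,1,NE,NW), (2,2,NW,W),
   (2,1,E,NW), (2,1,NW,W), (1,0,E,NE), (1,0,NE,W)]) Void Void Void Void)) (Ask (-1) 1 Void Void
   (Ask 0 3 Void (Ask 3 1 (Ask 4 0 (Ask (-1) 4 Void (Done [(4,0,E,NW), (4,0,NW,W), (0,3,NE,NW),
   (0,3,NW,W), ((-1),2,E,NE), (1,1,NE,NW), (2,2,NW,W), (2,1,E,NW), (2,1,NW,W), (1,0,E,NE),
   (1,0,NE,W)]) (Done [(4,0,E,NW), (4,0,NW,W), ((-1),4,NW,SW), (0,3,NE,W), ((-1),2,E,NE),
   (1,1,NE,NW), (2,2,NW,W), (2,1,E,NW), (2,1,NW,W), (1,0,E,NE), (1,0,NE,W)]) Void Void Void) Void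
   Void Void Void Void) (Ask 4 0 (SplitR (Ask 4 1 Void Void Void Void Void Void) (Ask 4 1 (Ask
   (-1) 4 Void (Done [(4,0,E,NE), (4,0,NE,NW), (4,0,NW,W), (0,3,NE,NW), (0,3,NW,W), ((-1),2,E,NE),
   (1,1,NE,NW), (2,2,NW,W), (2,1,E,NW), (2,1,NW,W), (1,0,E,NE), (1,0,NE,W)]) (Done [(4,0,E,NE),
   (4,0,NE,NW), (4,0,NW,W), ((-1),4,NW,SW), (0,3,NE,W), ((-1),2,E,NE), (1,1,NE,NW), (2,2,NW,W),
   (2,1,E,NW), (2,1,NW,W), (1,0,E,NE), (1,0,NE,W)]) Void Void Void) (Ask (-1) 4 Void (Done
   [(4,1,NE,W), (4,0,E,NW), (4,0,NW,W), (0,3,NE,NW), (0,3,NW,W), ((-1),2,E,NE), (1,1,NE,NW),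
   (2,2,NW,W), (2,1,E,NW), (2,1,NW,W), (1,0,E,NE), (1,0,NE,W)]) (Done [(4,1,NE,W), (4,0,E,NW),
   (4,0,NW,W), ((-1),4,NW,SW), (0,3,NE,W), ((-1),2,E,NE), (1,1,NE,NW), (2,2,NW,W), (2,1,E,NW),
   (2,1,NW,W), (1,0,E,NE), (1,0,NE,W)]) Void Void Void) Void Void Void Void)) (Ask (-1) 4 Void
   (Done [(4,0,NE,NW), (4,0,NW,W), (0,3,NE,NW), (0,3,NW,W), ((-1),2,E,NE), (1,1,NE,NW),
   (2,2,NW,W), (2,1,E,NW), (2,1,NW,W), (1,0,E,NE), (1,0,NE,W)]) (Done [(4,0,NE,NW), (4,0,NW,W),
   ((-1),4,NW,SW), (0,3,NE,W), ((-1),2,E,NE), (1,1,NE,NW), (2,2,NW,W), (2,1,E,NW), (2,1,NW,W),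
   (1,0,E,NE), (1,0,NE,W)]) Void Void Void) Void Void Void Void) Void Void Void (Ask (-1) 4 Void
   (Done [(4,0,NW,W), (0,3,NE,NW), (0,3,NW,W), ((-1),2,E,NE), (1,1,NE,NW), (2,2,NW,W), (2,1,E,NW),
   (2,1,NW,W), (1,0,E,NE), (1,0,NE,W)]) (Done [(4,0,NW,W), ((-1),4,NW,SW), (0,3,NE,W),
   ((-1),2,E,NE), (1,1,NE,NW), (2,2,NW,W), (2,1,E,NW), (2,1,NW,W), (1,0,E,NE), (1,0,NE,W)]) Void
   Void Void)) (Ask 3 1 (Ask 4 0 (Done [(4,0,E,NW), (4,0,NW,W), (0,3,NW,W), ((-1),2,E,NE),
   (1,1,NE,NW), (2,2,NW,W), (2,1,E,NW), (2,1,NW,W), (1,0,E,NE), (1,0,NE,W)]) Void Void Void Void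
   Void) (Ask 4 0 (SplitR (Ask 4 1 Void Void Void Void Void Void) (Ask 4 1 (Done [(4,0,E,NE),
   (4,0,NE,NW), (4,0,NW,W), (0,3,NW,W), ((-1),2,E,NE), (1,1,NE,NW), (2,2,NW,W), (2,1,E,NW),
   (2,1,NW,W), (1,0,E,NE), (1,0,NE,W)]) (Done [(4,1,NE,W), (4,0,E,NW), (4,0,NW,W), (0,3,NW,W),
   ((-1),2,E,NE), (1,1,NE,NW), (2,2,NW,W), (2,1,E,NW), (2,1,NW,W), (1,0,E,NE), (1,0,NE,W)]) Void
   Void Void Void)) (Done [(4,0,NE,NW), (4,0,NW,W), (0,3,NW,W), ((-1),2,E,NE), (1,1,NE,NW),
   (2,2,NW,W), (2,1,E,NW), (2,1,NW,W), (1,0,E,NE), (1,0,NE,W)]) Void Void Void Void) Void Void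
   Void (Done [(4,0,NW,W), (0,3,NW,W), ((-1),2,E,NE), (1,1,NE,NW), (2,2,NW,W), (2,1,E,NW),
   (2,1,NW,W), (1,0,E,NE), (1,0,NE,W)])) Void Void Void) (SplitL (Ask 3 1 (Ask 4 0 (Ask 0 3 Void
   (Ask (-1) 4 Void (Done [(4,0,E,NW), (4,0,NW,W), (0,3,NE,NW), (0,3,NW,W), ((-1),2,E,NE),
   (1,1,NE,NW), (2,2,NW,W), (2,1,E,NW), (2,1,NW,W), (1,0,E,NE), (1,0,NE,W)]) (Done [(4,0,E,NW),
   (4,0,NW,W), ((-1),4,NW,SW), (0,3,NE,W), ((-1),2,E,NE), (1,1,NE,NW), (2,2,NW,W), (2,1,E,NW),
   (2,1,NW,W), (1,0,E,NE), (1,0,NE,W)]) Void Void Void) (Done [(4,0,E,NW), (4,0,NW,W), (0,3,NW,W),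
   ((-1),2,E,NE), (1,1,NE,NW), (2,2,NW,W), (2,1,E,NW), (2,1,NW,W), (1,0,E,NE), (1,0,NE,W)]) Void
   Void Void) Void Void Void Void Void) (Ask 0 3 Void (Ask (-1) 4 Void (Ask (-2) 2 Void (Done
   [(0,3,NE,NW), (0,3,NW,W), ((-1),2,E,NE), (1,1,NE,NW), ((-1),2,NE,W), ((-2),1,E,NE),
   (0,0,NE,NW), (1,1,NW,W), (1,0,E,NW), (1,0,NW,W)]) Void Void Void Void) (Ask (-2) 2 Void (Done
   [((-1),4,NW,SW), (0,3,NE,W), ((-1),2,E,NE), (1,1,NE,NW), ((-1),2,NE,W), ((-2),1,E,NE),
   (0,0,NE,NW), (1,1,NW,W), (1,0,E,NW), (1,0,NW,W)]) Void Void Void Void) Void Void Void) (Ask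
   (-2) 2 Void (Done [(0,3,NW,W), ((-1),2,E,NE), (1,1,NE,NW), ((-1),2,NE,W), ((-2),1,E,NE),
   (0,0,NE,NW), (1,1,NW,W), (1,0,E,NW), (1,0,NW,W)]) Void Void Void Void) Void Void Void) Void
   Void Void (Ask 0 3 Void (Ask (-1) 4 Void (Done [(4,0,NW,W), (0,3,NE,NW), (0,3,NW,W),
   ((-1),2,E,NE), (1,1,NE,NW), (2,2,NW,W), (2,1,E,NW), (2,1,NW,W), (1,0,E,NE), (1,0,NE,W)]) (Done
   [(4,0,NW,W), ((-1),4,NW,SW), (0,3,NE,W), ((-1),2,E,NE), (1,1,NE,NW), (2,2,NW,W), (2,1,E,NW),
   (2,1,NW,W), (1,0,E,NE), (1,0,NE,W)]) Void Void Void) (Done [(4,0,NW,W), (0,3,NW,W),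
   ((-1),2,E,NE), (1,1,NE,NW), (2,2,NW,W), (2,1,E,NW), (2,1,NW,W), (1,0,E,NE), (1,0,NE,W)]) Void
   Void Void)) (Ask (-2) 3 Void Void (Ask (-2) 2 Void Void (Done [((-1),3,NW,W), ((-1),2,E,NW),
   ((-1),2,NW,W), ((-2),1,E,NE), (0,0,NE,NW), (0,2,NW,SW), (1,1,NE,W), (1,0,E,NW), (1,0,NW,W)])
   (Done [((-2),1,E,NW), ((-1),3,NW,W), ((-1),2,E,NW), ((-1),2,NW,SW), (0,0,NE,NW), (0,2,NW,SW),
   (1,1,NE,W), (1,0,E,NW), (1,0,NW,W)]) Void Void) (Ask 0 3 Void (Ask (-1) 4 Void (Ask (-2) 2 Void
   Void Void (Done [((-3),2,E,NE), (0,3,NE,NW), (0,3,NW,W), ((-1),2,E,NE), (1,1,NE,NW),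
   ((-1),2,NE,W), ((-2),1,E,NE), (0,0,NE,NW), (1,1,NW,W), (1,0,E,NW), (1,0,NW,W)]) Void Void) (Ask
   (-2) 2 Void Void Void (Done [((-3),2,E,NE), ((-1),4,NW,SW), (0,3,NE,W), ((-1),2,E,NE),
   (1,1,NE,NW), ((-1),2,NE,W), ((-2),1,E,NE), (0,0,NE,NW), (1,1,NW,W), (1,0,E,NW), (1,0,NW,W)])
   Void Void) Void Void Void) (Ask (-2) 2 Void Void Void (Done [((-3),2,E,NE), (0,3,NW,W),
   ((-1),2,E,NE), (1,1,NE,NW), ((-1),2,NE,W), ((-2),1,E,NE), (0,0,NE,NW), (1,1,NW,W), (1,0,E,NW),
   (1,0,NW,W)]) Void Void) Void Void Void) (Ask 0 3 Void (Ask (-1) 4 Void (Done [(0,3,NE,NW),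
   (0,3,NW,W), ((-1),2,E,NE), (1,1,NE,NW), ((-1),2,NE,W), ((-2),1,E,NE), (0,0,NE,NW), (1,1,NW,W),
   (1,0,E,NW), (1,0,NW,W)]) (Done [((-1),4,NW,SW), (0,3,NE,W), ((-1),2,E,NE), (1,1,NE,NW),
   ((-1),2,NE,W), ((-2),1,E,NE), (0,0,NE,NW), (1,1,NW,W), (1,0,E,NW), (1,0,NW,W)]) Void Void Void)
   (Done [(0,3,NW,W), ((-1),2,E,NE), (1,1,NE,NW), ((-1),2,NE,W), ((-2),1,E,NE), (0,0,NE,NW),
   (1,1,NW,W), (1,0,E,NW), (1,0,NW,W)]) Void Void Void) Void)) Void Void) (Ask (-1) 1 Void Void
   (Done [((-1),2,E,NW), ((-1),2,NW,SW), (0,0,NE,NW), (0,2,NW,SW), (1,1,NE,W), (1,0,E,NW),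
   (1,0,NW,W)]) (SplitL (Ask (-2) 2 Void Void Void Void Void Void) (Ask (-2) 2 Void Void (Done
   [((-1),2,E,NW), ((-1),2,NW,W), ((-2),1,E,NE), (0,0,NE,NW), (0,2,NW,SW), (1,1,NE,W), (1,0,E,NW),
   (1,0,NW,W)]) (Done [((-2),1,E,NW), ((-1),2,E,NW), ((-1),2,NW,SW), (0,0,NE,NW), (0,2,NW,SW),
   (1,1,NE,W), (1,0,E,NW), (1,0,NW,W)]) Void Void)) Void Void) Void Void)) Void Void) Void Void
   (Done [(3,1,NW,SW), (2,1,NE,W), (1,0,E,NE), (1,0,NE,W)]))))) (SplitR (Ask 2 1 Void Void (Done
   [(2,1,NW,W), (1,0,E,NE), (1,0,NE,W)]) Void Void (SplitL Void (Ask (-1) 1 Void (Done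
   [(0,0,NE,NW), (1,1,NW,W), (1,0,E,NW), (1,0,NW,W)]) (Ask (-1) 2 Void (SplitL (Ask (-2) 1 Void
   Void Void Void Void Void) (Ask (-2) 4 (Ask (-2) 3 Void Void (Ask 1 2 Void Void (Done
   [(1,2,NW,SW), (0,2,NE,W), ((-1),3,E,NW), ((-1),3,NW,W), ((-1),2,E,NW), ((-1),2,NW,SW),
   (0,0,NE,NW), (0,2,NW,SW), (1,1,NE,W), (1,0,E,NW), (1,0,NW,W)]) Void Void Void) (SplitL (Ask
   (-2) 1 Void Void (Done [((-1),1,NW,W), ((-3),2,E,NE), ((-1),2,NE,W), ((-2),1,E,NE),
   (0,0,NE,NW), (1,1,NW,W), (1,0,E,NW), (1,0,NW,W)]) (Ask (-3) 2 Void Void Void Void Void Void)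
   Void Void) (Ask (-3) 4 Void (Ask (-2) 5 Void Void (Ask (-3) 2 Void Void (Ask 1 2 Void Void
   (SplitL (Ask (-4) 4 Void (Done [(1,2,NW,SW), (0,2,NE,W), ((-1),3,E,NW), ((-3),4,NE,W),
   ((-3),3,E,NW), ((-1),3,NW,W), ((-1),2,E,NW), ((-1),2,NW,SW), (0,0,NE,NW), (0,2,NW,SW),
   (1,1,NE,W), (1,0,E,NW), (1,0,NW,W)]) Void Void Void Void) (Ask (-4) 5 Void (Done
   [((-3),4,NE,NW), ((-2),5,NW,W), ((-2),4,E,NW), ((-2),4,NW,W), ((-3),3,E,NE), ((-1),2,NE,NW),
   ((-1),2,NW,SW), (0,0,NE,NW), (1,1,NW,W), (1,0,E,NW), (1,0,NW,W)]) (Ask (-4) 4 Void Void (Done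
   [(1,2,NW,SW), (0,2,NE,W), ((-1),3,E,NW), ((-4),5,NW,SW), ((-3),4,NE,W), ((-3),3,E,NW),
   ((-1),3,NW,W), ((-1),2,E,NW), ((-1),2,NW,SW), (0,0,NE,NW), (0,2,NW,SW), (1,1,NE,W), (1,0,E,NW),
   (1,0,NW,W)]) (SplitL (Ask (-5) 5 Void Void Void Void Void Void) (Ask (-5) 5 Void Void (Done
   [(1,2,NW,SW), (0,2,NE,W), ((-1),3,E,NW), ((-4),5,NW,W), ((-5),4,E,NE), ((-3),4,NE,W),
   ((-3),3,E,NW), ((-1),3,NW,W), ((-1),2,E,NW), ((-1),2,NW,SW), (0,0,NE,NW), (0,2,NW,SW),
   (1,1,NE,W), (1,0,E,NW), (1,0,NW,W)]) (Done [(1,2,NW,SW), (0,2,NE,W), ((-1),3,E,NW),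
   ((-5),4,E,NW), ((-4),5,NW,SW), ((-3),4,NE,W), ((-3),3,E,NW), ((-1),3,NW,W), ((-1),2,E,NW),
   ((-1),2,NW,SW), (0,0,NE,NW), (0,2,NW,SW), (1,1,NE,W), (1,0,E,NW), (1,0,NW,W)]) Void Void)) Void
   Void) (Ask (-4) 4 Void Void Void (Done [(1,2,NW,SW), (0,2,NE,W), ((-1),3,E,NW), ((-5),4,E,NE),
   ((-3),4,NE,W), ((-3),3,E,NW), ((-1),3,NW,W), ((-1),2,E,NW), ((-1),2,NW,SW), (0,0,NE,NW),
   (0,2,NW,SW), (1,1,NE,W), (1,0,E,NW), (1,0,NW,W)]) Void Void) (Done [(1,2,NW,SW), (0,2,NE,W),
   ((-1),3,E,NW), ((-3),4,NE,W), ((-3),3,E,NW), ((-1),3,NW,W), ((-1),2,E,NW), ((-1),2,NW,SW),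
   (0,0,NE,NW), (0,2,NW,SW), (1,1,NE,W), (1,0,E,NW), (1,0,NW,W)]) Void)) Void Void Void) (Ask (-2)
   1 Void Void Void (Done [((-3),1,E,NW), ((-1),1,NW,W), ((-3),2,E,NE), ((-1),2,NE,W),
   ((-2),1,E,NE), (0,0,NE,NW), (1,1,NW,W), (1,0,E,NW), (1,0,NW,W)]) Void Void) (Ask (-2) 1 Void
   Void Void Void Void Void) (Done [((-1),1,NW,W), ((-3),2,E,NE), ((-1),2,NE,W), ((-2),1,E,NE),
   (0,0,NE,NW), (1,1,NW,W), (1,0,E,NW), (1,0,NW,W)])) Void Void Void) (Ask (-2) 5 Void Void (Ask
   (-3) 5 Void Void (Done [((-2),5,NW,W), ((-2),4,E,NW), ((-2),4,NW,W), ((-3),3,E,NE),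
   ((-1),2,NE,NW), ((-1),2,NW,SW), (0,0,NE,NW), (1,1,NW,W), (1,0,E,NW), (1,0,NW,W)]) Void Void
   Void) (Done [((-2),4,E,NW), ((-2),4,NW,W), ((-3),3,E,NE), ((-1),2,NE,NW), ((-1),2,NW,SW),
   (0,0,NE,NW), (1,1,NW,W), (1,0,E,NW), (1,0,NW,W)]) Void Void) (Ask 1 2 Void Void (Done
   [(1,2,NW,SW), (0,2,NE,W), ((-3),3,E,NW), ((-1),3,E,NW), ((-1),3,NW,W), ((-1),2,E,NW),
   ((-1),2,NW,SW), (0,0,NE,NW), (0,2,NW,SW), (1,1,NE,W), (1,0,E,NW), (1,0,NW,W)]) Void Void Void)
   Void Void)) Void Void) (Ask 1 2 Void Void (Ask (-1) 4 Void Void Void Void Void Void) Void Void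
   Void) (Ask (-2) 3 Void Void (Done [((-2),4,NW,SW), ((-1),2,NE,NW), ((-1),2,NW,SW), (0,0,NE,NW),
   (1,1,NW,W), (1,0,E,NW), (1,0,NW,W)]) (SplitL (Ask (-3) 4 Void Void Void Void Void Void) (Ask
   (-3) 4 Void Void (Done [((-2),4,NW,W), ((-3),3,E,NE), ((-1),2,NE,NW), ((-1),2,NW,SW),
   (0,0,NE,NW), (1,1,NW,W), (1,0,E,NW), (1,0,NW,W)]) (Done [((-3),3,E,NW), ((-2),4,NW,SW),
   ((-1),2,NE,NW), ((-1),2,NW,SW), (0,0,NE,NW), (1,1,NW,W), (1,0,E,NW), (1,0,NW,W)]) Void Void))
   Void Void) (Ask (-2) 3 Void Void Void (Done [((-3),3,E,NE), ((-1),2,NE,NW), ((-1),2,NW,SW),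
   (0,0,NE,NW), (1,1,NW,W), (1,0,E,NW), (1,0,NW,W)]) Void Void) (Done [((-1),2,NE,NW),
   ((-1),2,NW,SW), (0,0,NE,NW), (1,1,NW,W), (1,0,E,NW), (1,0,NW,W)]) Void)) (Done [((-1),2,NW,SW),
   (0,0,NE,NW), (1,1,NW,W), (1,0,E,NW), (1,0,NW,W)]) Void Void Void) (Ask (-1) 2 Void (SplitL (Ask
   1 2 Void Void (Ask (-1) 4 Void Void (Ask (-2) 4 Void Void Void Void (Ask (-2) 2 Void Void Void
   Void Void Void) Void) (Ask (-2) 5 Void Void Void Void Void Void) Void Void) Void Void Void)
   (Ask (-2) 2 Void (Done [((-1),2,NE,W), ((-2),1,E,NE), (0,0,NE,NW), (1,1,NW,W), (1,0,E,NW),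
   (1,0,NW,W)]) (Ask (-2) 3 Void (Done [((-1),2,NE,NW), ((-1),2,NW,W), ((-2),1,E,NE), (0,0,NE,NW),
   (1,1,NW,W), (1,0,E,NW), (1,0,NW,W)]) (Done [((-2),3,NW,SW), ((-1),2,NE,W), ((-2),1,E,NE),
   (0,0,NE,NW), (1,1,NW,W), (1,0,E,NW), (1,0,NW,W)]) Void Void Void) (Ask (-2) 3 Void (Done
   [((-2),1,E,NW), ((-1),2,NE,NW), ((-1),2,NW,SW), (0,0,NE,NW), (1,1,NW,W), (1,0,E,NW),
   (1,0,NW,W)]) (SplitL (Ask (-3) 3 Void Void Void Void Void Void) (Ask (-3) 3 Void Void (Done
   [((-2),3,NW,W), ((-3),2,E,NE), ((-1),2,NE,W), ((-2),1,E,NE), (0,0,NE,NW), (1,1,NW,W),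
   (1,0,E,NW), (1,0,NW,W)]) (Done [((-3),2,E,NW), ((-2),3,NW,SW), ((-1),2,NE,W), ((-2),1,E,NE),
   (0,0,NE,NW), (1,1,NW,W), (1,0,E,NW), (1,0,NW,W)]) Void Void)) (Done [((-3),2,E,NE),
   ((-1),2,NE,W), ((-2),1,E,NE), (0,0,NE,NW), (1,1,NW,W), (1,0,E,NW), (1,0,NW,W)]) Void Void) Void
   Void)) (SplitL (Ask (-2) 2 Void Void Void Void Void Void) (Ask (-2) 2 Void Void (Done
   [((-1),2,NW,W), ((-2),1,E,NE), (0,0,NE,NW), (1,1,NW,W), (1,0,E,NW), (1,0,NW,W)]) (Done
   [((-2),1,E,NW), ((-1),2,NW,SW), (0,0,NE,NW), (1,1,NW,W), (1,0,E,NW), (1,0,NW,W)]) Void Void))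
   (Done [((-2),1,E,NE), (0,0,NE,NW), (1,1,NW,W), (1,0,E,NW), (1,0,NW,W)]) Void Void) Void Void)))
   (Ask 2 1 (Ask 1 2 (Done [(2,1,E,NW), (2,1,NW,W), (1,0,E,NE), (1,0,NE,W)]) (SplitR (Ask 2 2 Void
   Void Void Void Void Void) (Ask 2 2 (Done [(2,1,E,NE), (2,1,NE,NW), (2,1,NW,W), (1,0,E,NE),
   (1,0,NE,W)]) (Done [(2,2,NE,W), (2,1,E,NW), (2,1,NW,W), (1,0,E,NE), (1,0,NE,W)]) Void Void Void
   Void)) (SplitR (Ask 2 2 Void Void (Done [(2,2,NW,W), (2,1,E,NW), (2,1,NW,W), (1,0,E,NE),
   (1,0,NE,W)]) Void Void Void) (Ask 2 2 (Done [(2,1,E,NE), (1,2,NW,SW), (2,1,NE,W), (1,0,E,NE),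
   (1,0,NE,W)]) (Ask 1 3 Void (Done [(2,2,NE,NW), (2,2,NW,W), (2,1,E,NW), (2,1,NW,W), (1,0,E,NE),
   (1,0,NE,W)]) (Done [(1,3,NW,SW), (2,2,NE,W), (2,1,E,NW), (2,1,NW,W), (1,0,E,NE), (1,0,NE,W)])
   Void Void Void) (Done [(2,2,NW,W), (2,1,E,NW), (2,1,NW,W), (1,0,E,NE), (1,0,NE,W)]) Void Void
   Void)) Void Void Void) (Ask 1 2 Void (Done [(2,1,NE,NW), (2,1,NW,W), (1,0,E,NE), (1,0,NE,W)])
   (Done [(1,2,NW,SW), (2,1,NE,W), (1,0,E,NE), (1,0,NE,W)]) Void Void Void) (Done [(2,1,NW,W),
   (1,0,E,NE), (1,0,NE,W)]) Void Void (SplitR (Ask 4 0 Void Void (Ask 2 2 Void Void (Ask 1 2 Void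
   Void (Done [(4,0,NW,W), (2,2,NW,W), (2,1,E,NW), (2,1,NW,W), (1,0,E,NE), (1,0,NE,W)]) Void Void
   Void) (Done [(4,0,NW,W), (2,1,E,NW), (2,1,NW,W), (1,0,E,NE), (1,0,NE,W)]) Void Void) Void Void
   Void) (Ask 3 1 (Ask 4 0 (Ask 1 2 (Done [(4,0,E,NW), (4,0,NW,W), (2,1,E,NW), (2,1,NW,W),
   (1,0,E,NE), (1,0,NE,W)]) (Ask 2 2 (Done [(3,1,E,NW), (3,1,NW,SW), (2,1,NE,NW), (2,1,NW,W),
   (1,0,E,NE), (1,0,NE,W)]) (Done [(4,0,E,NW), (4,0,NW,W), (2,2,NE,W), (2,1,E,NW), (2,1,NW,W),
   (1,0,E,NE), (1,0,NE,W)]) Void Void Void Void) (Ask 2 2 (Done [(3,1,E,NW), (3,1,NW,SW),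
   (1,2,NW,SW), (2,1,NE,W), (1,0,E,NE), (1,0,NE,W)]) (SplitR (Ask 3 2 Void Void Void Void Void
   Void) (Ask 3 2 (Done [(3,1,E,NE), (3,1,NE,NW), (3,1,NW,SW), (1,2,NW,SW), (2,1,NE,W),
   (1,0,E,NE), (1,0,NE,W)]) (Done [(1,2,NW,SW), (3,2,NE,W), (3,1,E,NW), (3,1,NW,SW), (2,1,NE,W),
   (1,0,E,NE), (1,0,NE,W)]) Void Void Void Void)) (Done [(4,0,E,NW), (4,0,NW,W), (2,2,NW,W),
   (2,1,E,NW), (2,1,NW,W), (1,0,E,NE), (1,0,NE,W)]) Void Void Void) Void Void Void) Void Void Void
   Void Void) (Ask 2 2 Void (Ask 1 2 Void (Done [(3,1,NE,NW), (3,1,NW,SW), (2,1,NE,NW),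
   (2,1,NW,W), (1,0,E,NE), (1,0,NE,W)]) (Done [(3,1,NE,NW), (3,1,NW,SW), (1,2,NW,SW), (2,1,NE,W),
   (1,0,E,NE), (1,0,NE,W)]) Void Void Void) (Ask 4 0 (SplitR (Ask 4 1 Void Void Void Void Void
   Void) (Ask 4 1 (Ask 1 2 Void Void (Done [(4,0,E,NE), (4,0,NE,NW), (4,0,NW,W), (2,2,NW,W),
   (2,1,E,NW), (2,1,NW,W), (1,0,E,NE), (1,0,NE,W)]) Void Void Void) (Ask 1 2 Void Void (Done
   [(4,1,NE,W), (4,0,E,NW), (4,0,NW,W), (2,2,NW,W), (2,1,E,NW), (2,1,NW,W), (1,0,E,NE),
   (1,0,NE,W)]) Void Void Void) Void Void Void Void)) (Ask 1 2 Void Void (Done [(4,0,NE,NW),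
   (4,0,NW,W), (2,2,NW,W), (2,1,E,NW), (2,1,NW,W), (1,0,E,NE), (1,0,NE,W)]) Void Void Void) Void
   Void Void Void) (Ask 4 0 (SplitR (Ask 4 1 Void Void Void Void Void Void) (Ask 4 1 (Done
   [(4,0,E,NE), (4,0,NE,NW), (4,0,NW,W), (2,1,E,NW), (2,1,NW,W), (1,0,E,NE), (1,0,NE,W)]) (Done
   [(4,1,NE,W), (4,0,E,NW), (4,0,NW,W), (2,1,E,NW), (2,1,NW,W), (1,0,E,NE), (1,0,NE,W)]) Void Void
   Void Void)) (Done [(4,0,NE,NW), (4,0,NW,W), (2,1,E,NW), (2,1,NW,W), (1,0,E,NE), (1,0,NE,W)])
   Void Void Void Void) Void Void) (Ask 1 2 Void (Done [(3,1,NW,SW), (2,1,NE,NW), (2,1,NW,W),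
   (1,0,E,NE), (1,0,NE,W)]) (Done [(3,1,NW,SW), (1,2,NW,SW), (2,1,NE,W), (1,0,E,NE), (1,0,NE,W)])
   Void Void Void) Void Void (Ask 1 2 (Done [(4,0,NW,W), (2,1,E,NW), (2,1,NW,W), (1,0,E,NE),
   (1,0,NE,W)]) (Ask 2 2 (Done [(4,0,NW,W), (2,1,E,NE), (2,1,NE,NW), (2,1,NW,W), (1,0,E,NE),
   (1,0,NE,W)]) (Done [(4,0,NW,W), (2,2,NE,W), (2,1,E,NW), (2,1,NW,W), (1,0,E,NE), (1,0,NE,W)])
   Void Void Void Void) (Ask 2 2 (Done [(4,0,NW,W), (2,1,E,NE), (1,2,NW,SW), (2,1,NE,W),
   (1,0,E,NE), (1,0,NE,W)]) (Ask 1 3 Void (Done [(4,0,NW,W), (2,2,NE,NW), (2,2,NW,W), (2,1,E,NW),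
   (2,1,NW,W), (1,0,E,NE), (1,0,NE,W)]) (Done [(4,0,NW,W), (1,3,NW,SW), (2,2,NE,W), (2,1,E,NW),
   (2,1,NW,W), (1,0,E,NE), (1,0,NE,W)]) Void Void Void) (Done [(4,0,NW,W), (2,2,NW,W), (2,1,E,NW),
   (2,1,NW,W), (1,0,E,NE), (1,0,NE,W)]) Void Void Void) Void Void Void))))) Void Void Void)) (Done
   [(1,0,NE,W)]) Void Void Void Void)) (SplitR (Ask 1 0 Void Void (Done [(1,0,NW,W)]) Void Void
   Void) (Ask 1 0 (Ask 0 1 (Done [(1,0,E,NW), (1,0,NW,W)]) (SplitR (Ask 1 1 Void Void Void Void
   Void Void) (Ask 1 1 (Done [(1,0,E,NE), (1,0,NE,NW), (1,0,NW,W)]) (Done [(1,1,NE,W), (1,0,E,NW),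
   (1,0,NW,W)]) Void Void Void Void)) (SplitR (Ask 1 1 Void Void (Done [(1,1,NW,W), (1,0,E,NW),
   (1,0,NW,W)]) Void Void Void) (Ask 1 1 (Done [(1,0,E,NE), (0,1,NW,SW), (1,0,NE,W)]) (SplitR (Ask
   2 1 Void Void Void Void Void (Ask 0 2 Void (Done [(1,1,NE,NW), (1,1,NW,W), (1,0,E,NW),
   (1,0,NW,W)]) (Done [(0,2,NW,SW), (1,1,NE,W), (1,0,E,NW), (1,0,NW,W)]) Void Void Void)) (Ask 2 1
   (Ask 0 2 Void (Done [(1,1,NE,NW), (1,1,NW,W), (1,0,E,NW), (1,0,NW,W)]) (Done [(0,2,NW,SW),
   (1,1,NE,W), (1,0,E,NW), (1,0,NW,W)]) Void Void Void) (Done [(0,1,NW,SW), (2,1,NE,W),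
   (1,0,E,NE), (1,0,NE,W)]) Void Void Void (Ask 0 2 Void (Done [(1,1,NE,NW), (1,1,NW,W),
   (1,0,E,NW), (1,0,NW,W)]) (Done [(0,2,NW,SW), (1,1,NE,W), (1,0,E,NW), (1,0,NW,W)]) Void Void
   Void))) (Done [(1,1,NW,W), (1,0,E,NW), (1,0,NW,W)]) Void Void Void)) Void Void Void) (Ask 0 1
   Void (Done [(1,0,NE,NW), (1,0,NW,W)]) (Done [(0,1,NW,SW), (1,0,NE,W)]) Void Void Void) (Done
   [(1,0,NW,W)]) Void Void Void)) Void Void Void)"

lemma corner_ok: "check [((0, 0), (1, 0))] 5 corner_cert 0 False 1 False []"
  by code_simp

text \<open>The bound on the number of flips is the same for all regions.\<close>

lemma corner_tile:
  assumes "0 \<le> L" "1 \<le> R" "5 \<le> L + R" "tiling (region L R) T"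
  shows "\<exists>T'. flips_within (cost corner_cert) T T' \<and> {(0, 0), (1, 0)} \<in> T'"
  using check_sound[OF corner_ok assms(4) _ assms(3)] assms by auto

section \<open>Removing the bottom row\<close>

lemma connects_corner:
  assumes "0 \<le> L" "1 \<le> R" "5 \<le> L + R" "connects (region (L + 2) (R - 2)) K k"
  shows "connects (region L R) (K + 2 * cost corner_cert) k"
proof -
  have "region L R - {(0, 0), (1, 0)} = shift 2 0 ` region (L + 2) (R - 2)"
    unfolding shift_image region_def by auto
  then have "connects (region L R - {(0, 0), (1, 0)}) K k"
    using connects_shift[OF assms(4)] by simp
  from connects_peel[OF _ _ corner_tile[OF assms(1-3)] this] show ?thesis
    using assms by (simp add: region_def adj_iff level_def)
qed

text \<open>The bottom row of \<open>region L (2 * m - 1)\<close> consists of \<open>2 * m\<close> nodes. Once they are tiled by \<open>m\<close> level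
  tiles, a full triangle of side \<open>N\<close> remains.\<close>

lemma connects_even_row:
  assumes "0 \<le> L" "5 \<le> N" "L + (2 * int m - 1) = N" "connects (region 0 (N - 1)) K k"
  shows "connects (region L (2 * int m - 1)) (K + 2 * cost corner_cert * m) k"
  using assms(1,3)
proof (induction m arbitrary: L)
  case 0
  \<comment> \<open>No node of the bottom row is left.\<close>
  then have "region L (- 1) = shift (- L) 1 ` region 0 (N - 1)"
    unfolding shift_image region_def by auto
  then show ?case
    using connects_shift[OF assms(4), of "- L" 1] by simp
next
  case (Suc m)
  have "connects (region (L + 2) (2 * int m - 1)) (K + 2 * cost corner_cert * m) k"
    using Suc by simp
  then have "connects (region (L + 2) (2 * int (Suc m) - 1 - 2)) (K + 2 * cost corner_cert * m) k"
    by simp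
  from connects_corner[OF _ _ _ this] show ?case
    using Suc.prems assms(2) by (simp add: algebra_simps)
qed

text \<open>The only node in the bottom row of \<open>region N 0\<close> has a single neighbour in the region. Removing both
  leaves a triangle of side \<open>N\<close> without its right corner.\<close>

lemma connects_last_tile:
  assumes "1 \<le> N" "connects (region 1 (N - 2)) K k"
  shows "connects (region N 0) K (k + 1)"
proof -
  have "region N 0 - {(0, 0), (- 1, 1)} = mirror ` shift 1 1 ` region 1 (N - 2)"
    unfolding shift_image mirror_image region_def using assms(1) by auto
  then have c: "connects (region N 0 - {(0, 0), (- 1, 1)}) K k"
    using connects_mirror[OF connects_shift[OF assms(2)]] by simp
  have forced: "\<exists>T'. flips_within 0 T T' \<and> {(0, 0), (- 1, 1)} \<in> T'" if T: "tiling (region N 0) T" for T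
  proof -
    have "(0, 0) \<in> region N 0" using assms(1) by (simp add: region_def)
    then obtain t where t: "t \<in> T" "(0, 0) \<in> t"
      using tiling_Union[OF T] by blast
    obtain q where q: "t = {(0, 0), q}" "adj (0, 0) q"
      using tiling_tile[OF T t] .
    have "q \<in> region N 0" using tiling_Union[OF T] t q by blast
    with q(2) have "q = (- 1, 1)"
      by (cases rule: adj_cases) (auto simp: region_def)
    then show ?thesis using t q flips_within_refl by blast
  qed
  from connects_peel[OF _ _ forced c] show ?thesis
    using assms(1) by (simp add: region_def adj_iff level_def)
qed

lemma connects_odd_row:
  assumes "0 \<le> L" "5 \<le> N" "L + 2 * int m = N" "connects (region 1 (N - 2)) K k"
  shows "connects (region L (2 * int m)) (K + 2 * cost corner_cert * m) (k + 1)"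
  using assms(1,3)
proof (induction m arbitrary: L)
  case 0
  then show ?case
    using connects_last_tile[OF _ assms(4)] assms(2) by simp
next
  case (Suc m)
  have "connects (region (L + 2) (2 * int m)) (K + 2 * cost corner_cert * m) (k + 1)"
    using Suc by simp
  then have "connects (region (L + 2) (2 * int (Suc m) - 2)) (K + 2 * cost corner_cert * m) (k + 1)"
    by simp
  from connects_corner[OF _ _ _ this] show ?case
    using Suc.prems assms(2) by (simp add: algebra_simps)
qed

section \<open>The clipped triangle of side five\<close>

text \<open>The tiling of the clipped triangle of side \<open>5\<close> (\<open>region 1 3\<close>) to which all others are connected.\<close>

definition base_target :: config where
  "base_target = [((-1,2),(-1,3)), ((0,2),(1,2)), ((-1,1),(0,0)), ((1,0),(2,0)), ((-1,4),(0,3)), ((2,1),(3,0)), ((0,1),(1,1))]"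

text \<open>The tree branches into all tilings of \<open>region 1 3\<close>.\<close>

definition base_cert :: cert where "base_cert =
  Ask 0 0 (Ask 2 0 (Ask (-1) 1 (Ask 1 1 (Ask (-1) 2 (Ask 1 2 Void Void (Ask (-1) 3 Void (Done
   [(1,1,E,SE), (0,0,E,NW), (0,1,SE,E), ((-1),2,E,SE), (0,2,SE,NE), (0,2,NE,NW), ((-1),2,SE,NE),
   (0,1,NE,E)]) Void Void Void Void) Void Void Void) (Ask 0 2 (Ask 0 3 Void Void (Done
   [(1,1,E,SE), (0,0,E,NW), (1,1,SE,W)]) Void Void Void) (Ask 1 2 Void Void Void Void Void Void)
   Void Void Void Void) Void Void Void Void) (Ask 2 1 Void Void Void Void Void Void) (Ask 2 1 Void
   Void (Ask (-1) 2 Void (Ask 0 3 Void Void (Done [(0,2,SE,E), (1,1,E,SE), (0,0,E,NW),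
   (1,1,SE,W)]) Void Void Void) Void Void Void Void) Void Void Void) Void Void Void) (Ask 0 1 (Ask
   2 1 Void Void (Ask 0 2 Void (Ask (-1) 3 Void (Done [(0,0,E,NE), (0,2,NE,NW), (0,0,NE,NW),
   ((-1),2,SE,NE), (0,1,NE,SE), (0,2,SE,E), (1,1,E,SE), (1,1,SE,W)]) Void Void Void Void) (Ask 0 3
   Void Void (Done [(0,0,E,NE), (0,0,NE,NW), ((-1),2,SE,NE), (0,1,NE,SE), (0,2,SE,E), (1,1,E,SE),
   (1,1,SE,W)]) Void Void Void) Void Void Void) Void Void Void) (Ask 1 1 (Ask 1 2 Void Void (Ask
   (-1) 3 Void (Done [(0,1,NE,W), (1,1,E,SE), (0,0,E,NW), (0,1,SE,E), ((-1),2,E,SE), (0,2,SE,NE),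
   (0,2,NE,NW), ((-1),2,SE,NE), (0,1,NE,E)]) Void Void Void Void) Void Void Void) (Ask 2 1 Void
   Void Void Void Void Void) Void Void Void Void) Void Void Void Void) Void Void Void Void) (Ask 3
   0 Void Void Void Void Void Void) (Ask 3 0 Void Void (Ask (-1) 1 (Ask (-1) 2 (Ask 1 2 Void Void
   (Ask (-1) 3 Void (Done [(0,0,E,NW), (0,1,SE,E), ((-1),2,E,SE), (0,2,SE,NE), (0,2,NE,NW),
   ((-1),2,SE,NE), (0,1,NE,E)]) Void Void Void Void) Void Void Void) (Ask 0 2 (Ask 0 3 Void Void
   (Done [(0,0,E,NW), (1,1,SE,W)]) Void Void Void) (Ask 1 2 Void Void Void Void Void Void) Void
   Void Void Void) Void Void Void Void) (Ask 0 1 Void (Ask 1 2 Void Void (Ask (-1) 3 Void (Done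
   [(0,1,NE,W), (0,0,E,NW), (0,1,SE,E), ((-1),2,E,SE), (0,2,SE,NE), (0,2,NE,NW), ((-1),2,SE,NE),
   (0,1,NE,E)]) Void Void Void Void) Void Void Void) Void Void Void Void) Void Void Void Void)
   Void Void Void) Void Void Void) (Ask 1 0 (Ask 3 0 Void Void (Ask (-1) 1 Void (Ask 1 1 Void (Ask
   0 2 Void (Ask (-1) 3 Void (Done [(0,2,NE,NW), (0,0,NE,NW), ((-1),2,SE,NE), (0,1,NE,E)]) Void
   Void Void Void) (Ask 0 3 Void Void (Done [(0,0,NE,NW), ((-1),2,SE,NE), (0,1,NE,E)]) Void Void
   Void) Void Void Void) (Ask 1 2 Void Void (Ask (-1) 3 Void (Done [(0,2,SE,NE), (0,2,NE,NW),
   (0,0,NE,NW), ((-1),2,SE,NE), (0,1,NE,E)]) Void Void Void Void) Void Void Void) Void Void Void)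
   Void Void Void Void) Void Void Void) (Ask 2 0 (Ask (-1) 1 Void (Ask 2 1 Void Void (Ask 0 2 Void
   (Ask (-1) 3 Void (Done [(0,2,NE,NW), (0,0,NE,NW), ((-1),2,SE,NE), (0,1,NE,SE), (0,2,SE,E),
   (1,1,E,SE), (1,1,SE,W)]) Void Void Void Void) (Ask 0 3 Void Void (Done [(0,0,NE,NW),
   ((-1),2,SE,NE), (0,1,NE,SE), (0,2,SE,E), (1,1,E,SE), (1,1,SE,W)]) Void Void Void) Void Void
   Void) Void Void Void) Void Void Void Void) (Ask 3 0 Void Void Void Void Void Void) Void Void
   Void Void) Void Void Void Void) (Ask 1 0 (Ask 3 0 Void Void (Ask 0 1 (Ask (-1) 2 (Ask 1 2 Void
   Void (Ask (-1) 3 Void (Done [((-1),2,E,SE), (0,2,SE,NE), (0,2,NE,NW), ((-1),2,SE,NE),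
   (0,1,NE,E)]) Void Void Void Void) Void Void Void) (Ask 0 2 (Ask 0 3 Void Void (Done []) Void
   Void Void) (Ask 1 2 Void Void Void Void Void Void) Void Void Void Void) Void Void Void Void)
   (Ask 1 1 Void (Ask (-1) 2 Void (Ask 0 3 Void Void (Done [(0,1,NE,E)]) Void Void Void) Void Void
   Void Void) Void Void Void Void) (Ask 1 1 Void (Ask 0 2 Void (Ask (-1) 3 Void (Done
   [(0,2,NE,NW), ((-1),2,SE,NE), (0,1,NE,E)]) Void Void Void Void) (Ask 0 3 Void Void (Done
   [((-1),2,SE,NE), (0,1,NE,E)]) Void Void Void) Void Void Void) (Ask 1 2 Void Void (Ask (-1) 3
   Void (Done [(0,2,SE,NE), (0,2,NE,NW), ((-1),2,SE,NE), (0,1,NE,E)]) Void Void Void Void) Void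
   Void Void) Void Void Void) Void Void Void) Void Void Void) (Ask 2 0 (Ask 0 1 Void (Ask 2 1 Void
   Void (Ask (-1) 2 Void (Ask 0 3 Void Void (Done [(0,1,NE,SE), (0,2,SE,E), (1,1,E,SE),
   (1,1,SE,W)]) Void Void Void) Void Void Void Void) Void Void Void) (Ask 2 1 Void Void (Ask 0 2
   Void (Ask (-1) 3 Void (Done [(0,2,NE,NW), ((-1),2,SE,NE), (0,1,NE,SE), (0,2,SE,E), (1,1,E,SE),
   (1,1,SE,W)]) Void Void Void Void) (Ask 0 3 Void Void (Done [((-1),2,SE,NE), (0,1,NE,SE),
   (0,2,SE,E), (1,1,E,SE), (1,1,SE,W)]) Void Void Void) Void Void Void) Void Void Void) Void Void
   Void) (Ask 3 0 Void Void Void Void Void Void) Void Void Void Void) (Ask 2 0 (Ask 1 1 (Ask (-1)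
   2 (Ask 1 2 Void Void (Ask (-1) 3 Void (Done [(1,1,E,SE), (0,1,SE,E), ((-1),2,E,SE),
   (0,2,SE,NE), (0,2,NE,NW), ((-1),2,SE,NE), (0,1,NE,E)]) Void Void Void Void) Void Void Void)
   (Ask 0 2 (Ask 0 3 Void Void (Done [(1,1,E,SE), (1,1,SE,W)]) Void Void Void) (Ask 1 2 Void Void
   Void Void Void Void) Void Void Void Void) Void Void Void Void) (Ask 2 1 Void Void Void Void
   Void Void) (Ask 2 1 Void Void (Ask (-1) 2 Void (Ask 0 3 Void Void (Done [(0,2,SE,E),
   (1,1,E,SE), (1,1,SE,W)]) Void Void Void) Void Void Void Void) Void Void Void) Void Void Void)
   (Ask 3 0 Void Void Void Void Void Void) (Ask 3 0 Void Void (Ask (-1) 2 (Ask 1 2 Void Void (Ask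
   (-1) 3 Void (Done [(0,1,SE,E), ((-1),2,E,SE), (0,2,SE,NE), (0,2,NE,NW), ((-1),2,SE,NE),
   (0,1,NE,E)]) Void Void Void Void) Void Void Void) (Ask 0 2 (Ask 0 3 Void Void (Done
   [(1,1,SE,W)]) Void Void Void) (Ask 1 2 Void Void Void Void Void Void) Void Void Void Void) Void
   Void Void Void) Void Void Void) Void Void Void) Void Void Void) Void Void Void"

lemma base_ok: "check base_target 0 base_cert 1 True 3 True []"
  by code_simp

lemma tiles_adj: "\<forall>(p, q) \<in> set K. adj p q \<Longrightarrow> t \<in> tiles K \<Longrightarrow> \<exists>p q. t = {p, q} \<and> adj p q"
  unfolding tiles_def by (elim imageE) (metis (no_types, lifting) case_prodE case_prod_conv)

lemma tiles_disjoint: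
  assumes K: "distinct (map fst K @ map snd K)"
    and tu: "t \<in> tiles K" "u \<in> tiles K" "p \<in> t" "p \<in> u"
  shows "t = u"
proof -
  obtain a b where t: "(a, b) \<in> set K" "t = {a, b}"
    using tu(1) by (auto simp: tiles_def)
  obtain c d where u: "(c, d) \<in> set K" "u = {c, d}"
    using tu(2) by (auto simp: tiles_def)
  have inj: "inj_on fst (set K)" "inj_on snd (set K)" and "fst ` set K \<inter> snd ` set K = {}"
    using K by (simp_all add: distinct_map)
  then have ne: "a \<noteq> d" "b \<noteq> c"
    using imageI[OF t(1), of fst] imageI[OF t(1), of snd]
      imageI[OF u(1), of fst] imageI[OF u(1), of snd] by auto
  consider "a = c" | "b = d"
    using tu(3,4) t(2) u(2) ne by blast
  then show ?thesis
  proof cases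
    case 1
    then show ?thesis using inj_onD[OF inj(1) _ t(1) u(1)] t(2) u(2) by simp
  next
    case 2
    then show ?thesis using inj_onD[OF inj(2) _ t(1) u(1)] t(2) u(2) by simp
  qed
qed

lemma tiling_base_target: "tiling (region 1 3) (tiles base_target)"
proof (rule tilingI)
  show "\<Union>(tiles base_target) = region 1 3"
  proof
    show "\<Union>(tiles base_target) \<subseteq> region 1 3"
      by (simp add: base_target_def region_def)
    show "region 1 3 \<subseteq> \<Union>(tiles base_target)"
    proof
      fix p assume p: "p \<in> region 1 3"
      obtain x y where xy: "p = (x, y)" by (cases p)
      have "y = 0 \<or> y = 1 \<or> y = 2 \<or> y = 3 \<or> y = 4"
        and "x = -1 \<or> x = 0 \<or> x = 1 \<or> x = 2 \<or> x = 3"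
        using p unfolding region_def xy by (simp_all, presburger+)
      then show "p \<in> \<Union>(tiles base_target)"
        using p unfolding region_def xy base_target_def by (elim disjE; simp)
    qed
  qed
  show "\<exists>p q. t = {p, q} \<and> adj p q" if "t \<in> tiles base_target" for t
    by (rule tiles_adj[OF _ that]) (simp add: base_target_def adj_iff)
  show "t = u" if "t \<in> tiles base_target" "u \<in> tiles base_target" "p \<in> t" "p \<in> u" for t u p
    by (rule tiles_disjoint[OF _ that]) (simp add: base_target_def)
qed

lemma connects_base: "connects (region 1 3) (2 * cost base_cert) 7"
  unfolding connects_def
proof (intro conjI allI impI)
  have "card {t \<in> tiles base_target. \<not> level t} \<le> card (tiles base_target)"
    by (rule card_mono) (auto simp: tiles_def)
  also have "\<dots> \<le> card (set base_target)"
    unfolding tiles_def by (rule card_image_le) simp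
  also have "\<dots> \<le> length base_target"
    by (rule card_length)
  also have "\<dots> = 7"
    by (simp add: base_target_def)
  finally show "\<exists>T. tiling (region 1 3) T \<and> card {t \<in> T. \<not> level t} \<le> 7"
    using tiling_base_target by blast
next
  fix T T' assume T: "tiling (region 1 3) T" and T': "tiling (region 1 3) T'"
  have *: "flips_within (cost base_cert) T (tiles base_target)" if T: "tiling (region 1 3) T" for T
  proof -
    have "\<exists>U. flips_within (cost base_cert) T U \<and> tiles base_target \<subseteq> U"
      by (rule check_sound[OF base_ok T]) simp_all
    then obtain U where U: "flips_within (cost base_cert) T U" "tiles base_target \<subseteq> U"
      by blast
    then have "tiles base_target = U"
      using tiling_subset_eq flips_within_tiling[OF U(1) T] tiling_base_target by blast
    then show ?thesis using U by simp
  qed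
  from flips_within_trans[OF *[OF T] flips_within_sym[OF *[OF T'] T']]
  show "flips_within (2 * cost base_cert) T T'" by (simp add: mult_2)
qed

section \<open>Even triangles\<close>

text \<open>The nodes of the even triangle of side \<open>n\<close>. The clipped triangle is placed such that the missing
  corner is \<open>(- 1, 0)\<close>.\<close>

definition triangle :: "nat \<Rightarrow> node set" where
  "triangle n = (if n mod 4 \<in> {0, 3} then region 0 (int n - 1) else region 1 (int n - 2))"

text \<open>The summand from \<open>base_cert\<close> serves side \<open>5\<close>; the other one pays for the tiles of a row, which are
  created in both tilings that are to be connected.\<close>

definition flip_const :: nat where
  "flip_const = 2 * cost base_cert + 2 * cost corner_cert"

lemma connects_triangle:
  assumes "5 \<le> n"
  shows "connects (triangle n) (flip_const * n\<^sup>2) (n + 2)"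
  using assms
proof (induction n rule: nat_induct_at_least)
  case base
  have "triangle 5 = region 1 3" by (simp add: triangle_def)
  then show ?case
    using connects_mono[OF connects_base] by (simp add: flip_const_def)
next
  case (Suc n)
  let ?K = "flip_const * n\<^sup>2" and ?C = "2 * cost corner_cert"
  have cost: "?K + ?C * m' \<le> flip_const * (Suc n)\<^sup>2" if "m' \<le> n" for m'
  proof -
    have "?C * m' \<le> flip_const * n"
      using that by (intro mult_mono) (simp_all add: flip_const_def)
    then have "?K + ?C * m' \<le> flip_const * (n\<^sup>2 + n)"
      by (simp add: distrib_left)
    also have "\<dots> \<le> flip_const * (Suc n)\<^sup>2"
      by (intro mult_left_mono) (simp_all add: power2_eq_square)
    finally show ?thesis .
  qed
  have "Suc n mod 4 = 0 \<and> n mod 4 = 3 \<or> Suc n mod 4 = 1 \<and> n mod 4 = 0 \<or>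
      Suc n mod 4 = 2 \<and> n mod 4 = 1 \<or> Suc n mod 4 = 3 \<and> n mod 4 = 2"
    by presburger
  then consider "Suc n mod 4 = 0" "n mod 4 = 3" | "Suc n mod 4 = 1" "n mod 4 = 0"
    | "Suc n mod 4 = 2" "n mod 4 = 1" | "Suc n mod 4 = 3" "n mod 4 = 2"
    by meson
  then show ?case
  proof cases
    case 1
    have "\<exists>m. Suc n = 2 * m" using 1(1) by presburger
    then obtain m where m: "Suc n = 2 * m" by blast
    have c: "connects (region 0 (int n - 1)) ?K (n + 2)"
      using Suc.IH 1 by (simp add: triangle_def)
    have "connects (region 0 (2 * int m - 1)) (?K + ?C * m) (n + 2)"
    proof (rule connects_even_row[OF _ _ _ c])
      show "5 \<le> int n" "0 + (2 * int m - 1) = int n" using m Suc.hyps by simp_all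
    qed simp
    moreover have "triangle (Suc n) = region 0 (2 * int m - 1)"
      using 1 m by (simp add: triangle_def)
    moreover have "m \<le> n" using m Suc.hyps by simp
    ultimately show ?thesis
      using connects_mono[OF _ cost[of m]] by auto
  next
    case 2
    have "\<exists>m. n = 2 * m" using 2(2) by presburger
    then obtain m where m: "n = 2 * m" by blast
    have c: "connects (region 0 (int n - 1)) ?K (n + 2)"
      using Suc.IH 2 by (simp add: triangle_def)
    have "connects (region 1 (2 * int m - 1)) (?K + ?C * m) (n + 2)"
    proof (rule connects_even_row[OF _ _ _ c])
      show "5 \<le> int n" "1 + (2 * int m - 1) = int n" using m Suc.hyps by simp_all
    qed simp
    moreover have "triangle (Suc n) = region 1 (2 * int m - 1)"
      using 2 m by (simp add: triangle_def)
    moreover have "m \<le> n" using m Suc.hyps by simp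
    ultimately show ?thesis
      using connects_mono[OF _ cost[of m]] by auto
  next
    case 3
    have "\<exists>m. n = 2 * m + 1" using 3(2) by presburger
    then obtain m where m: "n = 2 * m + 1" by blast
    have c: "connects (region 1 (int n - 2)) ?K (n + 2)"
      using Suc.IH 3 by (simp add: triangle_def)
    have "connects (region 1 (2 * int m)) (?K + ?C * m) (n + 2 + 1)"
    proof (rule connects_odd_row[OF _ _ _ c])
      show "5 \<le> int n" "1 + 2 * int m = int n" using m Suc.hyps by simp_all
    qed simp
    moreover have "triangle (Suc n) = region 1 (2 * int m)"
      using 3 m by (simp add: triangle_def)
    moreover have "m \<le> n" using m Suc.hyps by simp
    ultimately show ?thesis
      using connects_mono[OF _ cost[of m]] by auto
  next
    case 4
    have "\<exists>m. n = 2 * m" using 4(2) by presburger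
    then obtain m where m: "n = 2 * m" by blast
    have c: "connects (region 1 (int n - 2)) ?K (n + 2)"
      using Suc.IH 4 by (simp add: triangle_def)
    have "connects (region 0 (2 * int m)) (?K + ?C * m) (n + 2 + 1)"
    proof (rule connects_odd_row[OF _ _ _ c])
      show "5 \<le> int n" "0 + 2 * int m = int n" using m Suc.hyps by simp_all
    qed simp
    moreover have "triangle (Suc n) = region 0 (2 * int m)"
      using 4 m by (simp add: triangle_def)
    moreover have "m \<le> n" using m Suc.hyps by simp
    ultimately show ?thesis
      using connects_mono[OF _ cost[of m]] by auto
  qed
qed

lemma connects_empty: "connects {} 0 0"
  unfolding connects_def
proof (intro conjI allI impI)
  have "tiling {} {}" by (rule tilingI) auto
  then show "\<exists>T. tiling {} T \<and> card {t \<in> T. \<not> level t} \<le> 0" by auto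
  show "flips_within 0 T T'" if "tiling {} T" "tiling {} T'" for T T'
  proof -
    have "T = {}" "T' = {}"
      using that by (simp_all add: tiling_def partition_on_empty)
    then show ?thesis using flips_within_refl by simp
  qed
qed

lemma connects_triangle_all:
  assumes "0 < n" "n \<notin> {3, 4}"
  shows "\<exists>K k. connects (triangle n) K k"
proof -
  have e: "region 1 (- 1) = {}" by (auto simp: region_def)
  consider "n = 1" | "n = 2" | "5 \<le> n" using assms by force
  then show ?thesis
  proof cases
    case 1
    then have "triangle n = {}" using e by (simp add: triangle_def)
    then show ?thesis using connects_empty by auto
  next
    case 2
    then have "triangle n = region 1 0" by (simp add: triangle_def)
    then show ?thesis using connects_last_tile[of 1 0 0] connects_empty e by auto
  next
    case 3
    then show ?thesis using connects_triangle by blast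
  qed
qed

text \<open>The nodes of \<open>even_triangle n\<close>; here the missing corner of a clipped triangle is \<open>(0, 0)\<close>.\<close>

definition triangle_nodes :: "nat \<Rightarrow> node set" where
  "triangle_nodes n =
     (if n mod 4 \<in> {0, 3} then full_triangle_nodes n else full_triangle_nodes n - {(0, 0)})"

lemma even_triangle_nodes: "even_triangle n = triangular_lattice \<restriction> triangle_nodes n"
  by (simp add: even_triangle_def full_triangle_def clipped_triangle_def triangle_nodes_def)

lemma connects_triangle_nodes:
  assumes "connects (triangle n) K k"
  shows "connects (triangle_nodes n) K k"
proof (cases "n mod 4 \<in> {0, 3}")
  case True
  then have "triangle_nodes n = triangle n"
    by (auto simp: triangle_nodes_def triangle_def region_def full_triangle_nodes_def)
  then show ?thesis using assms by simp
next
  case False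
  then have "triangle_nodes n = shift 1 0 ` triangle n"
    unfolding shift_image by (auto simp: triangle_nodes_def triangle_def region_def full_triangle_nodes_def)
  then show ?thesis using connects_shift[OF assms] by simp
qed

lemma finite_triangle_nodes: "finite (triangle_nodes n)"
  by (simp add: triangle_nodes_def finite_full_triangle_nodes)

section \<open>The ReCom metagraph\<close>

lemma dominates_lattice: "u \<rightarrow>\<^bsub>triangular_lattice \<restriction> S\<^esub> v \<longleftrightarrow> u \<in> S \<and> v \<in> S \<and> adj u v"
  by (cases u; cases v)
    (auto simp: arcs_ends_def arc_to_ends_def triangular_lattice_def adj_iff image_iff)

lemma dimer_tiling_lattice: "dimer_tiling (triangular_lattice \<restriction> S) T \<longleftrightarrow> tiling S T"
proof -
  have "verts (triangular_lattice \<restriction> S) = S"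
    by (simp add: triangular_lattice_def)
  moreover have "is_tile (triangular_lattice \<restriction> S) t \<longleftrightarrow> (\<exists>p q. t = {p, q} \<and> adj p q)"
    if "t \<subseteq> S" for t
    using that unfolding is_tile_def dominates_lattice by blast
  ultimately show ?thesis
    unfolding dimer_tiling_def tiling_def partition_on_def by (metis Union_upper)
qed

lemma recom_move_flip:
  assumes T: "tiling S T" and "flip T T'"
  shows "recom_move (triangular_lattice \<restriction> S) T T'" "T \<noteq> T'"
proof -
  obtain a b c e where h: "{a, b} \<in> T" "{c, e} \<in> T" "{a, b} \<inter> {c, e} = {}" "adj a c" "adj b e"
    and T': "T' = (T - {{a, b}, {c, e}}) \<union> {{a, c}, {b, e}}"
    using assms(2) unfolding flip_def by blast
  have ne: "a \<noteq> b" "c \<noteq> e"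
    using tiling_adj[OF T h(1)] tiling_adj[OF T h(2)] adj_irrefl by metis+
  have S: "a \<in> S" "b \<in> S" "c \<in> S" "e \<in> S"
    using tiling_Union[OF T] h by blast+
  have "{a, b} \<noteq> {c, e}" using h(3) by auto
  moreover have "\<exists>u\<in>{a, b}. \<exists>v\<in>{c, e}. u \<rightarrow>\<^bsub>triangular_lattice \<restriction> S\<^esub> v"
    using S h(4) dominates_lattice by auto
  moreover have "is_tile (triangular_lattice \<restriction> S) {a, c}" "is_tile (triangular_lattice \<restriction> S) {b, e}"
    unfolding is_tile_def dominates_lattice using S h(4,5) by blast+
  moreover have "{a, c} \<inter> {b, e} = {}" using ne h(3) by auto
  moreover have "{a, c} \<union> {b, e} = {a, b} \<union> {c, e}" by auto
  ultimately show "recom_move (triangular_lattice \<restriction> S) T T'"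
    unfolding recom_move_def using h(1,2) T' by blast
  have "{a, b} \<notin> T'"
    using h(3) ne unfolding T' by (auto simp: doubleton_eq_iff)
  then show "T \<noteq> T'" using h(1) by blast
qed

lemma arcs_recom_metagraph:
  "arcs (recom_metagraph (triangular_lattice \<restriction> S)) =
     {(T, T'). tiling S T \<and> tiling S T' \<and> T \<noteq> T' \<and>
       (recom_move (triangular_lattice \<restriction> S) T T' \<or> recom_move (triangular_lattice \<restriction> S) T' T)}"
  by (simp add: recom_metagraph_def dimer_tiling_lattice)

lemma verts_recom_metagraph:
  "verts (recom_metagraph (triangular_lattice \<restriction> S)) = {T. tiling S T}"
  by (simp add: recom_metagraph_def dimer_tiling_lattice)

lemma ends_recom_metagraph:
  "tail (recom_metagraph G) = fst" "head (recom_metagraph G) = snd"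
  by (simp_all add: recom_metagraph_def)

lemma graph_recom_lattice:
  assumes "finite S"
  shows "graph (recom_metagraph (triangular_lattice \<restriction> S))"
  by (rule graph_recom_metagraph) (simp add: triangular_lattice_def assms)

lemma flips_awalk:
  assumes S: "finite S" and T: "tiling S T" and "(flip ^^ m) T T'"
  shows "\<exists>p. pre_digraph.awalk (recom_metagraph (triangular_lattice \<restriction> S)) T p T' \<and> length p = m"
proof -
  let ?M = "recom_metagraph (triangular_lattice \<restriction> S)"
  interpret M: graph ?M by (rule graph_recom_lattice[OF S])
  show ?thesis
    using assms(2,3)
  proof (induction m arbitrary: T)
    case 0
    then show ?case
      by (intro exI[of _ "[]"]) (simp add: M.awalk_Nil_iff verts_recom_metagraph)
  next
    case (Suc m)
    then obtain U where U: "flip T U" "(flip ^^ m) U T'"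
      using relpowp_Suc_E2[OF Suc.prems(2)] by blast
    have "tiling S U" using flip_tiling[OF Suc.prems(1) U(1)] .
    then obtain p where p: "M.awalk U p T'" "length p = m"
      using Suc.IH U(2) by blast
    have "(T, U) \<in> arcs ?M"
      using recom_move_flip[OF Suc.prems(1) U(1)] Suc.prems(1) \<open>tiling S U\<close>
      by (simp add: arcs_recom_metagraph)
    then have "M.awalk T ((T, U) # p) T'"
      using p(1) by (simp add: M.awalk_Cons_iff ends_recom_metagraph)
    then show ?case using p(2) by (intro exI[of _ "(T, U) # p"]) simp
  qed
qed

lemma connected_recom_metagraph:
  assumes S: "finite S" and c: "connects S K k"
  shows "Digraph_Component.connected (recom_metagraph (triangular_lattice \<restriction> S))"
proof -
  let ?M = "recom_metagraph (triangular_lattice \<restriction> S)"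
  interpret M: graph ?M by (rule graph_recom_lattice[OF S])
  have "T \<rightarrow>\<^sup>*\<^bsub>?M\<^esub> T'" if "tiling S T" "tiling S T'" for T T'
    using c that flips_awalk[OF S] M.reachable_awalk
    unfolding connects_def flips_within_def by blast
  moreover have "\<exists>T. tiling S T"
    using c unfolding connects_def by blast
  ultimately show ?thesis
    unfolding connected_def strongly_connected_def
    using M.reachable_mk_symmetricI by (auto simp: verts_recom_metagraph)
qed

lemma graph_diameter_le:
  assumes S: "finite S" and c: "connects S K k"
  shows "graph_diameter (recom_metagraph (triangular_lattice \<restriction> S)) \<le> ereal (real K)"
  unfolding graph_diameter_def
proof (rule SUP_least, clarify)
  let ?M = "recom_metagraph (triangular_lattice \<restriction> S)"
  interpret M: graph ?M by (rule graph_recom_lattice[OF S])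
  fix T T' assume "T \<in> verts ?M" "T' \<in> verts ?M"
  then have T: "tiling S T" "tiling S T'" by (simp_all add: verts_recom_metagraph)
  then obtain m where m: "m \<le> K" "(flip ^^ m) T T'"
    using c unfolding connects_def flips_within_def by blast
  obtain p where p: "M.awalk T p T'" "length p = m"
    using flips_awalk[OF S T(1) m(2)] by blast
  have "M.\<mu> (\<lambda>_. 1) T T' \<le> ereal (M.awalk_cost (\<lambda>_. 1) p)"
    by (rule M.min_cost_le_walk_cost[OF p(1)])
  also have "M.awalk_cost (\<lambda>_. 1) p = real m"
    using p(2) by (simp add: M.awalk_cost_def sum_list_triv)
  finally show "M.\<mu> (\<lambda>_. 1) T T' \<le> ereal (real K)"
    using m(1) by (meson ereal_less_eq(3) of_nat_le_iff order_trans)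
qed

section \<open>The diameter\<close>

definition level_count :: "node set set \<Rightarrow> nat" where
  "level_count T = card {t \<in> T. level t}"

lemma finite_tiling: "finite S \<Longrightarrow> tiling S T \<Longrightarrow> finite T"
  unfolding tiling_def using finite_elements by blast

lemma level_count_add_two:
  assumes "finite T'" "T \<subseteq> T' \<union> {s, t}"
  shows "level_count T \<le> level_count T' + 2"
proof -
  have "{u \<in> T. level u} \<subseteq> {u \<in> T'. level u} \<union> {s, t}" using assms(2) by auto
  then have "level_count T \<le> card ({u \<in> T'. level u} \<union> {s, t})"
    unfolding level_count_def using assms(1) by (intro card_mono) auto
  also have "\<dots> \<le> level_count T' + card {s, t}"
    unfolding level_count_def by (rule card_Un_le)
  also have "card {s, t} \<le> 2" by (simp add: card_insert_le_m1)
  finally show ?thesis by simp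
qed

lemma level_count_recom_move:
  assumes "recom_move G T T'" "finite T" "finite T'"
  shows "level_count T \<le> level_count T' + 2" "level_count T' \<le> level_count T + 2"
proof -
  obtain s t s' t' where st: "s \<in> T" "t \<in> T" "T' = (T - {s, t}) \<union> {s', t'}"
    using assms(1) unfolding recom_move_def by blast
  then have sub: "T \<subseteq> T' \<union> {s, t}" "T' \<subseteq> T \<union> {s', t'}" by auto
  show "level_count T \<le> level_count T' + 2"
    by (rule level_count_add_two[OF assms(3) sub(1)])
  show "level_count T' \<le> level_count T + 2"
    by (rule level_count_add_two[OF assms(2) sub(2)])
qed

lemma graph_diameter_ge:
  assumes S: "finite S" and T: "tiling S T" "tiling S T'"
  shows "ereal ((real (level_count T) - real (level_count T')) / 2)
    \<le> graph_diameter (recom_metagraph (triangular_lattice \<restriction> S))"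
proof -
  let ?M = "recom_metagraph (triangular_lattice \<restriction> S)"
  interpret M: graph ?M by (rule graph_recom_lattice[OF S])
  have walk: "level_count U \<le> level_count V + 2 * length p" if "M.awalk U p V" for U p V
    using that
  proof (induction p arbitrary: U)
    case Nil
    then show ?case by (simp add: M.awalk_Nil_iff)
  next
    case (Cons a p)
    then have a: "a \<in> arcs ?M" "fst a = U" "M.awalk (snd a) p V"
      by (simp_all add: M.awalk_Cons_iff ends_recom_metagraph)
    obtain W where W: "a = (U, W)" using a(2) by (metis prod.collapse)
    have "finite U" "finite W"
      using a(1) finite_tiling[OF S] unfolding W arcs_recom_metagraph by auto
    moreover have "recom_move (triangular_lattice \<restriction> S) U W \<or>
        recom_move (triangular_lattice \<restriction> S) W U"
      using a(1) unfolding W arcs_recom_metagraph by simp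
    ultimately have "level_count U \<le> level_count W + 2"
      using level_count_recom_move(1)[of _ U W] level_count_recom_move(2)[of _ W U] by blast
    moreover have "level_count W \<le> level_count V + 2 * length p"
      using Cons.IH a(3) W by simp
    ultimately show ?case by simp
  qed
  have "ereal ((real (level_count T) - real (level_count T')) / 2) \<le> M.\<mu> (\<lambda>_. 1) T T'"
    unfolding M.\<mu>_def
  proof (rule INF_greatest)
    fix p assume "p \<in> {p. M.awalk T p T'}"
    then have "level_count T \<le> level_count T' + 2 * length p" using walk by simp
    then have "real (level_count T) \<le> real (level_count T') + 2 * real (length p)"
      by (metis of_nat_add of_nat_le_iff of_nat_mult of_nat_numeral)
    then show "ereal ((real (level_count T) - real (level_count T')) / 2)
        \<le> ereal (M.awalk_cost (\<lambda>_. 1) p)"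
      by (simp add: M.awalk_cost_def sum_list_triv)
  qed
  also have "\<dots> \<le> graph_diameter ?M"
    unfolding graph_diameter_def
    by (rule SUP_upper2[of "(T, T')"]) (use T in \<open>auto simp: verts_recom_metagraph\<close>)
  finally show ?thesis .
qed

lemma swap_triangle_nodes: "prod.swap ` triangle_nodes n = triangle_nodes n"
proof -
  have "prod.swap ` S = {(x, y). (y, x) \<in> S}" for S :: "node set" by force
  then show ?thesis by (auto simp: triangle_nodes_def full_triangle_nodes_def)
qed

text \<open>A square with \<open>(n + 1) div 2\<close> nodes along each side fits into the full triangle.\<close>

lemma card_triangle_nodes: "real n ^ 2 / 4 - 1 \<le> real (card (triangle_nodes n))"
proof -
  define m where "m = (n + 1) div 2"
  have nm: "n \<le> 2 * m" "2 * m \<le> n + 1" unfolding m_def by presburger+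
  let ?Q = "{0..<int m} \<times> {0..<int m}"
  have fin: "finite (triangle_nodes n)" by (rule finite_triangle_nodes)
  have "?Q \<subseteq> insert (0, 0) (triangle_nodes n)"
    using nm(2) by (auto simp: triangle_nodes_def full_triangle_nodes_def)
  then have "card ?Q \<le> card (insert (0, 0) (triangle_nodes n))"
    using fin by (intro card_mono) auto
  also have "\<dots> \<le> card (triangle_nodes n) + 1"
    using fin by (simp add: card_insert_if)
  finally have "m * m \<le> card (triangle_nodes n) + 1" by simp
  then have "real m * real m \<le> real (card (triangle_nodes n)) + 1"
    by (metis of_nat_1 of_nat_add of_nat_le_iff of_nat_mult)
  moreover have "(real n / 2) * (real n / 2) \<le> real m * real m"
    using nm(1) by (intro mult_mono) auto
  ultimately show ?thesis by (simp add: power2_eq_square)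
qed

lemma graph_diameter_even_triangle_ge:
  assumes "5 \<le> n"
  shows "ereal ((real n)\<^sup>2 / 16 - real n - 4) \<le> graph_diameter (recom_metagraph (even_triangle n))"
proof -
  let ?S = "triangle_nodes n"
  obtain T where T: "tiling ?S T" "card {t \<in> T. \<not> level t} \<le> n + 2"
    using connects_triangle_nodes[OF connects_triangle[OF assms]] unfolding connects_def by blast
  \<comment> \<open>A tile that is level after the exchange of coordinates was not level before, so \<open>T'\<close> has few level tiles.\<close>
  define T' where "T' = (`) prod.swap ` T"
  have T': "tiling ?S T'"
    using tiling_image[OF symmetry_swap T(1)] by (simp add: T'_def swap_triangle_nodes)
  have fin: "finite T" using finite_tiling[OF finite_triangle_nodes T(1)] .
  have card2: "card t \<le> 2" if "t \<in> T" for t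
    using that T(1) unfolding tiling_def by (force simp: card_insert_if)
  have "card ?S \<le> (\<Sum>t\<in>T. card t)"
    using card_Union_le_sum_card[of T] tiling_Union[OF T(1)] by simp
  also have "\<dots> \<le> card T * 2"
    using sum_bounded_above[of T card 2] card2 by simp
  finally have S: "card ?S \<le> 2 * card T" by simp
  have "T = {t \<in> T. level t} \<union> {t \<in> T. \<not> level t}" by auto
  then have "card T \<le> level_count T + card {t \<in> T. \<not> level t}"
    unfolding level_count_def by (metis card_Un_le)
  then have cT: "card T \<le> level_count T + (n + 2)" using T(2) by simp
  have "{t \<in> T'. level t} \<subseteq> (`) prod.swap ` {t \<in> T. \<not> level t}"
  proof
    fix u assume "u \<in> {t \<in> T'. level t}"
    then obtain t where t: "t \<in> T" "u = prod.swap ` t" "level (prod.swap ` t)"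
      by (auto simp: T'_def)
    obtain p q where pq: "t = {p, q}" "adj p q"
      using t(1) T(1) unfolding tiling_def by blast
    have "snd (prod.swap p) = snd (prod.swap q)"
      using t(3) pq(1) unfolding level_def by blast
    then have "fst p = fst q" by simp
    moreover have "p \<noteq> q" using pq(2) adj_irrefl by metis
    ultimately have "snd p \<noteq> snd q" using prod_eqI by metis
    then have "\<not> level t" unfolding pq(1) level_def by blast
    then show "u \<in> (`) prod.swap ` {t \<in> T. \<not> level t}" using t by blast
  qed
  then have "level_count T' \<le> card ((`) prod.swap ` {t \<in> T. \<not> level t})"
    unfolding level_count_def using fin by (intro card_mono) auto
  also have "\<dots> \<le> card {t \<in> T. \<not> level t}"
    using fin by (intro card_image_le) auto
  finally have cT': "level_count T' \<le> n + 2" using T(2) by simp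
  have "card ?S \<le> 2 * (level_count T + (n + 2))" by (rule order_trans[OF S mult_le_mono2[OF cT]])
  then have "real (card ?S) \<le> real (2 * (level_count T + (n + 2)))" by (rule of_nat_mono)
  then have "real n ^ 2 / 4 - 1 \<le> 2 * (real (level_count T) + real n + 2)"
    using card_triangle_nodes[of n] by simp
  then have "(real n)\<^sup>2 / 16 - real n - 4 \<le> (real (level_count T) - real (level_count T')) / 2"
    using cT' by (simp add: field_simps)
  then have "ereal ((real n)\<^sup>2 / 16 - real n - 4)
      \<le> ereal ((real (level_count T) - real (level_count T')) / 2)" by simp
  also have "\<dots> \<le> graph_diameter (recom_metagraph (even_triangle n))"
    unfolding even_triangle_nodes
    by (rule graph_diameter_ge[OF finite_triangle_nodes T(1) T'])
  finally show ?thesis .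
qed

lemma graph_diameter_even_triangle_le:
  assumes "5 \<le> n"
  shows "graph_diameter (recom_metagraph (even_triangle n)) \<le> ereal (real flip_const * (real n)\<^sup>2)"
  using graph_diameter_le[OF finite_triangle_nodes connects_triangle_nodes[OF connects_triangle[OF assms]]]
  by (simp add: even_triangle_nodes)

theorem theorem1:
  shows "(\<forall>n::nat. n > 0 \<and> n \<notin> {3, 4} \<longrightarrow>
            Digraph_Component.connected (recom_metagraph (even_triangle n))) \<and>
         (\<lambda>n::nat. real_of_ereal (graph_diameter (recom_metagraph (even_triangle n))))
            \<in> \<Theta>(\<lambda>n. (real n)\<^sup>2)"
proof (intro conjI allI impI)
  fix n :: nat assume n: "n > 0 \<and> n \<notin> {3, 4}"
  then obtain K k where "connects (triangle n) K k"
    using connects_triangle_all by blast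
  from connected_recom_metagraph[OF finite_triangle_nodes connects_triangle_nodes[OF this]]
  show "Digraph_Component.connected (recom_metagraph (even_triangle n))"
    by (simp add: even_triangle_nodes)
next
  let ?d = "\<lambda>n. graph_diameter (recom_metagraph (even_triangle n))"
  define D where "D n = real_of_ereal (?d n)" for n
  have bounds: "(real n)\<^sup>2 / 16 - real n - 4 \<le> D n"
      "D n \<le> real flip_const * (real n)\<^sup>2" if "5 \<le> n" for n
    using graph_diameter_even_triangle_ge[OF that] graph_diameter_even_triangle_le[OF that]
    unfolding D_def by (cases "?d n"; simp)+
  have "D \<in> \<Theta>(\<lambda>n. (real n)\<^sup>2)"
  proof (rule bigthetaI)
    \<comment> \<open>From \<open>n = 36\<close> on, half of \<open>n\<^sup>2 / 16\<close> makes up for the linear term.\<close>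
    have lower: "0 \<le> D n \<and> (real n)\<^sup>2 / 32 \<le> D n" if "36 \<le> n" for n
    proof -
      have "36 * real n \<le> (real n)\<^sup>2"
        unfolding power2_eq_square using that by (intro mult_right_mono) auto
      then have "(real n)\<^sup>2 / 32 \<le> (real n)\<^sup>2 / 16 - real n - 4"
        using that by simp
      then have "(real n)\<^sup>2 / 32 \<le> D n"
        using bounds(1)[of n] that by linarith
      moreover have "0 \<le> (real n)\<^sup>2 / 32" by simp
      ultimately show ?thesis by linarith
    qed
    show "D \<in> O(\<lambda>n. (real n)\<^sup>2)"
    proof (rule bigoI)
      show "\<forall>\<^sub>F n in sequentially. norm (D n) \<le> real flip_const * norm ((real n)\<^sup>2)"
        using eventually_ge_at_top[of 36]
      proof eventually_elim
        case (elim n)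
        then show ?case using bounds(2)[of n] lower[of n] by simp
      qed
    qed
    show "D \<in> \<Omega>(\<lambda>n. (real n)\<^sup>2)"
    proof (rule landau_omega.bigI[of "1 / 32"])
      show "\<forall>\<^sub>F n in sequentially. 1 / 32 * norm ((real n)\<^sup>2) \<le> norm (D n)"
        using eventually_ge_at_top[of 36]
      proof eventually_elim
        case (elim n)
        then show ?case using lower[of n] by simp
      qed
    qed simp
  qed
  then show "(\<lambda>n. real_of_ereal (?d n)) \<in> \<Theta>(\<lambda>n. (real n)\<^sup>2)"
    unfolding D_def .
qed

end
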